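(* Let $1\le p<\infty$ and let $\mathcal{D}=\mathrm{Diff}(\mathbb{D}^2,\partial\mathbb{D}^2,\mathrm{area})$. There is a bi-Lipschitz embedding of the normed semigroup $\mathbb{R}^\infty_+$ into $(\mathcal{D},\mathbf{d}_p)$. Moreover, there is a bi-Lipschitz embedding of $\mathbb{R}^\infty_+$ into $(\mathrm{Ker}(\mathcal{C}),\mathbf{d}_p)$, where $\mathcal{C}\colon\mathcal{D}\to\mathbb{R}$ is the Calabi homomorphism.
   Context: Semigroup. $\mathbb{R}^\infty_+$ is the additive semigroup of all real sequences $v=(v_1,v_2,\dots)$ with $v_i\ge0$ for all $i$ and $v_i=0$ for all sufficiently large $i$ (finitely supported sequences), with the $\ell^1$-norm $\|v\|=\sum_i v_i$. Group. $\mathbb{D}^2$ is the closed unit disc in the Euclidean plane. $\mathcal{D}$ is the group of smooth area-preserving diffeomorphisms of $\mathbb{D}^2$ that equal the identity near the boundary. Calabi homomorphism. Every $g\in\mathcal{D}$ is the time-one map of the flow of a smooth time-dependent Hamiltonian $H_t\colon\mathbb{D}^2\to\mathbb{R}$, $t\in[0,1]$, vanishing near $\partial\mathbb{D}^2$; the Calabi homomorphism $\mathcal{C}\colon\mathcal{D}\to\mathbb{R}$ is $\mathcal{C}(g)=2\int_0^1\int_{\mathbb{D}^2}H_t(x)\,dx\,dt$, which is well defined (the normalizing constant is irrelevant for the kernel). $L^p$-metric. For a smooth isotopy $\{g_t\}_{t\in[0,1]}\subset\mathcal{D}$ put $\mathcal{L}_p\{g_t\}=\int_0^1\left(\int_{\mathbb{D}^2}\|\dot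 g_t(x)\|^p\,dx\right)^{1/p}dt$, with $\|\cdot\|$ the Euclidean norm. Define $\mathbf{d}_p(g_0,g_1)=\inf\mathcal{L}_p\{g_t\}$, the infimum over all smooth isotopies in $\mathcal{D}$ from $g_0$ to $g_1$ (a right-invariant metric); $\mathrm{Ker}(\mathcal{C})$ carries the restriction of $\mathbf{d}_p$. Put $\|g\|_p=\mathbf{d}_p(\mathrm{Id},g)$. Bi-Lipschitz embedding. For $G=\mathcal{D}$ or $G=\mathrm{Ker}(\mathcal{C})$, a bi-Lipschitz embedding $\mathbb{R}^\infty_+\to(G,\mathbf{d}_p)$ is an injective semigroup homomorphism $\Psi\colon\mathbb{R}^\infty_+\to G$ for which there is a constant $A\ge1$ with $A^{-1}\|v\|\le\|\Psi(v)\|_p\le A\|v\|$ for all $v\in\mathbb{R}^\infty_+$. *)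

theory Defs
  imports "HOL-Analysis.Analysis" "HOL-Library.Poly_Mapping"
begin

(* Meant for open S.  In finite dimension, a differentiable map all of whose directional
   derivatives are of class C^n is of class C^(n+1). *)
primrec Ck_on :: "nat \<Rightarrow> 'a::euclidean_space set \<Rightarrow> ('a \<Rightarrow> 'b::euclidean_space) \<Rightarrow> bool" where
  "Ck_on 0 S f \<longleftrightarrow> continuous_on S f"
| "Ck_on (Suc n) S f \<longleftrightarrow>
     (\<forall>x\<in>S. f differentiable (at x)) \<and> (\<forall>v. Ck_on n S (\<lambda>x. frechet_derivative f (at x) v))"

(* On a set that need not be open (the closed disc, or [0,1] times the closed disc), smooth means
   having a smooth extension to an open neighbourhood. *)
definition smooth_on :: "'a::euclidean_space set \<Rightarrow> ('a \<Rightarrow> 'b::euclidean_space) \<Rightarrow> bool" where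
  "smooth_on S f \<longleftrightarrow> (\<exists>U F. open U \<and> S \<subseteq> U \<and> (\<forall>k. Ck_on k U F) \<and> (\<forall>x\<in>S. F x = f x))"

definition disc :: "(real^2) set" where
  "disc = cball 0 1"

(* A map of the disc is represented by its extension by the identity to the whole plane, so that
   equality of maps is equality of HOL functions and the group operation is plain composition. *)
definition area_diff :: "(real^2 \<Rightarrow> real^2) set" where
  "area_diff = {g. g permutes disc \<and> smooth_on disc g \<and> smooth_on disc (inv g) \<and>
     (\<exists>r<1. \<forall>x\<in>disc. r \<le> norm x \<longrightarrow> g x = x) \<and>
     (\<forall>A\<in>sets lebesgue. A \<subseteq> disc \<longrightarrow> emeasure lebesgue (g ` A) = emeasure lebesgue A)}"

definition smooth_isotopy ::
    "(real \<Rightarrow> real^2 \<Rightarrow> real^2) \<Rightarrow> (real^2 \<Rightarrow> real^2) \<Rightarrow> (real^2 \<Rightarrow> real^2) \<Rightarrow> bool" where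
  "smooth_isotopy g g0 g1 \<longleftrightarrow>
     (\<forall>t\<in>{0..1}. g t \<in> area_diff) \<and> smooth_on ({0..1} \<times> disc) (\<lambda>(t, x). g t x) \<and>
     g 0 = g0 \<and> g 1 = g1"

definition Lp_length :: "real \<Rightarrow> (real \<Rightarrow> real^2 \<Rightarrow> real^2) \<Rightarrow> real" where
  "Lp_length p g =
     (LBINT t:{0..1}.
        (LBINT x:disc. norm (vector_derivative (\<lambda>s. g s x) (at t within {0..1})) powr p) powr (1 / p))"

(* Any two elements of area_diff are joined by a smooth isotopy, so for them the infimum is over a
   nonempty set. *)
definition Lp_dist :: "real \<Rightarrow> (real^2 \<Rightarrow> real^2) \<Rightarrow> (real^2 \<Rightarrow> real^2) \<Rightarrow> real" where
  "Lp_dist p g0 g1 = Inf {Lp_length p g |g. smooth_isotopy g g0 g1}"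

definition Lp_norm :: "real \<Rightarrow> (real^2 \<Rightarrow> real^2) \<Rightarrow> real" where
  "Lp_norm p g = Lp_dist p id g"

(* The Hamiltonian vector field (dh/dx2, -dh/dx1).  The opposite sign convention changes the Calabi
   homomorphism only by a sign. *)
definition ham_field :: "(real^2 \<Rightarrow> real) \<Rightarrow> real^2 \<Rightarrow> real^2" where
  "ham_field h x = vector [frechet_derivative h (at x within disc) (axis 2 1),
                           - frechet_derivative h (at x within disc) (axis 1 1)]"

definition hamiltonian :: "(real \<Rightarrow> real^2 \<Rightarrow> real) \<Rightarrow> bool" where
  "hamiltonian H \<longleftrightarrow> smooth_on ({0..1} \<times> disc) (\<lambda>(t, x). H t x) \<and>
     (\<exists>r<1. \<forall>t\<in>{0..1}. \<forall>x\<in>disc. r \<le> norm x \<longrightarrow> H t x = 0)"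

definition ham_flow :: "(real \<Rightarrow> real^2 \<Rightarrow> real) \<Rightarrow> (real \<Rightarrow> real^2 \<Rightarrow> real^2) \<Rightarrow> bool" where
  "ham_flow H \<phi> \<longleftrightarrow> (\<forall>x\<in>disc. \<phi> 0 x = x \<and>
     (\<forall>t\<in>{0..1}. \<phi> t x \<in> disc \<and>
        ((\<lambda>s. \<phi> s x) has_vector_derivative ham_field (H t) (\<phi> t x)) (at t within {0..1})))"

definition generates :: "(real \<Rightarrow> real^2 \<Rightarrow> real) \<Rightarrow> (real^2 \<Rightarrow> real^2) \<Rightarrow> bool" where
  "generates H g \<longleftrightarrow> hamiltonian H \<and> (\<exists>\<phi>. ham_flow H \<phi> \<and> (\<forall>x\<in>disc. \<phi> 1 x = g x))"

(* For g in area_diff a generating Hamiltonian exists and the double integral does not depend on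
   its choice. *)
definition calabi :: "(real^2 \<Rightarrow> real^2) \<Rightarrow> real" where
  "calabi g = (THE c. \<exists>H. generates H g \<and> c = 2 * (LBINT t:{0..1}. (LBINT x:disc. H t x)))"

definition ker_calabi :: "(real^2 \<Rightarrow> real^2) set" where
  "ker_calabi = {g \<in> area_diff. calabi g = 0}"

definition Rinf_plus :: "(nat \<Rightarrow>\<^sub>0 real) set" where
  "Rinf_plus = {v. \<forall>i. 0 \<le> Poly_Mapping.lookup v i}"

definition l1_norm :: "(nat \<Rightarrow>\<^sub>0 real) \<Rightarrow> real" where
  "l1_norm v = (\<Sum>i\<in>Poly_Mapping.keys v. \<bar>Poly_Mapping.lookup v i\<bar>)"

definition bilipschitz_embedding ::
    "real \<Rightarrow> (real^2 \<Rightarrow> real^2) set \<Rightarrow> ((nat \<Rightarrow>\<^sub>0 real) \<Rightarrow> real^2 \<Rightarrow> real^2) \<Rightarrow> bool" where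
  "bilipschitz_embedding p G \<Psi> \<longleftrightarrow>
     \<Psi> ` Rinf_plus \<subseteq> G \<and> inj_on \<Psi> Rinf_plus \<and>
     (\<forall>v\<in>Rinf_plus. \<forall>w\<in>Rinf_plus. \<Psi> (v + w) = \<Psi> v \<circ> \<Psi> w) \<and>
     (\<exists>A\<ge>1. \<forall>v\<in>Rinf_plus. inverse A * l1_norm v \<le> Lp_norm p (\<Psi> v) \<and> Lp_norm p (\<Psi> v) \<le> A * l1_norm v)"

end

theory Submission
  imports Defs
begin

text \<open>
  All maps in the image are twists, rotating the circle of radius $r$ by an angle $\theta(r^2)$; twists
  commute and $\theta$ depends linearly on $v$.  Rotating at constant speed gives the upper bound.

  For the lower bound, follow for each pair of points the total change of the argument of their
  difference along an isotopy.  It does not depend on the isotopy, because the disc is fixed near its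
  boundary and the space of pairs is connected; for a twist and $|x| < |y|$ it equals
  $\theta(|y|^2)$ up to two terms that cancel after integration over $x$ and $y$.  On the other hand it is at
  most the integral over time of the relative speed divided by the distance, and $1/|x-y|$ is
  integrable in the plane, so its integral over all pairs is bounded by the $L^1$-length.  This needs
  $\theta$ to be positive only on one annulus, so the disc inside it is free to make the Calabi
  invariant vanish.

  The Calabi invariant is well defined because the integral of $H$ is determined by the integral of
  the action of the trajectories, the differential of the action is determined by the time-one map, and
  Hamiltonian flows preserve area.
\<close>

section \<open>Smooth functions\<close>

text \<open>\<open>calabi\<close> is given by a description, so all Hamiltonians generating one map
  must have the same integral, while \<open>ham_flow\<close> supplies only pointwise solutions of an
  ODE. Gronwall estimates, Euler polygons and quadratic error bounds therefore take the place of
  derivatives of the flow. The supports of the bumps overlap on purpose: all outer bumps are bounded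
  below on one common annulus, and since the coordinates of v are nonnegative the angle there is at
  least a constant times the l1-norm. Differences of two elements of the semigroup have coordinates
  of both signs, so the lower bound does not by itself give injectivity; that is read off from the
  distinct end points of the bumps. The constants do not depend on p, because the L^1-norm is
  controlled by the L^p-norm on a disc of finite area. One map serves both claims: the kernel lies
  in the whole group and carries the same norm, with isotopies through the whole group.\<close>

lemma frechet_derivative_cong_open:
  assumes "open S" "x \<in> S" "\<And>y. y \<in> S \<Longrightarrow> f y = g y"
  shows "frechet_derivative f (at x) = frechet_derivative g (at x)"
    and "f differentiable (at x) \<longleftrightarrow> g differentiable (at x)"
proof -
  have "(f has_derivative D) (at x) \<longleftrightarrow> (g has_derivative D) (at x)" for D
    using has_derivative_transform_within_open[of _ D x UNIV S] assms by metis
  then show "frechet_derivative f (at x) = frechet_derivative g (at x)"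
    and "f differentiable (at x) \<longleftrightarrow> g differentiable (at x)"
    by (auto simp: frechet_derivative_def differentiable_def)
qed

lemma Ck_on_cong:
  assumes "open S" "\<And>x. x \<in> S \<Longrightarrow> f x = g x"
  shows "Ck_on n S f \<longleftrightarrow> Ck_on n S g"
  using assms(2)
proof (induction n arbitrary: f g)
  case 0
  then show ?case using continuous_on_cong[of S S f g] by simp
next
  case (Suc n)
  have "Ck_on n S (\<lambda>x. frechet_derivative f (at x) v) = Ck_on n S (\<lambda>x. frechet_derivative g (at x) v)" for v
    using frechet_derivative_cong_open(1)[OF assms(1), of _ f g] Suc.prems by (intro Suc.IH) auto
  moreover have "(\<forall>x\<in>S. f differentiable (at x)) \<longleftrightarrow> (\<forall>x\<in>S. g differentiable (at x))"
    using frechet_derivative_cong_open(2)[OF assms(1), of _ f g] Suc.prems by blast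
  ultimately show ?case by simp
qed

text \<open>Regularity can be checked on any explicitly written derivative \<open>f'\<close>;
  uniqueness of derivatives identifies it with \<open>frechet_derivative\<close>. The closure rules
  below go through this form.\<close>

lemma Ck_on_SucI:
  assumes "open S" "\<And>x. x \<in> S \<Longrightarrow> (f has_derivative f' x) (at x)" "\<And>v. Ck_on n S (\<lambda>x. f' x v)"
  shows "Ck_on (Suc n) S f"
proof -
  have "frechet_derivative f (at x) = f' x" if "x \<in> S" for x
    using assms(2)[OF that] by (simp add: frechet_derivative_at[symmetric])
  then have "Ck_on n S (\<lambda>x. frechet_derivative f (at x) v)" for v
    using Ck_on_cong[OF assms(1), of "\<lambda>x. frechet_derivative f (at x) v" "\<lambda>x. f' x v"] assms(3) by simp
  then show ?thesis using assms(2) by (auto simp: differentiable_def)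
qed

lemma Ck_on_Suc_has_derivative:
  assumes "Ck_on (Suc n) S f" "x \<in> S"
  shows "(f has_derivative frechet_derivative f (at x)) (at x)"
  using assms by (simp add: frechet_derivative_works)

lemma Ck_on_SucD: "Ck_on (Suc n) S f \<Longrightarrow> Ck_on n S f"
proof (induction n arbitrary: f)
  case 0
  then show ?case
    by (auto intro!: differentiable_imp_continuous_on simp: differentiable_on_def differentiable_at_withinI)
next
  case (Suc n)
  then show ?case by (metis Ck_on.simps(2))
qed

lemma Ck_on_const: "open S \<Longrightarrow> Ck_on n S (\<lambda>x. c)"
proof (induction n arbitrary: c)
  case (Suc n)
  show ?case by (rule Ck_on_SucI[OF Suc.prems, where f' = "\<lambda>_ _. 0"]) (auto intro: Suc)
qed (auto intro: continuous_intros)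

lemma Ck_on_bounded_linear:
  assumes "open S" "bounded_linear f" shows "Ck_on n S f"
proof (cases n)
  case 0
  then show ?thesis by (simp add: assms(2) linear_continuous_on)
next
  case (Suc m)
  show ?thesis unfolding Suc
    by (rule Ck_on_SucI[OF assms(1), where f' = "\<lambda>_. f"])
       (auto intro: Ck_on_const assms bounded_linear_imp_has_derivative)
qed

lemma Ck_on_add:
  assumes "open S" shows "Ck_on n S f \<Longrightarrow> Ck_on n S g \<Longrightarrow> Ck_on n S (\<lambda>x. f x + g x)"
proof (induction n arbitrary: f g)
  case (Suc n)
  show ?case
    by (rule Ck_on_SucI[OF assms, where f' = "\<lambda>x v. frechet_derivative f (at x) v + frechet_derivative g (at x) v"])
       (use Suc in \<open>auto intro!: has_derivative_add simp: frechet_derivative_works\<close>)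
qed (auto intro: continuous_intros)

text \<open>Leibniz rule: each summand of the derivative is again \<open>prod\<close> of one factor
  and a derivative of the other, so the induction also needs both factors at the lower order, which
  \<open>Ck_on_SucD\<close> supplies.\<close>

lemma Ck_on_bilinear:
  fixes prod :: "'b::euclidean_space \<Rightarrow> 'c::euclidean_space \<Rightarrow> 'd::euclidean_space"
  assumes "bounded_bilinear prod" "open S" shows "Ck_on n S f \<Longrightarrow> Ck_on n S g \<Longrightarrow> Ck_on n S (\<lambda>x. prod (f x) (g x))"
proof (induction n arbitrary: f g)
  case 0
  then show ?case by (simp add: bounded_bilinear.continuous_on[OF assms(1)])
next
  case (Suc n)
  have p: "Ck_on n S (\<lambda>x. frechet_derivative f (at x) v)" "Ck_on n S (\<lambda>x. frechet_derivative g (at x) v)"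
      "Ck_on n S f" "Ck_on n S g" for v
    using Suc.prems Ck_on_SucD by auto
  show ?case
    by (rule Ck_on_SucI[OF assms(2) bounded_bilinear.FDERIV[OF assms(1)
            Ck_on_Suc_has_derivative[OF Suc.prems(1)] Ck_on_Suc_has_derivative[OF Suc.prems(2)]]])
       (assumption | intro Ck_on_add assms Suc.IH p)+
qed

lemmas Ck_on_scaleR = Ck_on_bilinear[OF bounded_bilinear_scaleR]
lemmas Ck_on_inner = Ck_on_bilinear[OF bounded_bilinear_inner]
lemmas Ck_on_mult = Ck_on_bilinear[OF bounded_bilinear_mult]

text \<open>The outer function comes with its whole sequence of derivatives. Differentiating
  \<open>h k (f x)\<close> produces \<open>h (Suc k) (f x)\<close> times a derivative of
  \<open>f\<close>, so the induction on the order closes once \<open>k\<close> is arbitrary.\<close>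

lemma Ck_on_compose_real:
  fixes h :: "nat \<Rightarrow> real \<Rightarrow> real"
  assumes "open S" "\<And>k x. (h k has_real_derivative h (Suc k) x) (at x)" "Ck_on n S f"
  shows "Ck_on n S (\<lambda>x. h k (f x))"
  using assms(3)
proof (induction n arbitrary: k)
  case 0
  have "continuous_on UNIV (h k)"
    by (meson DERIV_isCont assms(2) continuous_at_imp_continuous_on)
  with 0 show ?case
    using continuous_on_compose2[of UNIV "h k" S f] by auto
next
  case (Suc n)
  have p: "Ck_on n S (\<lambda>x. frechet_derivative f (at x) v)" "Ck_on n S f" for v
    using Suc.prems Ck_on_SucD by auto
  show ?case
    by (rule Ck_on_SucI[OF assms(1) DERIV_compose_FDERIV[OF assms(2) Ck_on_Suc_has_derivative[OF Suc.prems]]])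
       (assumption | intro Ck_on_mult assms(1) Suc.IH p)+
qed

lemma Ck_on_sin_cos:
  assumes "open S" "Ck_on n S f"
  shows "Ck_on n S (\<lambda>x. sin (f x :: real))" "Ck_on n S (\<lambda>x. cos (f x :: real))"
proof -
  \<comment> \<open>Differentiating the sine is a shift by a quarter turn, so one sequence serves
    both functions: index 0 gives sin and index 1 gives cos.\<close>
  define h :: "nat \<Rightarrow> real \<Rightarrow> real" where "h k x = sin (x + of_nat k * (pi / 2))" for k x
  have "(h k has_real_derivative h (Suc k) x) (at x)" for k x
  proof -
    have "h (Suc k) x = cos (x + of_nat k * (pi / 2))"
    proof -
      have "x + of_nat (Suc k) * (pi / 2) = (x + of_nat k * (pi / 2)) + pi / 2"
        by (simp add: field_simps)
      then show ?thesis unfolding h_def by (simp only: sin_add) simp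
    qed
    moreover have "(h k has_real_derivative cos (x + of_nat k * (pi / 2))) (at x)"
      unfolding h_def by (auto intro!: derivative_eq_intros)
    ultimately show ?thesis by simp
  qed
  from Ck_on_compose_real[where h = h and k = 0, OF assms(1) this assms(2)]
    Ck_on_compose_real[where h = h and k = 1, OF assms(1) this assms(2)]
  show "Ck_on n S (\<lambda>x. sin (f x :: real))" "Ck_on n S (\<lambda>x. cos (f x :: real))"
    by (simp_all add: h_def sin_add)
qed

text \<open>The mean value theorem is applied twice: along \<open>u\<close> to the difference of
  \<open>f\<close> between points \<open>h v\<close> apart, then along \<open>v\<close> to the
  derivative in direction \<open>u\<close>. The second difference is symmetric in \<open>u\<close>
  and \<open>v\<close>, the expression found for it is not; this is the source of the symmetry of
  second derivatives.\<close>

lemma second_difference_mean_value: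
  fixes f :: "'a::euclidean_space \<Rightarrow> real"
  assumes "Ck_on 2 (ball x e) f" "0 < h" "h * (norm u + norm v) < e"
  obtains y where "dist x y \<le> h * (norm u + norm v)"
    "f (x + h *\<^sub>R u + h *\<^sub>R v) - f (x + h *\<^sub>R u) - f (x + h *\<^sub>R v) + f x
      = h\<^sup>2 * frechet_derivative (\<lambda>x. frechet_derivative f (at x) u) (at y) v"
proof -
  have C1: "Ck_on (Suc 1) (ball x e) f" using assms(1) by (simp add: numeral_2_eq_2)
  have inb: "x + a *\<^sub>R u + b *\<^sub>R v \<in> ball x e" "dist x (x + a *\<^sub>R u + b *\<^sub>R v) \<le> h * (norm u + norm v)"
    if "0 \<le> a" "a \<le> h" "0 \<le> b" "b \<le> h" for a b
  proof -
    have "dist x (x + a *\<^sub>R u + b *\<^sub>R v) = norm (a *\<^sub>R u + b *\<^sub>R v)"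
      by (subst dist_commute) (simp add: dist_norm)
    also have "\<dots> \<le> a * norm u + b * norm v"
      using norm_triangle_ineq[of "a *\<^sub>R u" "b *\<^sub>R v"] that by simp
    also have "\<dots> \<le> h * (norm u + norm v)"
      using that by (simp add: distrib_left add_mono mult_right_mono)
    finally show "dist x (x + a *\<^sub>R u + b *\<^sub>R v) \<le> h * (norm u + norm v)" .
    then show "x + a *\<^sub>R u + b *\<^sub>R v \<in> ball x e" using assms(3) by simp
  qed
  define G where "G = (\<lambda>z. frechet_derivative f (at z) u)"
  have df: "(f has_derivative frechet_derivative f (at z)) (at z)" if "z \<in> ball x e" for z
    using Ck_on_Suc_has_derivative[OF C1 that] .
  have dG: "(G has_derivative frechet_derivative G (at z)) (at z)" if "z \<in> ball x e" for z
    using C1 that Ck_on_Suc_has_derivative[of 0 "ball x e" G z] by (simp add: G_def)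
  have lin: "D (c *\<^sub>R w) = c * D w" if "(F has_derivative D) F'" for F :: "'a \<Rightarrow> real" and D F' c w
    using has_derivative_linear[OF that] by (simp add: linear_cmul)
  have "\<exists>a. 0 < a \<and> a < h \<and> (f (x + h *\<^sub>R u + h *\<^sub>R v) - f (x + h *\<^sub>R u + 0 *\<^sub>R v)) - (f (x + 0 *\<^sub>R u + h *\<^sub>R v) - f (x + 0 *\<^sub>R u + 0 *\<^sub>R v))
      = (h - 0) * (G (x + a *\<^sub>R u + h *\<^sub>R v) - G (x + a *\<^sub>R u + 0 *\<^sub>R v))"
  proof (rule MVT2[OF assms(2)])
    fix a assume a: "0 \<le> a" "a \<le> h"
    have "((\<lambda>a. f (x + a *\<^sub>R u + b *\<^sub>R v)) has_real_derivative G (x + a *\<^sub>R u + b *\<^sub>R v)) (at a)" if "b = 0 \<or> b = h" for b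
    proof -
      have z: "x + a *\<^sub>R u + b *\<^sub>R v \<in> ball x e" using inb(1)[of a b] a that assms(2) by auto
      have "((\<lambda>a. f (x + a *\<^sub>R u + b *\<^sub>R v)) has_derivative (\<lambda>t. frechet_derivative f (at (x + a *\<^sub>R u + b *\<^sub>R v)) (t *\<^sub>R u))) (at a)"
        by (rule has_derivative_compose[where g = f and f = "\<lambda>a. x + a *\<^sub>R u + b *\<^sub>R v", OF _ df[OF z]]) (auto intro!: derivative_eq_intros)
      then show ?thesis
        by (simp add: has_field_derivative_def lin[OF df[OF z]] G_def mult_commute_abs)
    qed
    from DERIV_diff[OF this[of h] this[of 0]]
    show "((\<lambda>a. f (x + a *\<^sub>R u + h *\<^sub>R v) - f (x + a *\<^sub>R u + 0 *\<^sub>R v)) has_real_derivative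
            (G (x + a *\<^sub>R u + h *\<^sub>R v) - G (x + a *\<^sub>R u + 0 *\<^sub>R v))) (at a)"
      by simp
  qed
  then obtain a where a: "0 < a" "a < h" and ea: "(f (x + h *\<^sub>R u + h *\<^sub>R v) - f (x + h *\<^sub>R u)) - (f (x + h *\<^sub>R v) - f x)
      = h * (G (x + a *\<^sub>R u + h *\<^sub>R v) - G (x + a *\<^sub>R u + 0 *\<^sub>R v))" by auto
  have "\<exists>b. 0 < b \<and> b < h \<and> G (x + a *\<^sub>R u + h *\<^sub>R v) - G (x + a *\<^sub>R u + 0 *\<^sub>R v) = (h - 0) * frechet_derivative G (at (x + a *\<^sub>R u + b *\<^sub>R v)) v"
  proof (rule MVT2[OF assms(2)])
    fix b assume b: "0 \<le> b" "b \<le> h"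
    have z: "x + a *\<^sub>R u + b *\<^sub>R v \<in> ball x e" using inb a b by auto
    have "((\<lambda>b. G (x + a *\<^sub>R u + b *\<^sub>R v)) has_derivative (\<lambda>t. frechet_derivative G (at (x + a *\<^sub>R u + b *\<^sub>R v)) (t *\<^sub>R v))) (at b)"
      by (rule has_derivative_compose[where g = G and f = "\<lambda>b. x + a *\<^sub>R u + b *\<^sub>R v", OF _ dG[OF z]]) (auto intro!: derivative_eq_intros)
    then show "((\<lambda>b. G (x + a *\<^sub>R u + b *\<^sub>R v)) has_real_derivative frechet_derivative G (at (x + a *\<^sub>R u + b *\<^sub>R v)) v) (at b)"
      by (simp add: has_field_derivative_def lin[OF dG[OF z]] mult_commute_abs)
  qed
  then obtain b where b: "0 < b" "b < h" and eb: "G (x + a *\<^sub>R u + h *\<^sub>R v) - G (x + a *\<^sub>R u + 0 *\<^sub>R v) = h * frechet_derivative G (at (x + a *\<^sub>R u + b *\<^sub>R v)) v"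
    by auto
  show thesis
    by (rule that[of "x + a *\<^sub>R u + b *\<^sub>R v"])
       (use a b inb ea eb in \<open>auto simp: G_def power2_eq_square algebra_simps\<close>)
qed

lemma second_derivative_symmetric:
  fixes f :: "'a::euclidean_space \<Rightarrow> real"
  assumes "open U" "x \<in> U" "Ck_on 2 U f"
  shows "frechet_derivative (\<lambda>x. frechet_derivative f (at x) u) (at x) v
       = frechet_derivative (\<lambda>x. frechet_derivative f (at x) v) (at x) u"
proof -
  define A where "A = (\<lambda>u v y. frechet_derivative (\<lambda>x. frechet_derivative f (at x) u) (at y) v)"
  have cont: "continuous_on U (A u v)" for u v
    using assms(3) by (simp add: numeral_2_eq_2 A_def)
  have Ck_sub: "Ck_on n T f" if "T \<subseteq> S" "Ck_on n S f" for n S T and f :: "'a \<Rightarrow> real"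
    using that(2) by (induction n arbitrary: f) (use that(1) in \<open>auto intro: continuous_on_subset\<close>)
  obtain e where e: "e > 0" "ball x e \<subseteq> U" using assms openE by blast
  have C2: "Ck_on 2 (ball x e) f" using Ck_sub[OF e(2) assms(3)] .
  define K where "K = norm u + norm v + 1"
  have K: "K > 0" by (simp add: K_def add_nonneg_pos)
  have le: "\<bar>A u v x - A v u x\<bar> \<le> 2 * d" if d: "d > 0" for d
  proof -
    have "isCont (A u v) x" "isCont (A v u) x"
      using cont assms(1,2) by (auto simp: continuous_on_eq_continuous_at)
    then obtain r1 r2 where r: "r1 > 0" "\<And>y. dist y x < r1 \<Longrightarrow> dist (A u v y) (A u v x) < d"
        "r2 > 0" "\<And>y. dist y x < r2 \<Longrightarrow> dist (A v u y) (A v u x) < d"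
      using d unfolding continuous_at_eps_delta by (metis dist_commute)
    \<comment> \<open>So small that both intermediate points lie where the two second derivatives
      are within \<open>d\<close> of their values at \<open>x\<close>. The summand 1 in
      \<open>K\<close> keeps the denominator positive for \<open>u = v = 0\<close>.\<close>
    define h where "h = min e (min r1 r2) / (2 * K)"
    have h: "h > 0" using e r K by (simp add: h_def)
    have hK: "h * (norm u + norm v) < min e (min r1 r2)"
    proof -
      have "h * (norm u + norm v) < h * K" using h by (simp add: K_def)
      also have "\<dots> = min e (min r1 r2) / 2" using K by (simp add: h_def)
      also have "\<dots> < min e (min r1 r2)"
      proof -
        have "min e (min r1 r2) > 0" using e r by simp
        then show ?thesis by linarith
      qed
      finally show ?thesis .
    qed
    obtain y where y: "dist x y \<le> h * (norm u + norm v)"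
      "f (x + h *\<^sub>R u + h *\<^sub>R v) - f (x + h *\<^sub>R u) - f (x + h *\<^sub>R v) + f x = h\<^sup>2 * A u v y"
      using second_difference_mean_value[OF C2 h, of u v] hK by (auto simp: A_def)
    obtain z where z: "dist x z \<le> h * (norm v + norm u)"
      "f (x + h *\<^sub>R v + h *\<^sub>R u) - f (x + h *\<^sub>R v) - f (x + h *\<^sub>R u) + f x = h\<^sup>2 * A v u z"
      using second_difference_mean_value[OF C2 h, of v u] hK by (auto simp: A_def add.commute)
    have "h\<^sup>2 * A u v y = h\<^sup>2 * A v u z" using y(2) z(2) by (simp add: algebra_simps)
    then have "A u v y = A v u z" using h by simp
    moreover have "dist (A u v y) (A u v x) < d" "dist (A v u z) (A v u x) < d"
      using r(2)[of y] r(4)[of z] y(1) z(1) hK by (auto simp: dist_commute add.commute)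
    ultimately show ?thesis by (simp add: dist_real_def)
  qed
  have "\<bar>A u v x - A v u x\<bar> \<le> 0"
    by (rule field_le_epsilon) (use le[of "_ / 2"] in auto)
  then show ?thesis by (simp add: A_def)
qed

text \<open>\<open>flat k\<close> is the \<open>k\<close>-th derivative of $e^{-1/x}$, extended by $0$ to $x \le 0$.\<close>

definition flat_poly :: "nat \<Rightarrow> real poly" where
  "flat_poly k = ((\<lambda>p. [:0, 0, 1:] * (p - pderiv p)) ^^ k) 1"

definition flat :: "nat \<Rightarrow> real \<Rightarrow> real" where
  "flat k x = (if x > 0 then poly (flat_poly k) (1 / x) * exp (- (1 / x)) else 0)"

lemma tendsto_poly_exp_0: "((\<lambda>x::real. poly p x * exp (- x)) \<longlongrightarrow> 0) at_top"
proof -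
  \<comment> \<open>The extra factor \<open>x ^ n\<close> absorbs the shift of powers when a
    coefficient is split off the polynomial; \<open>n = 0\<close> is the claim.\<close>
  have "((\<lambda>x::real. x ^ n * (poly p x * exp (- x))) \<longlongrightarrow> 0) at_top" for n
  proof (induction p arbitrary: n)
    case (pCons a p)
    have "((\<lambda>x::real. a * (x ^ n / exp x) + x ^ Suc n * (poly p x * exp (- x))) \<longlongrightarrow> a * 0 + 0) at_top"
      by (intro tendsto_intros pCons tendsto_power_div_exp_0)
    then show ?case
      by (simp add: algebra_simps exp_minus divide_inverse)
  qed simp
  from this[of 0] show ?thesis by simp
qed

text \<open>With y = 1/x, the derivative of P(y) e^(-y) in x is y^2 (P(y) - P'(y)) e^(-y), which is
  the recursion in \<open>flat_poly\<close>. At 0 the difference quotient from the right is y P(y)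
  e^(-y) with y = 1/h, which tends to 0.\<close>

lemma flat_has_derivative: "(flat k has_real_derivative flat (Suc k) x) (at x)"
proof -
  consider "x < 0" | "x > 0" | "x = 0" by linarith
  then show ?thesis
  proof cases
    case 1
    have "((\<lambda>x. 0) has_real_derivative 0) (at x)" by simp
    then have "(flat k has_real_derivative 0) (at x)"
      by (rule has_field_derivative_transform_within_open[of _ _ _ "{..<0}"]) (use 1 in \<open>auto simp: flat_def\<close>)
    then show ?thesis using 1 by (simp add: flat_def)
  next
    case 2
    have "((\<lambda>x. poly (flat_poly k) (1 / x) * exp (- (1 / x))) has_real_derivative flat (Suc k) x) (at x)"
      using 2 by (auto intro!: derivative_eq_intros poly_DERIV[THEN DERIV_chain2]
         simp: flat_def flat_poly_def algebra_simps power2_eq_square)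
    then show ?thesis
      by (rule has_field_derivative_transform_within_open[of _ _ _ "{0<..}"]) (use 2 in \<open>auto simp: flat_def\<close>)
  next
    case 3
    have "((\<lambda>h. poly (pCons 0 (flat_poly k)) (inverse h) * exp (- inverse h)) \<longlongrightarrow> 0) (at_right 0)"
      by (rule filterlim_compose[OF tendsto_poly_exp_0 filterlim_inverse_at_top_right])
    then have "((\<lambda>h. (flat k h - flat k 0) / h) \<longlongrightarrow> 0) (at_right 0)"
      by (rule Lim_transform_eventually)
         (auto simp: eventually_at_filter flat_def divide_inverse mult_ac intro!: always_eventually)
    moreover have "((\<lambda>h. (flat k h - flat k 0) / h) \<longlongrightarrow> 0) (at_left 0)"
      by (rule tendsto_eventually) (auto simp: eventually_at_filter flat_def intro!: always_eventually)
    ultimately have "((\<lambda>h. (flat k h - flat k 0) / h) \<longlongrightarrow> 0) (at 0)"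
      by (rule filterlim_split_at[rotated])
    then show ?thesis using 3 by (simp add: DERIV_def flat_def)
  qed
qed

section \<open>Area preservation of divergence-free flows\<close>

lemma disc_simps [simp]: "compact disc" "convex disc" "closed disc" "disc \<noteq> {}" "disc \<in> sets lebesgue"
    "disc \<in> sets borel" "bounded disc"
  by (auto simp: disc_def)

lemma mem_disc: "x \<in> disc \<longleftrightarrow> norm x \<le> 1"
  by (simp add: disc_def)

lemma continuous_on_slices:
  assumes "continuous_on (A \<times> B) (\<lambda>(t, x). f t x)"
  shows "t \<in> A \<Longrightarrow> continuous_on B (f t)" "x \<in> B \<Longrightarrow> continuous_on A (\<lambda>t. f t x)"
  using continuous_on_compose2[OF assms, of B "\<lambda>x. (t, x)"] continuous_on_compose2[OF assms, of A "\<lambda>t. (t, x)"]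
  by (auto simp: continuous_on_Pair image_subset_iff)

lemma set_integral_nonneg_everywhere: "(\<And>x. 0 \<le> f x) \<Longrightarrow> 0 \<le> (LBINT x:A. f x :: real)"
  unfolding set_lebesgue_integral_def by (rule Bochner_Integration.integral_nonneg) auto

lemma vector_mean_value_bound:
  fixes g :: "real \<Rightarrow> 'a::real_normed_vector"
  assumes "\<And>s. s \<in> {a..b} \<Longrightarrow> (g has_vector_derivative g' s) (at s within {a..b})"
    "\<And>s. s \<in> {a..b} \<Longrightarrow> norm (g' s) \<le> K" "a \<le> b"
  shows "norm (g b - g a) \<le> K * (b - a)"
proof -
  have "onorm (\<lambda>h. h *\<^sub>R g' s) \<le> K" if "s \<in> {a..b}" for s
    using assms(2)[OF that] onorm_scaleR_left[of "\<lambda>x::real. x" "g' s"] onorm_id[where 'a = real]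
    by (simp add: bounded_linear_ident)
  then have "norm (g b - g a) \<le> K * norm (b - a)"
    using assms by (intro differentiable_bound[of "{a..b}"]) (auto simp: has_vector_derivative_def)
  then show ?thesis using assms(3) by simp
qed

lemma continuous_on_compact_absolutely_integrable:
  fixes f :: "'a::euclidean_space \<Rightarrow> 'b::euclidean_space"
  assumes "compact S" "continuous_on S f"
  shows "f absolutely_integrable_on S" "f integrable_on S" "set_integrable lborel S f"
proof -
  show s: "set_integrable lborel S f"
    unfolding set_integrable_def by (rule borel_integrable_compact[OF assms])
  then show a: "f absolutely_integrable_on S"
    unfolding set_integrable_def by (subst integrable_completion) auto
  show "f integrable_on S" using set_lebesgue_integral_eq_integral(1)[OF a] .
qed

lemma integral_change_of_variables_scalar:
  fixes f :: "real^'m::{finite,wellorder} \<Rightarrow> real" and g :: "real^'m::_ \<Rightarrow> real^'m::_"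
  assumes "S \<in> sets lebesgue"
    "\<And>x. x \<in> S \<Longrightarrow> (g has_derivative g' x) (at x within S)" "inj_on g S"
    "f absolutely_integrable_on (g ` S)"
  shows "integral (g ` S) f = integral S (\<lambda>x. \<bar>det (matrix (g' x))\<bar> * f (g x))"
    and "(\<lambda>x. \<bar>det (matrix (g' x))\<bar> * f (g x)) absolutely_integrable_on S"
  using has_absolute_integral_change_of_variables[OF assms(1-3), of "\<lambda>x. vec (f x) :: real^1" "vec (integral (g ` S) f)"] assms(4)
  unfolding absolutely_integrable_on_1_iff integral_on_1_eq by auto

lemma matrix_2_entries: "matrix (f :: real^2 \<Rightarrow> real^2) $ i $ j = f (axis j 1) $ i"
  by (simp add: matrix_def)

text \<open>Composing \<open>V\<close> with the nearest point projection, which is 1-Lipschitz,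
  extends it to the plane; outside the disc the extension is 0, because nearest points lie on the
  circle. With h L at most 1/2 a preimage of y is the fixed point of a contraction, and it lies in
  the disc because points outside are fixed by the extended map.\<close>

lemma lipschitz_perturbation_bij:
  fixes V :: "real^2 \<Rightarrow> real^2"
  assumes lip_space: "\<And>x y. x \<in> disc \<Longrightarrow> y \<in> disc \<Longrightarrow> norm (V x - V y) \<le> L * norm (x - y)"
    and supp: "\<And>x. norm x = 1 \<Longrightarrow> V x = 0" and L: "0 \<le> L" and h: "0 \<le> h" "h * L \<le> 1 / 2"
  shows "inj_on (\<lambda>x. x + h *\<^sub>R V x) disc" "(\<lambda>x. x + h *\<^sub>R V x) ` disc = disc"
proof -
  let ?c = "closest_point disc"
  have c_disc: "?c x \<in> disc" for x by (simp add: closest_point_in_set)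
  have c_self: "?c x = x" if "x \<in> disc" for x using that by (simp add: closest_point_self)
  have X0: "V (?c x) = 0" if "x \<notin> disc" for x
  proof -
    have "interior disc \<noteq> {}" by (simp add: disc_def)
    moreover have "x \<notin> interior disc" using that interior_subset by blast
    ultimately have "?c x \<in> frontier disc"
      using closest_point_in_rel_frontier[of disc x]
      by (simp add: rel_interior_nonempty_interior affine_hull_nonempty_interior rel_frontier_nonempty_interior)
    then have "norm (?c x) = 1" by (simp add: disc_def)
    then show ?thesis using supp by simp
  qed
  have contr: "dist (h *\<^sub>R V (?c x)) (h *\<^sub>R V (?c y)) \<le> 1 / 2 * dist x y" for x y
  proof -
    have "dist (h *\<^sub>R V (?c x)) (h *\<^sub>R V (?c y)) = h * norm (V (?c x) - V (?c y))"
      using h by (simp add: dist_norm flip: scaleR_diff_right)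
    also have "\<dots> \<le> h * (L * dist (?c x) (?c y))"
      using lip_space[OF c_disc c_disc] h by (intro mult_left_mono) (auto simp: dist_norm)
    also have "\<dots> \<le> h * (L * dist x y)"
      using h L by (intro mult_left_mono closest_point_lipschitz) auto
    also have "\<dots> \<le> 1 / 2 * dist x y" using h(2) mult_right_mono[OF h(2), of "dist x y"] by (simp add: mult.assoc)
    finally show ?thesis .
  qed
  have inj: "x = y" if "x + h *\<^sub>R V (?c x) = y + h *\<^sub>R V (?c y)" for x y
  proof -
    have "x = y + h *\<^sub>R V (?c y) - h *\<^sub>R V (?c x)"
      using that by (simp add: eq_diff_eq)
    then have "x - y = h *\<^sub>R V (?c y) - h *\<^sub>R V (?c x)" by (metis add_diff_cancel_left' add_diff_eq)
    then have "dist x y = dist (h *\<^sub>R V (?c y)) (h *\<^sub>R V (?c x))" by (simp add: dist_norm)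
    then have "dist x y \<le> 1 / 2 * dist x y" using contr[of y x] by (simp only: dist_commute)
    then show ?thesis by simp
  qed
  show "inj_on (\<lambda>x. x + h *\<^sub>R V x) disc"
  proof (rule inj_onI)
    fix x y assume "x \<in> disc" "y \<in> disc" "(x + h *\<^sub>R V x) = (y + h *\<^sub>R V y)"
    then show "x = y" using inj[of x y] c_self[of x] c_self[of y] by simp
  qed
  show "(\<lambda>x. x + h *\<^sub>R V x) ` disc = disc"
  proof (intro equalityI subsetI)
    fix z assume "z \<in> (\<lambda>x. x + h *\<^sub>R V x) ` disc"
    then obtain x where x: "x \<in> disc" "z = x + h *\<^sub>R V (?c x)" by (auto simp: c_self)
    show "z \<in> disc"
    proof (rule ccontr)
      assume "z \<notin> disc"
      then have "z = x" using x X0[of z] inj[of z x] by simp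
      with x \<open>z \<notin> disc\<close> show False by simp
    qed
  next
    fix y assume y: "y \<in> disc"
    have "\<exists>!x. y - h *\<^sub>R V (?c x) = x"
      using contr by (intro banach_fix_type[of "1/2"]) (auto simp: dist_norm norm_minus_commute)
    then obtain x where x: "y - h *\<^sub>R V (?c x) = x" by blast
    have "x \<in> disc" using x X0[of x] y by (cases "x \<in> disc") auto
    then show "y \<in> (\<lambda>x. x + h *\<^sub>R V x) ` disc"
      using x c_self by (intro image_eqI[of _ _ x]) (auto simp: algebra_simps)
  qed
qed

text \<open>Spatial derivatives are required in the open disc only: near the circle the field is 0,
  and so is its derivative within the disc. The Lipschitz bound in time is what makes an Euler step
  accurate up to O(h^2).\<close>

locale disc_field =
  fixes X :: "real \<Rightarrow> real^2 \<Rightarrow> real^2" and X' :: "real \<Rightarrow> real^2 \<Rightarrow> real^2 \<Rightarrow> real^2" and L r :: real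
  assumes lip: "t \<in> {0..1} \<Longrightarrow> s \<in> {0..1} \<Longrightarrow> x \<in> disc \<Longrightarrow> y \<in> disc \<Longrightarrow>
      norm (X t x - X s y) \<le> L * (\<bar>t - s\<bar> + norm (x - y))"
    and supp: "t \<in> {0..1} \<Longrightarrow> x \<in> disc \<Longrightarrow> r \<le> norm x \<Longrightarrow> X t x = 0" and r: "r < 1"
    and deriv: "t \<in> {0..1} \<Longrightarrow> norm x < 1 \<Longrightarrow> (X t has_derivative X' t x) (at x)"
    and deriv_bound: "t \<in> {0..1} \<Longrightarrow> norm x < 1 \<Longrightarrow> norm (X' t x v) \<le> L * norm v"
    and divergence_free: "t \<in> {0..1} \<Longrightarrow> norm x < 1 \<Longrightarrow> X' t x (axis 1 1) $ 1 + X' t x (axis 2 1) $ 2 = 0"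
    and L: "0 \<le> L"
begin

lemma lip_space: "t \<in> {0..1} \<Longrightarrow> x \<in> disc \<Longrightarrow> y \<in> disc \<Longrightarrow> norm (X t x - X t y) \<le> L * norm (x - y)"
  using lip[of t t x y] by simp

text \<open>Comparison with a point of the circle, where the field is 0, at distance at most
  2.\<close>

lemma X_bound: assumes "t \<in> {0..1}" "x \<in> disc" shows "norm (X t x) \<le> 2 * L"
proof -
  have e: "(axis 1 1 :: real^2) \<in> disc" "norm (axis 1 1 :: real^2) = 1" by (auto simp: mem_disc)
  have "norm (X t x - X t (axis 1 1)) \<le> L * norm (x - axis 1 1)" using lip_space assms e by blast
  also have "\<dots> \<le> L * 2"
    using norm_triangle_ineq4[of x "axis 1 1"] assms e L by (intro mult_left_mono) (auto simp: mem_disc)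
  finally show ?thesis using supp[OF assms(1) e(1)] e r by simp
qed

definition step :: "real \<Rightarrow> real \<Rightarrow> real^2 \<Rightarrow> real^2" where
  "step h t x = x + h *\<^sub>R X t x"

lemma step_bij:
  assumes t: "t \<in> {0..1}" and h: "0 \<le> h" "h * L \<le> 1 / 2"
  shows "inj_on (step h t) disc" "step h t ` disc = disc"
  using lipschitz_perturbation_bij[of "X t" L h] lip_space[OF t] supp[OF t] r L h
  by (auto simp: step_def[abs_def] mem_disc)

lemma step_in_disc: "t \<in> {0..1} \<Longrightarrow> 0 \<le> h \<Longrightarrow> h * L \<le> 1 / 2 \<Longrightarrow> x \<in> disc \<Longrightarrow> step h t x \<in> disc"
  using step_bij(2) by blast

lemma continuous_on_X: assumes "t \<in> {0..1}" shows "continuous_on disc (X t)"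
proof -
  have "L-lipschitz_on disc (X t)"
    using lip_space[OF assms] L by (auto simp: lipschitz_on_def dist_norm)
  then show ?thesis by (rule lipschitz_on_continuous_on)
qed

lemma continuous_on_step: "t \<in> {0..1} \<Longrightarrow> continuous_on disc (step h t)"
  unfolding step_def by (intro continuous_intros continuous_on_X)

text \<open>The derivative of \<open>step\<close> within the closed disc. \<open>X'\<close> carries
  no information on the circle, where the field vanishes on a collar; hence the second
  branch.\<close>

definition stepD :: "real \<Rightarrow> real \<Rightarrow> real^2 \<Rightarrow> real^2 \<Rightarrow> real^2" where
  "stepD h t x v = v + h *\<^sub>R (if norm x < 1 then X' t x v else 0)"

lemma step_has_derivative:
  assumes t: "t \<in> {0..1}" and x: "x \<in> disc"
  shows "(step h t has_derivative stepD h t x) (at x within disc)"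
proof -
  have "(X t has_derivative (\<lambda>v. if norm x < 1 then X' t x v else 0)) (at x within disc)"
  proof (cases "norm x < 1")
    case True
    then show ?thesis using deriv[OF t True] by (simp add: has_derivative_at_withinI)
  next
    case False
    then have n1: "norm x = 1" using x by (simp add: mem_disc)
    have "((\<lambda>_. 0) has_derivative (\<lambda>v. 0)) (at x within disc)" by simp
    then have "(X t has_derivative (\<lambda>v. 0)) (at x within disc)"
    proof (rule has_derivative_transform_within[of _ _ _ _ "1 - r"])
      fix y assume y: "y \<in> disc" "dist y x < 1 - r"
      have "norm x \<le> norm y + dist y x" by (metis dist_norm norm_triangle_sub norm_minus_commute)
      then show "0 = X t y" using supp[OF t y(1)] y n1 by simp
    qed (use r x in auto)
    then show ?thesis using False by simp
  qed
  then show ?thesis unfolding step_def stepD_def by (auto intro!: derivative_eq_intros)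
qed

text \<open>For 2 by 2 matrices det (1 + h A) = 1 + h tr A + h^2 det A, and the trace is the
  divergence, so the linear term is gone. With h L at most 1/2 the determinant stays positive, so
  the absolute value does no harm.\<close>

lemma det_stepD:
  assumes t: "t \<in> {0..1}" and h: "0 \<le> h" "h * L \<le> 1 / 2"
  shows "\<bar>\<bar>det (matrix (stepD h t x))\<bar> - 1\<bar> \<le> 2 * (h * L)\<^sup>2"
proof (cases "norm x < 1")
  case True
  define a b c d where "a = X' t x (axis 1 1) $ 1" and "b = X' t x (axis 2 1) $ 1"
    and "c = X' t x (axis 1 1) $ 2" and "d = X' t x (axis 2 1) $ 2"
  have bd: "\<bar>X' t x (axis j 1) $ i\<bar> \<le> L" for i j
    using component_le_norm_cart[of "X' t x (axis j 1)" i] deriv_bound[OF t True, of "axis j 1"]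
    by simp
  have ab: "\<bar>a\<bar> \<le> L" "\<bar>b\<bar> \<le> L" "\<bar>c\<bar> \<le> L" "\<bar>d\<bar> \<le> L" using bd by (auto simp: a_def b_def c_def d_def)
  have ad: "a + d = 0" using divergence_free[OF t True] by (simp add: a_def d_def)
  have "det (matrix (stepD h t x)) = (1 + h * a) * (1 + h * d) - (h * b) * (h * c)"
    using True by (simp add: det_2 matrix_2_entries stepD_def a_def b_def c_def d_def axis_def)
  also have "\<dots> = 1 + h * (a + d) + h\<^sup>2 * (a * d - b * c)" by (simp add: power2_eq_square algebra_simps)
  finally have det: "det (matrix (stepD h t x)) = 1 + h\<^sup>2 * (a * d - b * c)" using ad by simp
  have "\<bar>a * d\<bar> \<le> L * L" "\<bar>b * c\<bar> \<le> L * L" unfolding abs_mult using ab L by (auto intro!: mult_mono)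
  then have "\<bar>a * d - b * c\<bar> \<le> 2 * L\<^sup>2" by (simp add: power2_eq_square)
  then have le: "\<bar>h\<^sup>2 * (a * d - b * c)\<bar> \<le> 2 * (h * L)\<^sup>2"
    using mult_left_mono[of "\<bar>a * d - b * c\<bar>" "2 * L\<^sup>2" "h\<^sup>2"] by (simp add: abs_mult power_mult_distrib)
  have "(h * L)\<^sup>2 \<le> (1 / 2)\<^sup>2" using h L by (intro power_mono) auto
  then have "2 * (h * L)\<^sup>2 \<le> 1 / 2" by (simp add: power2_eq_square)
  then show ?thesis using le unfolding det by linarith
next
  case False
  then have "stepD h t x = (\<lambda>v. v)" by (auto simp: stepD_def)
  then show ?thesis by (simp add: matrix_id_mat_1 flip: id_def)
qed

text \<open>A step permutes the disc, so the integral of \<open>f\<close> equals that of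
  \<open>f (step h t x)\<close> times the Jacobian. What remains is the deviation of the Jacobian
  from 1, times a bound for \<open>f\<close>.\<close>

lemma integral_step:
  assumes t: "t \<in> {0..1}" and h: "0 \<le> h" "h * L \<le> 1 / 2"
    and f: "continuous_on disc f" "\<And>x. x \<in> disc \<Longrightarrow> \<bar>f x\<bar> \<le> B"
  shows "\<bar>integral disc (\<lambda>x. f (step h t x)) - integral disc f\<bar> \<le> 2 * (h * L)\<^sup>2 * B * measure lebesgue disc"
proof -
  let ?d = "\<lambda>x. \<bar>det (matrix (stepD h t x))\<bar>"
  have B: "0 \<le> B" using f(2)[of 0] by (simp add: mem_disc)
  have fi: "f absolutely_integrable_on (step h t ` disc)"
    unfolding step_bij(2)[OF t h] by (intro continuous_on_compact_absolutely_integrable f) simp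
  note cov = integral_change_of_variables_scalar[OF disc_simps(5) step_has_derivative[OF t] step_bij(1)[OF t h] fi]
  have i1: "(\<lambda>x. f (step h t x)) integrable_on disc"
    using continuous_on_compose2[OF f(1) continuous_on_step[OF t]] step_in_disc[OF t h]
    by (intro continuous_on_compact_absolutely_integrable) auto
  have "norm (integral disc (\<lambda>x. f (step h t x) - ?d x * f (step h t x))) \<le> integral disc (\<lambda>x. 2 * (h * L)\<^sup>2 * B)"
  proof (rule integral_norm_bound_integral)
    show "(\<lambda>x. f (step h t x) - ?d x * f (step h t x)) integrable_on disc"
      by (intro integrable_diff i1 set_lebesgue_integral_eq_integral(1) cov(2))
    fix x assume x: "x \<in> disc"
    have "norm (f (step h t x) - ?d x * f (step h t x)) = \<bar>?d x - 1\<bar> * \<bar>f (step h t x)\<bar>"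
      by (simp flip: abs_mult) (simp add: algebra_simps abs_minus_commute)
    also have "\<dots> \<le> (2 * (h * L)\<^sup>2) * B"
      using det_stepD[OF t h, of x] f(2)[OF step_in_disc[OF t h x]] by (intro mult_mono) auto
    finally show "norm (f (step h t x) - ?d x * f (step h t x)) \<le> 2 * (h * L)\<^sup>2 * B" .
  qed (simp add: integrable_on_const lmeasurable_compact)
  also have "integral disc (\<lambda>x. 2 * (h * L)\<^sup>2 * B) = 2 * (h * L)\<^sup>2 * B * measure lebesgue disc"
    using lmeasure_integral[of disc] integral_mult_right[of disc "2 * (h * L)\<^sup>2 * B" "\<lambda>x. 1"]
    by (simp add: lmeasurable_compact)
  also have "integral disc (\<lambda>x. f (step h t x) - ?d x * f (step h t x))
     = integral disc (\<lambda>x. f (step h t x)) - integral disc f"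
    using cov step_bij(2)[OF t h] by (subst Henstock_Kurzweil_Integration.integral_diff[OF i1])
      (auto intro: set_lebesgue_integral_eq_integral(1))
  finally show ?thesis by simp
qed

section \<open>Euler polygons and their distance from the flow\<close>

primrec euler :: "real \<Rightarrow> nat \<Rightarrow> real^2 \<Rightarrow> real^2" where
  "euler h 0 x = x"
| "euler h (Suc k) x = step h (real k * h) (euler h k x)"

lemma euler_in_disc_continuous:
  assumes h: "0 \<le> h" "h * L \<le> 1 / 2" and "real k * h \<le> 1"
  shows "continuous_on disc (euler h k) \<and> euler h k ` disc \<subseteq> disc"
  using assms(3)
proof (induction k)
  case (Suc k)
  have "real k * h \<le> real (Suc k) * h" using h by (intro mult_right_mono) auto
  then have t: "real k * h \<in> {0..1}" and IH: "continuous_on disc (euler h k)" "euler h k ` disc \<subseteq> disc"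
    using Suc h by auto
  have "continuous_on disc (euler h (Suc k))"
    using continuous_on_compose2[OF continuous_on_step[OF t] IH] by simp
  moreover have "euler h (Suc k) ` disc \<subseteq> disc"
    using step_in_disc[OF t h] IH(2) by (auto simp: image_subset_iff)
  ultimately show ?case by blast
qed auto

text \<open>The induction runs over all \<open>f\<close>: the last step is absorbed into the test
  function, which stays continuous with the same bound, and the errors of the k steps add
  up.\<close>

lemma integral_euler:
  assumes h: "0 \<le> h" "h * L \<le> 1 / 2" and "real k * h \<le> 1"
    and "continuous_on disc f" "\<And>x. x \<in> disc \<Longrightarrow> \<bar>f x\<bar> \<le> B"
  shows "\<bar>integral disc (\<lambda>x. f (euler h k x)) - integral disc f\<bar> \<le> real k * (2 * (h * L)\<^sup>2 * B * measure lebesgue disc)"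
  using assms(3-5)
proof (induction k arbitrary: f)
  case (Suc k)
  let ?g = "\<lambda>x. f (step h (real k * h) x)"
  have "real k * h \<le> real (Suc k) * h" using h by (intro mult_right_mono) auto
  then have t: "real k * h \<in> {0..1}" using Suc.prems(1) h by auto
  have g: "continuous_on disc ?g" "\<bar>?g x\<bar> \<le> B" if "x \<in> disc" for x
    using continuous_on_compose2[OF Suc.prems(2) continuous_on_step[OF t]] step_in_disc[OF t h] Suc.prems(3) that
    by auto
  have "\<bar>integral disc (\<lambda>x. ?g (euler h k x)) - integral disc ?g\<bar> \<le> real k * (2 * (h * L)\<^sup>2 * B * measure lebesgue disc)"
    using t g[of 0] g(2) by (intro Suc.IH) (auto simp: mem_disc)
  moreover have "\<bar>integral disc ?g - integral disc f\<bar> \<le> 2 * (h * L)\<^sup>2 * B * measure lebesgue disc"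
    by (rule integral_step[OF t h Suc.prems(2,3)])
  ultimately show ?case by (simp add: distrib_right)
qed auto

text \<open>Gronwall's inequality: exp(-2 L s) |u - w|^2 is nonincreasing. The square keeps the
  function differentiable where the solutions meet.\<close>

lemma solutions_lipschitz:
  assumes u: "\<And>s. s \<in> {0..1} \<Longrightarrow> u s \<in> disc" "\<And>s. s \<in> {0..1} \<Longrightarrow> (u has_vector_derivative X s (u s)) (at s within {0..1})"
    and w: "\<And>s. s \<in> {0..1} \<Longrightarrow> w s \<in> disc" "\<And>s. s \<in> {0..1} \<Longrightarrow> (w has_vector_derivative X s (w s)) (at s within {0..1})"
    and t: "t \<in> {0..1}"
  shows "norm (u t - w t) \<le> exp L * norm (u 0 - w 0)"
proof -
  define d where "d s = u s - w s" for s
  define D where "D s = X s (u s) - X s (w s)" for s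
  have der: "(d has_vector_derivative D s) (at s within {0..t})" if "s \<in> {0..t}" for s
    unfolding d_def D_def using that t
    by (intro has_vector_derivative_diff has_vector_derivative_within_subset[OF u(2), of s "{0..t}"]
          has_vector_derivative_within_subset[OF w(2), of s "{0..t}"]) auto
  have DL: "norm (D s) \<le> L * norm (d s)" if "s \<in> {0..t}" for s
    unfolding d_def D_def using that t u(1) w(1) by (intro lip_space) auto
  have der2: "((\<lambda>s. exp (- 2 * L * s) * (d s \<bullet> d s)) has_real_derivative
      exp (- 2 * L * s) * (2 * (D s \<bullet> d s) - 2 * L * (d s \<bullet> d s))) (at s within {0..t})"
    if "s \<in> {0..t}" for s
  proof -
    have "((\<lambda>s. d s \<bullet> d s) has_vector_derivative (d s \<bullet> D s + D s \<bullet> d s)) (at s within {0..t})"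
      by (rule bounded_bilinear.has_vector_derivative[OF bounded_bilinear_inner der[OF that] der[OF that]])
    then have "((\<lambda>s. d s \<bullet> d s) has_real_derivative 2 * (D s \<bullet> d s)) (at s within {0..t})"
      by (simp add: has_real_derivative_iff_has_vector_derivative inner_commute)
    moreover have "((\<lambda>s. exp (- 2 * L * s)) has_real_derivative exp (- 2 * L * s) * (- 2 * L)) (at s within {0..t})"
      by (auto intro!: derivative_eq_intros)
    ultimately show ?thesis
      by (rule DERIV_cong[OF DERIV_mult[rotated]]) (simp add: algebra_simps)
  qed
  have "exp (- 2 * L * t) * (d t \<bullet> d t) \<le> exp (- 2 * L * 0) * (d 0 \<bullet> d 0)"
  proof (rule DERIV_nonpos_imp_decreasing_open[where f = "\<lambda>s. exp (- 2 * L * s) * (d s \<bullet> d s)" and a = 0 and b = t])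
    show "continuous_on {0..t} (\<lambda>s. exp (- 2 * L * s) * (d s \<bullet> d s))"
      by (rule DERIV_continuous_on[OF der2])
    fix s assume st: "0 < s" "s < t"
    then have s: "s \<in> {0..t}" by simp
    have "D s \<bullet> d s \<le> norm (D s) * norm (d s)" by (rule norm_cauchy_schwarz)
    also have "\<dots> \<le> L * norm (d s) * norm (d s)" using DL[OF s] by (intro mult_right_mono) auto
    also have "\<dots> = L * (d s \<bullet> d s)" by (simp add: dot_square_norm power2_eq_square)
    finally have "exp (- 2 * L * s) * (2 * (D s \<bullet> d s) - 2 * L * (d s \<bullet> d s)) \<le> 0"
      by (simp add: mult_nonneg_nonpos)
    then show "\<exists>y. DERIV (\<lambda>s. exp (- 2 * L * s) * (d s \<bullet> d s)) s :> y \<and> y \<le> 0"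
      using der2[OF s] at_within_Icc_at[OF st] by auto
  qed (use t in auto)
  then have "(norm (d t))\<^sup>2 \<le> exp (2 * L * t) * (norm (d 0))\<^sup>2"
    by (simp add: dot_square_norm exp_minus field_simps)
  also have "\<dots> \<le> exp (2 * L) * (norm (d 0))\<^sup>2"
    using t L by (intro mult_right_mono) (auto simp: mult_left_le)
  also have "\<dots> = (exp L * norm (d 0))\<^sup>2"
    by (simp add: power_mult_distrib exp_double)
  finally have "norm (d t) \<le> exp L * norm (d 0)" by (rule power2_le_imp_le) simp
  then show ?thesis by (simp add: d_def)
qed

context
  fixes \<phi> :: "real \<Rightarrow> real^2 \<Rightarrow> real^2"
  assumes flow0: "\<And>x. x \<in> disc \<Longrightarrow> \<phi> 0 x = x"
    and flow_disc: "\<And>t x. x \<in> disc \<Longrightarrow> t \<in> {0..1} \<Longrightarrow> \<phi> t x \<in> disc"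
    and flow_deriv: "\<And>t x. x \<in> disc \<Longrightarrow> t \<in> {0..1} \<Longrightarrow>
       ((\<lambda>s. \<phi> s x) has_vector_derivative X t (\<phi> t x)) (at t within {0..1})"
begin

lemma flow_deriv_subset:
  "x \<in> disc \<Longrightarrow> s \<in> S \<Longrightarrow> S \<subseteq> {0..1} \<Longrightarrow>
    ((\<lambda>s. \<phi> s x) has_vector_derivative X s (\<phi> s x)) (at s within S)"
  by (rule has_vector_derivative_within_subset[OF flow_deriv]) auto

lemma flow_lipschitz_time:
  assumes x: "x \<in> disc" and "s \<in> {0..1}" "t \<in> {0..1}"
  shows "norm (\<phi> t x - \<phi> s x) \<le> 2 * L * \<bar>t - s\<bar>"
proof -
  have le: "norm (\<phi> b x - \<phi> a x) \<le> 2 * L * (b - a)" if "0 \<le> a" "a \<le> b" "b \<le> 1" for a b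
    by (rule vector_mean_value_bound[where g' = "\<lambda>s. X s (\<phi> s x)"])
       (use that x flow_disc X_bound in \<open>auto intro!: flow_deriv_subset\<close>)
  show ?thesis
    using le[of s t] le[of t s] assms by (cases "s \<le> t") (auto simp: norm_minus_commute)
qed

lemma flow_lipschitz_space:
  assumes x: "x \<in> disc" and y: "y \<in> disc" and t: "t \<in> {0..1}"
  shows "norm (\<phi> t x - \<phi> t y) \<le> exp L * norm (x - y)"
  using solutions_lipschitz[where u = "\<lambda>s. \<phi> s x" and w = "\<lambda>s. \<phi> s y", OF flow_disc flow_deriv flow_disc flow_deriv t]
    x y flow0 by simp

text \<open>A boundary point is a rest point, so the constant path is a solution too, and the
  Gronwall estimate makes it the only one.\<close>

lemma flow_fixes_boundary:
  assumes x: "norm x = 1" and t: "t \<in> {0..1}"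
  shows "\<phi> t x = x"
proof -
  have xd: "x \<in> disc" using x by (simp add: mem_disc)
  have "X s x = 0" if "s \<in> {0..1}" for s using supp[OF that xd] x r by simp
  then have "norm (\<phi> t x - x) \<le> exp L * norm (\<phi> 0 x - x)"
    using xd by (intro solutions_lipschitz[where u = "\<lambda>s. \<phi> s x" and w = "\<lambda>s. x"] flow_disc flow_deriv t) auto
  then show ?thesis using flow0[OF xd] by simp
qed

text \<open>The local error of Euler's method. Along a trajectory the velocity changes at rate at
  most L (1 + 2 L): L from the time argument, and L times the maximal speed 2 L from the motion of
  the point.\<close>

lemma flow_step:
  assumes x: "x \<in> disc" and ab: "0 \<le> a" "a \<le> b" "b \<le> 1"
  shows "norm (\<phi> b x - \<phi> a x - (b - a) *\<^sub>R X a (\<phi> a x)) \<le> L * (1 + 2 * L) * (b - a)\<^sup>2"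
proof -
  let ?g = "\<lambda>s. \<phi> s x - s *\<^sub>R X a (\<phi> a x)"
  have "norm (?g b - ?g a) \<le> (L * (1 + 2 * L) * (b - a)) * (b - a)"
  proof (rule vector_mean_value_bound[where g' = "\<lambda>s. X s (\<phi> s x) - X a (\<phi> a x)"])
    fix s assume s: "s \<in> {a..b}"
    show "(?g has_vector_derivative X s (\<phi> s x) - X a (\<phi> a x)) (at s within {a..b})"
      using s ab x by (auto intro!: derivative_eq_intros flow_deriv_subset)
    have "norm (X s (\<phi> s x) - X a (\<phi> a x)) \<le> L * (\<bar>s - a\<bar> + norm (\<phi> s x - \<phi> a x))"
      using s ab x flow_disc by (intro lip) auto
    also have "\<dots> \<le> L * (\<bar>s - a\<bar> + 2 * L * \<bar>s - a\<bar>)"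
      using s ab x L flow_lipschitz_time[OF x, of a s] by (intro mult_left_mono add_left_mono) auto
    also have "\<dots> = L * (1 + 2 * L) * \<bar>s - a\<bar>" by (simp add: algebra_simps)
    also have "\<dots> \<le> L * (1 + 2 * L) * (b - a)" using s L by (intro mult_left_mono) auto
    finally show "norm (X s (\<phi> s x) - X a (\<phi> a x)) \<le> L * (1 + 2 * L) * (b - a)" .
  qed (use ab in auto)
  moreover have "?g b - ?g a = \<phi> b x - \<phi> a x - (b - a) *\<^sub>R X a (\<phi> a x)" by (simp add: algebra_simps)
  ultimately show ?thesis by (simp add: power2_eq_square mult.assoc)
qed

text \<open>Each step adds one local error and multiplies the old error by at most 1 + h L. The
  accumulated factor is kept as a power; since k h is at most 1, it never exceeds e^L.\<close>

lemma euler_error: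
  assumes h: "0 \<le> h" "h * L \<le> 1 / 2" and "real k * h \<le> 1" and x: "x \<in> disc"
  shows "norm (\<phi> (real k * h) x - euler h k x) \<le> real k * (L * (1 + 2 * L) * h\<^sup>2) * (1 + h * L) ^ k"
  using assms(3)
proof (induction k)
  case 0
  then show ?case using flow0[OF x] by simp
next
  case (Suc k)
  have "real k * h \<le> real (Suc k) * h" using h by (intro mult_right_mono) auto
  then have t: "real k * h \<in> {0..1}" using Suc.prems(1) h by auto
  let ?K = "L * (1 + 2 * L) * h\<^sup>2" and ?p = "\<phi> (real k * h) x" and ?e = "euler h k x" and ?X = "X (real k * h)"
  have K: "0 \<le> ?K" using L by simp
  have e: "?e \<in> disc" "?p \<in> disc" using euler_in_disc_continuous[OF h] t x flow_disc by auto
  have split: "\<phi> (real (Suc k) * h) x - euler h (Suc k) x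
     = (\<phi> (real (Suc k) * h) x - ?p - h *\<^sub>R ?X ?p) + ((?p - ?e) + h *\<^sub>R (?X ?p - ?X ?e))"
    by (simp add: step_def algebra_simps)
  have "norm (\<phi> (real (Suc k) * h) x - euler h (Suc k) x)
    \<le> norm (\<phi> (real (Suc k) * h) x - ?p - h *\<^sub>R ?X ?p) + (norm (?p - ?e) + norm (h *\<^sub>R (?X ?p - ?X ?e)))"
    unfolding split by (rule order_trans[OF norm_triangle_ineq add_left_mono[OF norm_triangle_ineq]])
  also have "\<dots> \<le> ?K + (norm (?p - ?e) + h * (L * norm (?p - ?e)))"
  proof (intro add_mono)
    have d: "real (Suc k) * h - real k * h = h" by (simp add: algebra_simps)
    have "0 \<le> real k * h" "real k * h \<le> real (Suc k) * h" using h by (auto intro!: mult_right_mono)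
    from flow_step[OF x this Suc.prems]
    show "norm (\<phi> (real (Suc k) * h) x - ?p - h *\<^sub>R ?X ?p) \<le> ?K"
      unfolding d .
    show "norm (h *\<^sub>R (?X ?p - ?X ?e)) \<le> h * (L * norm (?p - ?e))"
      using h lip_space[OF t e(2,1)] by (simp add: mult_left_mono)
  qed simp
  also have "\<dots> = ?K + (1 + h * L) * norm (?p - ?e)" by (simp add: algebra_simps)
  also have "\<dots> \<le> ?K * (1 + h * L) ^ Suc k + (1 + h * L) * (real k * ?K * (1 + h * L) ^ k)"
  proof (intro add_mono mult_left_mono)
    have "1 \<le> (1 + h * L) ^ Suc k" using h L by (intro one_le_power) auto
    then show "?K \<le> ?K * (1 + h * L) ^ Suc k" using mult_left_mono[OF _ K, of 1] by simp
    show "norm (?p - ?e) \<le> real k * ?K * (1 + h * L) ^ k" using Suc.IH t by simp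
  qed (use h L in auto)
  also have "\<dots> = real (Suc k) * ?K * (1 + h * L) ^ Suc k" by (simp add: algebra_simps)
  finally show ?case .
qed

lemma continuous_on_flow: assumes t: "t \<in> {0..1}" shows "continuous_on disc (\<phi> t)"
proof -
  have "norm (\<phi> t x - \<phi> t y) \<le> exp L * norm (x - y)" if xy: "x \<in> disc" "y \<in> disc" for x y
    using flow_lipschitz_space[OF xy t] .
  then have "(exp L)-lipschitz_on disc (\<phi> t)" by (auto simp: lipschitz_on_def dist_norm)
  then show ?thesis by (rule lipschitz_on_continuous_on)
qed

text \<open>The divergence vanishes, so an Euler step of size $h$ has Jacobian $1 + O(h^2)$, and $t/h$ of them
  change an integral by $O(h)$.  The flow need not be differentiable in the initial value.\<close>

lemma integral_flow:
  assumes t: "t \<in> {0..1}" and f: "Q-lipschitz_on disc f"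
  shows "integral disc (\<lambda>x. f (\<phi> t x)) = integral disc (f :: real^2 \<Rightarrow> real)"
proof -
  let ?c = "measure lebesgue disc"
  have fc: "continuous_on disc f" using f by (rule lipschitz_on_continuous_on)
  have Q: "0 \<le> Q" using lipschitz_on_nonneg[OF f] .
  obtain B where B: "\<And>x. x \<in> disc \<Longrightarrow> \<bar>f x\<bar> \<le> B"
    using compact_imp_bounded[OF compact_continuous_image[OF fc]] unfolding bounded_iff by auto
  have B0: "0 \<le> B" using B[of 0] by (simp add: mem_disc)
  \<comment> \<open>Collects two errors of order 1/n: exchanging the flow for the Euler polygon
    inside a Lipschitz function, and the Jacobians of the n steps.\<close>
  define A where "A = Q * (L * (1 + 2 * L)) * exp L * ?c + 2 * L\<^sup>2 * B * ?c"
  define \<delta> where "\<delta> = \<bar>integral disc (\<lambda>x. f (\<phi> t x)) - integral disc f\<bar>"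
  \<comment> \<open>For such n the step size t/n satisfies h L at most 1/2, the condition under
    which Euler steps permute the disc.\<close>
  have le: "\<delta> \<le> A / real n" if n: "real n \<ge> 2 * L + 1" for n
  proof -
    define h where "h = t / real n"
    have n0: "real n > 0" using n L by linarith
    have h: "0 \<le> h" "h \<le> 1 / real n" "real n * h = t" "real n * h \<le> 1"
      using t n0 by (auto simp: h_def divide_right_mono)
    have hL: "h * L \<le> 1 / 2"
    proof -
      have "h * L \<le> 1 / real n * L" using h L by (intro mult_right_mono) auto
      also have "\<dots> \<le> 1 / 2" using n n0 by (simp add: field_simps)
      finally show ?thesis .
    qed
    have h2: "real n * h\<^sup>2 \<le> 1 / real n"
    proof -
      have "real n * h\<^sup>2 = (real n * h) * h" by (simp add: power2_eq_square)
      also have "\<dots> \<le> 1 * (1 / real n)" using h n0 by (intro mult_mono) auto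
      finally show ?thesis by simp
    qed
    note eu = euler_in_disc_continuous[OF h(1) hL h(4)]
    have i1: "(\<lambda>x. f (\<phi> t x)) integrable_on disc"
      using continuous_on_compose2[OF fc continuous_on_flow[OF t]] flow_disc t
      by (intro continuous_on_compact_absolutely_integrable) auto
    have i2: "(\<lambda>x. f (euler h n x)) integrable_on disc"
      using eu by (intro continuous_on_compact_absolutely_integrable continuous_on_compose2[OF fc]) auto
    have "norm (integral disc (\<lambda>x. f (\<phi> t x) - f (euler h n x)))
        \<le> integral disc (\<lambda>x. Q * (L * (1 + 2 * L)) * exp L / real n)"
    proof (rule integral_norm_bound_integral)
      fix x assume x: "x \<in> disc"
      have "(1 + h * L) ^ n \<le> exp (h * L) ^ n" using h L by (intro power_mono exp_ge_add_one_self) auto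
      also have "\<dots> = exp (t * L)" using h(3) by (simp add: exp_of_nat_mult[symmetric] mult.assoc[symmetric])
      also have "\<dots> \<le> exp L" using t L by (simp add: mult_left_le_one_le)
      finally have p: "(1 + h * L) ^ n \<le> exp L" .
      have "norm (f (\<phi> t x) - f (euler h n x)) \<le> Q * norm (\<phi> t x - euler h n x)"
        using lipschitz_onD[OF f, of "\<phi> t x" "euler h n x"] flow_disc[OF x t] eu x by (auto simp: dist_norm)
      also have "\<dots> \<le> Q * (real n * (L * (1 + 2 * L) * h\<^sup>2) * (1 + h * L) ^ n)"
        using euler_error[OF h(1) hL h(4) x] Q h(3) by (intro mult_left_mono) auto
      also have "\<dots> = (Q * (L * (1 + 2 * L))) * ((real n * h\<^sup>2) * (1 + h * L) ^ n)" by (simp add: mult_ac)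
      also have "\<dots> \<le> (Q * (L * (1 + 2 * L))) * (1 / real n * exp L)"
        using h2 p Q L h by (intro mult_left_mono mult_mono) auto
      finally show "norm (f (\<phi> t x) - f (euler h n x)) \<le> Q * (L * (1 + 2 * L)) * exp L / real n" by simp
    qed (use i1 i2 in \<open>auto intro: integrable_diff simp: integrable_on_const lmeasurable_compact\<close>)
    also have "\<dots> = Q * (L * (1 + 2 * L)) * exp L / real n * ?c"
      using lmeasure_integral[of disc] integral_mult_right[of disc "Q * (L * (1 + 2 * L)) * exp L / real n" "\<lambda>x. 1"]
      by (simp add: lmeasurable_compact)
    finally have e1: "\<bar>integral disc (\<lambda>x. f (\<phi> t x)) - integral disc (\<lambda>x. f (euler h n x))\<bar>
        \<le> Q * (L * (1 + 2 * L)) * exp L / real n * ?c"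
      by (simp add: Henstock_Kurzweil_Integration.integral_diff[OF i1 i2])
    have "\<bar>integral disc (\<lambda>x. f (euler h n x)) - integral disc f\<bar> \<le> real n * (2 * (h * L)\<^sup>2 * B * ?c)"
      by (rule integral_euler[OF h(1) hL h(4) fc B])
    also have "\<dots> = (real n * h\<^sup>2) * (2 * L\<^sup>2 * B * ?c)" by (simp add: power_mult_distrib mult_ac)
    also have "\<dots> \<le> 1 / real n * (2 * L\<^sup>2 * B * ?c)" using h2 B0 by (intro mult_right_mono) auto
    finally have e2: "\<bar>integral disc (\<lambda>x. f (euler h n x)) - integral disc f\<bar> \<le> 1 / real n * (2 * L\<^sup>2 * B * ?c)" .
    have "A / real n = Q * (L * (1 + 2 * L)) * exp L / real n * ?c + 1 / real n * (2 * L\<^sup>2 * B * ?c)"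
      by (simp add: A_def add_divide_distrib)
    then show ?thesis using e1 e2 unfolding \<delta>_def by linarith
  qed
  have "(\<lambda>n. A / real n) \<longlonglongrightarrow> 0" by (rule lim_const_over_n)
  moreover have "\<forall>\<^sub>F n in sequentially. \<delta> \<le> A / real n"
    using eventually_ge_at_top[of "nat \<lceil>2 * L + 1\<rceil>"]
    by eventually_elim (rule le, linarith)
  ultimately have "\<delta> \<le> 0" by (rule tendsto_lowerbound) simp
  then show ?thesis by (simp add: \<delta>_def)
qed

end

end

section \<open>The action and the Calabi invariant\<close>

text \<open>For small $h$ the map $x \mapsto x + h\psi(x)e_2$ permutes the disc and has Jacobian
  $1 + h\,\partial_2\psi$, whose integral is therefore the area.\<close>

lemma integral_partial_derivative_disc:
  fixes \<psi> :: "real^2 \<Rightarrow> real"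
  assumes der: "\<And>x. x \<in> disc \<Longrightarrow> (\<psi> has_derivative \<psi>' x) (at x within disc)"
    and bnd: "\<And>x v. x \<in> disc \<Longrightarrow> \<bar>\<psi>' x v\<bar> \<le> L * norm v"
    and L: "0 \<le> L"
    and bdry: "\<And>x. norm x = 1 \<Longrightarrow> \<psi> x = 0"
  shows "integral disc (\<lambda>x. \<psi>' x (axis 2 1)) = 0"
proof -
  define h where "h = 1 / (2 * (L + 1))"
  have h: "0 < h" "h * L \<le> 1 / 2" using L by (auto simp: h_def field_simps)
  let ?V = "\<lambda>x. \<psi> x *\<^sub>R (axis 2 1 :: real^2)"
  have lip: "norm (?V x - ?V y) \<le> L * norm (x - y)" if "x \<in> disc" "y \<in> disc" for x y
  proof -
    have "norm (\<psi> x - \<psi> y) \<le> L * norm (x - y)"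
      by (rule differentiable_bound[OF disc_simps(2) der]) (use bnd that L in \<open>auto intro!: onorm_le\<close>)
    then show ?thesis by (simp flip: scaleR_diff_left)
  qed
  let ?T = "\<lambda>x. x + h *\<^sub>R ?V x" and ?D = "\<lambda>x v. v + h *\<^sub>R (\<psi>' x v *\<^sub>R (axis 2 1 :: real^2))"
  have bij: "inj_on ?T disc" "?T ` disc = disc"
    using lipschitz_perturbation_bij[of ?V L h] lip bdry L h by auto
  have dT: "(?T has_derivative ?D x) (at x within disc)" if "x \<in> disc" for x
    by (auto intro!: derivative_eq_intros der[OF that])
  have det: "\<bar>det (matrix (?D x))\<bar> = 1 + h * \<psi>' x (axis 2 1)" if x: "x \<in> disc" for x
  proof -
    have "\<bar>\<psi>' x (axis 2 1)\<bar> \<le> L" using bnd[OF x, of "axis 2 1"] by simp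
    then have "h * \<bar>\<psi>' x (axis 2 1)\<bar> \<le> h * L" using h by (intro mult_left_mono) auto
    then have "\<bar>h * \<psi>' x (axis 2 1)\<bar> \<le> 1 / 2" using h by (simp only: abs_mult abs_of_pos)
    then show ?thesis by (simp add: det_2 matrix_2_entries axis_def)
  qed
  have one: "(\<lambda>x. 1 :: real) absolutely_integrable_on disc"
    by (intro continuous_on_compact_absolutely_integrable) auto
  have cov: "integral disc (\<lambda>x. 1 :: real) = integral disc (\<lambda>x. \<bar>det (matrix (?D x))\<bar> * 1)"
    "(\<lambda>x. \<bar>det (matrix (?D x))\<bar> * 1) absolutely_integrable_on disc"
    using integral_change_of_variables_scalar[OF disc_simps(5) dT bij(1), of "\<lambda>x. 1"] one unfolding bij(2) by blast+
  have e: "integral disc (\<lambda>x. 1 :: real) = integral disc (\<lambda>x. 1 + h * \<psi>' x (axis 2 1))"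
    by (rule trans[OF cov(1)], intro Henstock_Kurzweil_Integration.integral_cong) (simp only: det mult_1_right)
  have i1: "(\<lambda>x. 1 :: real) integrable_on disc" using set_lebesgue_integral_eq_integral(1)[OF one] .
  have "(\<lambda>x. \<bar>det (matrix (?D x))\<bar> * 1) integrable_on disc" using set_lebesgue_integral_eq_integral(1)[OF cov(2)] by simp
  then have i2: "(\<lambda>x. 1 + h * \<psi>' x (axis 2 1)) integrable_on disc"
    by (rule integrable_eq) (simp only: det mult_1_right)
  have i3: "(\<lambda>x. h * \<psi>' x (axis 2 1)) integrable_on disc"
    using integrable_diff[OF i2 i1] by simp
  have "integral disc (\<lambda>x. h * \<psi>' x (axis 2 1)) = 0"
    using e Henstock_Kurzweil_Integration.integral_add[OF i1 i3] by simp
  then show ?thesis using h by simp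
qed

lemma set_integral_swap_disc:
  fixes f :: "real \<Rightarrow> real^2 \<Rightarrow> real"
  assumes "continuous_on ({0..1} \<times> disc) (\<lambda>(t, x). f t x)"
  shows "(LBINT x:disc. (LBINT t:{0..1}. f t x)) = (LBINT t:{0..1}. (LBINT x:disc. f t x))"
    and "set_integrable lborel {0..1} (\<lambda>t. LBINT x:disc. f t x)"
proof -
  let ?h = "\<lambda>(t, x). indicator ({0..1} \<times> disc) (t, x) *\<^sub>R f t x"
  have "integrable lborel (\<lambda>p. indicator ({0..1} \<times> disc) p *\<^sub>R (\<lambda>(t, x). f t x) p)"
    by (rule borel_integrable_compact) (use assms in \<open>auto intro: compact_Times\<close>)
  then have i: "integrable (lborel \<Otimes>\<^sub>M lborel) ?h"
    by (simp add: lborel_prod case_prod_beta')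
  have e1: "(\<integral>x. ?h (t, x) \<partial>lborel) = indicator {0..1} t *\<^sub>R (LBINT x:disc. f t x)" for t
    by (simp add: set_lebesgue_integral_def indicator_times mult.assoc)
  have e2: "(\<integral>t. ?h (t, x) \<partial>lborel) = indicator disc x *\<^sub>R (LBINT t:{0..1}. f t x)" for x
    by (simp add: set_lebesgue_integral_def indicator_times mult.left_commute mult.assoc)
  show "(LBINT x:disc. (LBINT t:{0..1}. f t x)) = (LBINT t:{0..1}. (LBINT x:disc. f t x))"
    using lborel_pair.Fubini_integral[of "\<lambda>t x. ?h (t, x)"] i e1 e2
    by (simp add: set_lebesgue_integral_def[of lborel disc "\<lambda>x. LBINT t:{0..1}. f t x"]
       set_lebesgue_integral_def[of lborel "{0..1}" "\<lambda>t. LBINT x:disc. f t x"])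
  show "set_integrable lborel {0..1} (\<lambda>t. LBINT x:disc. f t x)"
    using lborel_pair.integrable_fst[OF i] e1 by (simp add: set_integrable_def)
qed

text \<open>The quadratic bound makes the derivative 0 everywhere. In this way two actions are
  compared without differentiating either of them.\<close>

lemma constant_on_of_quadratic_bound:
  fixes f :: "'a::real_normed_vector \<Rightarrow> real"
  assumes "convex S" "\<And>x y. x \<in> S \<Longrightarrow> y \<in> S \<Longrightarrow> \<bar>f x - f y\<bar> \<le> C * (norm (x - y))\<^sup>2"
    and "x \<in> S" "y \<in> S"
  shows "f x = f y"
proof -
  have "(f has_derivative (\<lambda>h. 0)) (at x within S)" if x: "x \<in> S" for x
    unfolding has_derivative_within_alt
  proof (intro conjI allI impI)
    fix e :: real assume e: "e > 0"
    define d where "d = e / (\<bar>C\<bar> + 1)"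
    have d: "d > 0" using e by (simp add: d_def)
    have "norm (f y - f x - 0) \<le> e * norm (y - x)" if y: "y \<in> S" "norm (y - x) < d" for y
    proof -
      have "norm (f y - f x - 0) \<le> C * (norm (y - x))\<^sup>2" using assms(2)[OF y(1) x] by simp
      also have "\<dots> \<le> (\<bar>C\<bar> + 1) * norm (y - x) * norm (y - x)"
        unfolding power2_eq_square mult.assoc by (intro mult_right_mono) auto
      also have "\<dots> \<le> e * norm (y - x)"
        using y(2) by (intro mult_right_mono) (auto simp: d_def field_simps)
      finally show ?thesis .
    qed
    then show "\<exists>d>0. \<forall>y\<in>S. norm (y - x) < d \<longrightarrow> norm (f y - f x - 0) \<le> e * norm (y - x)"
      using d by blast
  qed simp
  then show ?thesis using has_derivative_zero_constant[OF assms(1), of f] assms(3,4) by metis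
qed

text \<open>In \<open>H_deriv\<close> the differential of H is the area form contracted with X,
  which encodes X = (dH/dx2, -dH/dx1). It is taken within the closed disc, as in
  \<open>ham_field\<close>.\<close>

locale hamiltonian_field = disc_field X X' L r for X X' L r +
  fixes H :: "real \<Rightarrow> real^2 \<Rightarrow> real"
  assumes H_deriv: "t \<in> {0..1} \<Longrightarrow> x \<in> disc \<Longrightarrow>
      (H t has_derivative (\<lambda>w. X t x $ 1 * w $ 2 - X t x $ 2 * w $ 1)) (at x within disc)"
    and H_boundary: "t \<in> {0..1} \<Longrightarrow> norm x = 1 \<Longrightarrow> H t x = 0"
    and H_continuous: "continuous_on ({0..1} \<times> disc) (\<lambda>(t, x). H t x)"
begin

text \<open>A trapezoidal rule for the differential of H along the segment from \<open>a\<close> to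
  \<open>b\<close>. The mean value theorem yields the field at one interior point; exchanging it for
  the average of the end values costs L |b - a| in each component. The average is the form that
  arises when the Lagrangians of two trajectories are subtracted.\<close>

lemma H_midpoint:
  assumes t: "t \<in> {0..1}" and a: "a \<in> disc" and b: "b \<in> disc"
  shows "\<bar>H t b - H t a - ((X t a $ 1 + X t b $ 1) / 2 * (b $ 2 - a $ 2) - (X t a $ 2 + X t b $ 2) / 2 * (b $ 1 - a $ 1))\<bar>
    \<le> 2 * L * (norm (b - a))\<^sup>2"
proof -
  define p where "p s = a + s *\<^sub>R (b - a)" for s :: real
  have pd: "p s \<in> disc" if "s \<in> {0..1}" for s
    using convexD_alt[OF disc_simps(2) a b, of s] that by (simp add: p_def algebra_simps)
  have "\<exists>s\<in>{0<..<1}. H t (p 1) - H t (p 0) =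
     (\<lambda>h. X t (p s) $ 1 * (h *\<^sub>R (b - a)) $ 2 - X t (p s) $ 2 * (h *\<^sub>R (b - a)) $ 1) (1 - 0)"
  proof (rule mvt_simple)
    fix s :: real assume "0 \<le> s" "s \<le> 1"
    then have s: "s \<in> {0..1}" by simp
    have dp: "(p has_derivative (\<lambda>h. h *\<^sub>R (b - a))) (at s within {0..1})"
      unfolding p_def by (auto intro!: derivative_eq_intros)
    have "(H t has_derivative (\<lambda>w. X t (p s) $ 1 * w $ 2 - X t (p s) $ 2 * w $ 1)) (at (p s) within p ` {0..1})"
      by (rule has_derivative_subset[OF H_deriv[OF t pd[OF s]]]) (use pd in auto)
    from diff_chain_within[OF dp this]
    show "((\<lambda>s. H t (p s)) has_derivative (\<lambda>h. X t (p s) $ 1 * (h *\<^sub>R (b - a)) $ 2 - X t (p s) $ 2 * (h *\<^sub>R (b - a)) $ 1)) (at s within {0..1})"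
      by (simp add: o_def)
  qed simp
  then obtain s where s: "0 < s" "s < 1" and eq: "H t b - H t a = X t (p s) $ 1 * (b $ 2 - a $ 2) - X t (p s) $ 2 * (b $ 1 - a $ 1)"
    by (auto simp: p_def)
  have comp: "\<bar>X t (p s) $ i - (X t a $ i + X t b $ i) / 2\<bar> \<le> L * norm (b - a)" for i
  proof -
    have sd: "s \<in> {0..1}" using s by simp
    have "norm (X t (p s) - X t a) \<le> L * norm (p s - a)" "norm (X t (p s) - X t b) \<le> L * norm (p s - b)"
      using lip_space[OF t pd[OF sd]] a b by auto
    moreover have "norm (p s - a) \<le> norm (b - a)" "norm (p s - b) \<le> norm (b - a)"
    proof -
      show "norm (p s - a) \<le> norm (b - a)" using s by (simp add: p_def mult_left_le_one_le)
      have "p s - b = (s - 1) *\<^sub>R (b - a)" by (simp add: p_def algebra_simps)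
      then show "norm (p s - b) \<le> norm (b - a)" using s by (simp add: mult_left_le_one_le)
    qed
    ultimately have n: "norm (X t (p s) - X t a) \<le> L * norm (b - a)" "norm (X t (p s) - X t b) \<le> L * norm (b - a)"
      using L by (meson mult_left_mono order_trans)+
    have "\<bar>X t (p s) $ i - X t a $ i\<bar> \<le> L * norm (b - a)" "\<bar>X t (p s) $ i - X t b $ i\<bar> \<le> L * norm (b - a)"
      using component_le_norm_cart[of "X t (p s) - X t a" i] component_le_norm_cart[of "X t (p s) - X t b" i] n by auto
    then show ?thesis unfolding abs_le_iff by (simp add: field_simps)
  qed
  have "H t b - H t a - ((X t a $ 1 + X t b $ 1) / 2 * (b $ 2 - a $ 2) - (X t a $ 2 + X t b $ 2) / 2 * (b $ 1 - a $ 1))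
     = (X t (p s) $ 1 - (X t a $ 1 + X t b $ 1) / 2) * (b - a) $ 2 - (X t (p s) $ 2 - (X t a $ 2 + X t b $ 2) / 2) * (b - a) $ 1"
    unfolding eq by (simp add: algebra_simps)
  also have "\<bar>\<dots>\<bar> \<le> \<bar>X t (p s) $ 1 - (X t a $ 1 + X t b $ 1) / 2\<bar> * \<bar>(b - a) $ 2\<bar>
      + \<bar>X t (p s) $ 2 - (X t a $ 2 + X t b $ 2) / 2\<bar> * \<bar>(b - a) $ 1\<bar>"
    by (simp only: abs_mult[symmetric])
  also have "\<dots> \<le> (L * norm (b - a)) * norm (b - a) + (L * norm (b - a)) * norm (b - a)"
    by (intro add_mono mult_mono comp component_le_norm_cart) (use L in auto)
  also have "\<dots> = 2 * L * (norm (b - a))\<^sup>2" by (simp add: power2_eq_square)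
  finally show ?thesis .
qed

text \<open>The Lagrangian of the primitive $x_2\,dx_1$ of the area form.\<close>

definition lagr :: "real \<Rightarrow> real^2 \<Rightarrow> real" where
  "lagr t x = x $ 2 * X t x $ 1 - H t x"

lemma continuous_on_X_joint: "continuous_on ({0..1} \<times> disc) (\<lambda>(t, x). X t x)"
proof -
  have "norm (X t x - X s y) \<le> (2 * L) * norm ((t, x) - (s, y))"
    if "t \<in> {0..1}" "s \<in> {0..1}" "x \<in> disc" "y \<in> disc" for t s x y
  proof -
    have "norm (X t x - X s y) \<le> L * (norm (t - s) + norm (x - y))" using lip that by simp
    also have "\<dots> \<le> L * (norm ((t, x) - (s, y)) + norm ((t, x) - (s, y)))"
      using norm_fst_le[of "t - s" "x - y"] norm_snd_le[of "x - y" "t - s"] L by (intro mult_left_mono add_mono) auto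
    finally show ?thesis by simp
  qed
  then have "(2 * L)-lipschitz_on ({0..1} \<times> disc) (\<lambda>(t, x). X t x)"
    using L by (auto simp: lipschitz_on_def dist_norm)
  then show ?thesis by (rule lipschitz_on_continuous_on)
qed

lemma continuous_on_lagr: "continuous_on ({0..1} \<times> disc) (\<lambda>(t, x). lagr t x)"
proof -
  have "continuous_on ({0..1} \<times> disc) (\<lambda>p. snd p $ 2 * (case p of (t, x) \<Rightarrow> X t x) $ 1 - (case p of (t, x) \<Rightarrow> H t x))"
    by (intro continuous_intros continuous_on_X_joint H_continuous)
  then show ?thesis by (simp add: lagr_def case_prod_beta')
qed

lemma H_lipschitz: assumes t: "t \<in> {0..1}" shows "(4 * L)-lipschitz_on disc (H t)"
  unfolding lipschitz_on_def
proof (intro conjI ballI)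
  fix x y assume xy: "x \<in> disc" "y \<in> disc"
  have "norm (H t x - H t y) \<le> 4 * L * norm (x - y)"
  proof (rule differentiable_bound[where f' = "\<lambda>z (w::real^2). X t z $ 1 * w $ 2 - X t z $ 2 * w $ 1", OF disc_simps(2) H_deriv[OF t]])
    fix z assume z: "z \<in> disc"
    show "onorm (\<lambda>w::real^2. X t z $ 1 * w $ 2 - X t z $ 2 * w $ 1) \<le> 4 * L"
    proof (rule onorm_le)
      fix w :: "real^2"
      have "norm (X t z $ 1 * w $ 2 - X t z $ 2 * w $ 1) \<le> \<bar>X t z $ 1\<bar> * \<bar>w $ 2\<bar> + \<bar>X t z $ 2\<bar> * \<bar>w $ 1\<bar>"
        by (simp only: real_norm_def abs_mult[symmetric])
      also have "\<dots> \<le> 2 * L * norm w + 2 * L * norm w"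
        by (intro add_mono mult_mono component_le_norm_cart order_trans[OF component_le_norm_cart X_bound[OF t z]]) (use L in auto)
      finally show "norm (X t z $ 1 * w $ 2 - X t z $ 2 * w $ 1) \<le> 4 * L * norm w" by simp
    qed
  qed (use xy in auto)
  then show "dist (H t x) (H t y) \<le> 4 * L * dist x y" by (simp add: dist_norm)
qed (use L in auto)

lemma H_bound: assumes t: "t \<in> {0..1}" and x: "x \<in> disc" shows "\<bar>H t x\<bar> \<le> 8 * L"
proof -
  have e: "(axis 1 1 :: real^2) \<in> disc" "norm (axis 1 1 :: real^2) = 1" by (auto simp: mem_disc)
  have "\<bar>H t x - H t (axis 1 1)\<bar> \<le> 4 * L * norm (x - axis 1 1)"
    using lipschitz_onD[OF H_lipschitz[OF t] x e(1)] by (simp add: dist_norm)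
  also have "\<dots> \<le> 4 * L * 2"
    using norm_triangle_ineq4[of x "axis 1 1"] x e L by (intro mult_left_mono) (auto simp: mem_disc)
  finally show ?thesis using H_boundary[OF t e(2)] by simp
qed

text \<open>Makes the Lagrangian at a fixed time an admissible test function for
  \<open>integral_flow\<close>. Its product term is Lipschitz because both factors are bounded and
  Lipschitz on the disc.\<close>

lemma lagr_lipschitz: assumes t: "t \<in> {0..1}" shows "\<exists>Q. Q-lipschitz_on disc (lagr t)"
proof -
  have 1: "1-lipschitz_on disc (\<lambda>x::real^2. x $ 2)"
    by (auto simp: lipschitz_on_def dist_norm component_le_norm_cart simp flip: vector_minus_component)
  have 2: "L-lipschitz_on disc (\<lambda>x. X t x $ 1)"
    unfolding lipschitz_on_def
  proof (intro conjI ballI L)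
    fix x y assume "x \<in> disc" "y \<in> disc"
    from order_trans[OF component_le_norm_cart[of "X t x - X t y" 1] lip_space[OF t this]]
    show "dist (X t x $ 1) (X t y $ 1) \<le> L * dist x y" by (simp add: dist_norm)
  qed
  have "\<bar>x $ 2 * X t x $ 1 - y $ 2 * X t y $ 1\<bar> \<le> (L + 2 * L) * norm (x - y)" if xy: "x \<in> disc" "y \<in> disc" for x y
  proof -
    have c: "\<bar>x $ 2\<bar> \<le> 1" "\<bar>X t y $ 1\<bar> \<le> 2 * L"
      using order_trans[OF component_le_norm_cart X_bound[OF t xy(2)]] component_le_norm_cart[of x 2] xy
      by (auto simp: mem_disc)
    have "\<bar>x $ 2 * X t x $ 1 - y $ 2 * X t y $ 1\<bar> = \<bar>x $ 2 * (X t x $ 1 - X t y $ 1) + (x $ 2 - y $ 2) * X t y $ 1\<bar>"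
      by (simp add: algebra_simps)
    also have "\<dots> \<le> \<bar>x $ 2\<bar> * \<bar>X t x $ 1 - X t y $ 1\<bar> + \<bar>x $ 2 - y $ 2\<bar> * \<bar>X t y $ 1\<bar>"
      by (simp only: abs_mult[symmetric])
    also have "\<dots> \<le> 1 * (L * norm (x - y)) + norm (x - y) * (2 * L)"
      using c lipschitz_onD[OF 1 xy] lipschitz_onD[OF 2 xy] by (intro add_mono mult_mono) (auto simp: dist_norm)
    finally show ?thesis by (simp add: algebra_simps)
  qed
  then have "(L + 2 * L)-lipschitz_on disc (\<lambda>x. x $ 2 * X t x $ 1)"
    using L by (auto simp: lipschitz_on_def dist_norm)
  from lipschitz_on_diff[OF this H_lipschitz[OF t]]
  show ?thesis unfolding lagr_def by blast
qed

text \<open>The function x2 H vanishes on the circle, so its partial derivative H + x2 X1 in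
  direction x2 has integral 0. Hence x2 X1 and -H have the same integral, and the Lagrangian
  subtracts H once more.\<close>

lemma integral_lagr: assumes t: "t \<in> {0..1}"
  shows "(LBINT x:disc. lagr t x) = - 2 * (LBINT x:disc. H t x)"
proof -
  have cX: "continuous_on disc (\<lambda>x. x $ 2 * X t x $ 1)" "continuous_on disc (H t)"
    using continuous_on_X[OF t] lipschitz_on_continuous_on[OF H_lipschitz[OF t]] by (auto intro!: continuous_intros)
  note ci = continuous_on_compact_absolutely_integrable[OF disc_simps(1)]
  have "integral disc (\<lambda>x. (axis 2 1 :: real^2) $ 2 * H t x
      + x $ 2 * (X t x $ 1 * (axis 2 1 :: real^2) $ 2 - X t x $ 2 * (axis 2 1 :: real^2) $ 1)) = 0"
  \<comment> \<open>The bound 12 L consists of 8 L for |H| and 2 L for each of the two terms in the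
    differential of H, since |x2| is at most 1 and each component of X at most 2 L.\<close>
  proof (rule integral_partial_derivative_disc[where \<psi> = "\<lambda>x. x $ 2 * H t x" and L = "12 * L"
        and \<psi>' = "\<lambda>x (w::real^2). w $ 2 * H t x + x $ 2 * (X t x $ 1 * w $ 2 - X t x $ 2 * w $ 1)"])
    fix x :: "real^2" assume x: "x \<in> disc"
    show "((\<lambda>x. x $ 2 * H t x) has_derivative (\<lambda>w. w $ 2 * H t x + x $ 2 * (X t x $ 1 * w $ 2 - X t x $ 2 * w $ 1))) (at x within disc)"
      by (rule has_derivative_eq_rhs)
         (rule derivative_eq_intros H_deriv[OF t x] bounded_linear_imp_has_derivative bounded_linear_vec_nth refl
           | simp add: fun_eq_iff algebra_simps)+
    fix w :: "real^2"
    have "\<bar>w $ 2 * H t x + x $ 2 * (X t x $ 1 * w $ 2 - X t x $ 2 * w $ 1)\<bar>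
       \<le> \<bar>w $ 2\<bar> * \<bar>H t x\<bar> + \<bar>x $ 2\<bar> * (\<bar>X t x $ 1\<bar> * \<bar>w $ 2\<bar> + \<bar>X t x $ 2\<bar> * \<bar>w $ 1\<bar>)"
      unfolding abs_mult[symmetric]
      by (rule order_trans[OF abs_triangle_ineq])
         (auto simp: abs_mult intro!: mult_left_mono order_trans[OF abs_triangle_ineq4])
    also have "\<dots> \<le> norm w * (8 * L) + 1 * (2 * L * norm w + 2 * L * norm w)"
      using H_bound[OF t x] x L order_trans[OF component_le_norm_cart X_bound[OF t x]]
      by (intro add_mono mult_mono component_le_norm_cart order_trans[OF component_le_norm_cart, of x 1])
         (auto simp: mem_disc)
    finally show "\<bar>w $ 2 * H t x + x $ 2 * (X t x $ 1 * w $ 2 - X t x $ 2 * w $ 1)\<bar> \<le> (12 * L) * norm w"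
      by (simp add: algebra_simps)
  qed (use L H_boundary[OF t] in auto)
  then have "integral disc (\<lambda>x. H t x + x $ 2 * X t x $ 1) = 0" by (simp add: axis_def)
  then have "integral disc (\<lambda>x. x $ 2 * X t x $ 1) = - integral disc (H t)"
    by (subst (asm) Henstock_Kurzweil_Integration.integral_add[OF ci(2)[OF cX(2)] ci(2)[OF cX(1)]]) simp
  then have "integral disc (lagr t) = - 2 * integral disc (H t)"
    unfolding lagr_def by (subst Henstock_Kurzweil_Integration.integral_diff[OF ci(2)[OF cX(1)] ci(2)[OF cX(2)]]) simp
  then show ?thesis
    using set_borel_integral_eq_integral(2)[OF ci(3)[OF cX(2)]]
      set_borel_integral_eq_integral(2)[OF ci(3)[of "lagr t"]] lagr_lipschitz[OF t] lipschitz_on_continuous_on by metis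
qed

context
  fixes \<phi> :: "real \<Rightarrow> real^2 \<Rightarrow> real^2"
  assumes flow0: "\<And>x. x \<in> disc \<Longrightarrow> \<phi> 0 x = x"
    and flow_disc: "\<And>t x. x \<in> disc \<Longrightarrow> t \<in> {0..1} \<Longrightarrow> \<phi> t x \<in> disc"
    and flow_deriv: "\<And>t x. x \<in> disc \<Longrightarrow> t \<in> {0..1} \<Longrightarrow>
       ((\<lambda>s. \<phi> s x) has_vector_derivative X t (\<phi> t x)) (at t within {0..1})"
begin

lemma continuous_on_flow_joint: "continuous_on ({0..1} \<times> disc) (\<lambda>(t, x). \<phi> t x)"
proof -
  have "norm (\<phi> t x - \<phi> s y) \<le> (2 * L + exp L) * norm ((t, x) - (s, y))"
    if h: "t \<in> {0..1}" "s \<in> {0..1}" "x \<in> disc" "y \<in> disc" for t s x y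
  proof -
    have "norm (\<phi> t x - \<phi> s y) \<le> norm (\<phi> t x - \<phi> s x) + norm (\<phi> s x - \<phi> s y)"
      by (rule norm_diff_triangle_le) auto
    also have "\<dots> \<le> 2 * L * norm (t - s) + exp L * norm (x - y)"
      using flow_lipschitz_time[OF flow0 flow_disc flow_deriv h(3,2,1)] flow_lipschitz_space[OF flow0 flow_disc flow_deriv h(3,4,2)]
      by simp
    also have "\<dots> \<le> 2 * L * norm ((t, x) - (s, y)) + exp L * norm ((t, x) - (s, y))"
      using norm_fst_le[of "t - s" "x - y"] norm_snd_le[of "x - y" "t - s"] L by (intro add_mono mult_left_mono) auto
    finally show ?thesis by (simp add: algebra_simps)
  qed
  then have "(2 * L + exp L)-lipschitz_on ({0..1} \<times> disc) (\<lambda>(t, x). \<phi> t x)"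
    using L by (auto simp: lipschitz_on_def dist_norm add_nonneg_nonneg)
  then show ?thesis by (rule lipschitz_on_continuous_on)
qed

lemma continuous_on_lagr_flow: "continuous_on ({0..1} \<times> disc) (\<lambda>(t, x). lagr t (\<phi> t x))"
proof -
  have "continuous_on ({0..1} \<times> disc) (\<lambda>p. (fst p, case p of (t, x) \<Rightarrow> \<phi> t x))"
    by (intro continuous_intros continuous_on_flow_joint)
  moreover have "(\<lambda>p. (fst p, case p of (t, x) \<Rightarrow> \<phi> t x)) ` ({0..1} \<times> disc) \<subseteq> {0..1} \<times> disc"
    using flow_disc by auto
  ultimately show ?thesis
    using continuous_on_compose2[OF continuous_on_lagr] by (fastforce simp: case_prod_beta')
qed

lemma continuous_on_lagr_trajectory: assumes "x \<in> disc"
  shows "continuous_on {0..1} (\<lambda>t. lagr t (\<phi> t x))"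
  using continuous_on_slices(2)[OF continuous_on_lagr_flow assms] .

definition action :: "real^2 \<Rightarrow> real" where
  "action x = (LBINT t:{0..1}. lagr t (\<phi> t x))"

text \<open>After exchanging the integrals, the flow can be removed at each fixed time because it
  preserves area; \<open>integral_lagr\<close> evaluates what remains.\<close>

lemma integral_action: "(LBINT x:disc. action x) = - 2 * (LBINT t:{0..1}. (LBINT x:disc. H t x))"
proof -
  have inner: "(LBINT x:disc. lagr t (\<phi> t x)) = - 2 * (LBINT x:disc. H t x)" if t: "t \<in> {0..1}" for t
  proof -
    obtain Q where Q: "Q-lipschitz_on disc (lagr t)" using lagr_lipschitz[OF t] by blast
    note ci = continuous_on_compact_absolutely_integrable(3)[OF disc_simps(1)]
    have c1: "continuous_on disc (lagr t)" by (rule lipschitz_on_continuous_on[OF Q])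
    have c2: "continuous_on disc (\<lambda>x. lagr t (\<phi> t x))"
      using continuous_on_slices(1)[OF continuous_on_lagr_flow t] .
    have "(LBINT x:disc. lagr t (\<phi> t x)) = (LBINT x:disc. lagr t x)"
      using set_borel_integral_eq_integral(2)[OF ci[OF c1]] set_borel_integral_eq_integral(2)[OF ci[OF c2]]
        integral_flow[OF flow0 flow_disc flow_deriv t Q] by simp
    then show ?thesis using integral_lagr[OF t] by simp
  qed
  have "(LBINT x:disc. action x) = (LBINT t:{0..1}. (LBINT x:disc. lagr t (\<phi> t x)))"
    unfolding action_def by (rule set_integral_swap_disc(1)[OF continuous_on_lagr_flow])
  also have "\<dots> = (LBINT t:{0..1}. - 2 * (LBINT x:disc. H t x))"
    by (rule set_lebesgue_integral_cong) (use inner in auto)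
  finally show ?thesis by (simp add: set_lebesgue_integral_def mult.left_commute)
qed

lemma action_boundary: assumes "norm x = 1" shows "action x = 0"
proof -
  have "x \<in> disc" using assms by (simp add: mem_disc)
  then have "lagr t (\<phi> t x) = 0" if "t \<in> {0..1}" for t
    using flow_fixes_boundary[OF flow0 flow_disc flow_deriv assms that] supp[OF that] H_boundary[OF that assms] r assms
    by (simp add: lagr_def)
  then have "\<forall>t. t \<in> {0..1} \<longrightarrow> lagr t (\<phi> t x) = 0" by blast
  from set_lebesgue_integral_cong[OF _ this, of lborel] have "action x = (LBINT t:{0..1}. 0)" unfolding action_def by simp
  then show ?thesis by (simp add: set_lebesgue_integral_def)
qed

text \<open>Along two trajectories, the difference of the Lagrangians is the time derivative of the midpoint
  approximation of the integral of $x_2\,dx_1$ between them, up to a quadratic error.  No derivative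
  of the flow with respect to the initial value enters.\<close>

lemma action_difference:
  assumes a: "a \<in> disc" and b: "b \<in> disc"
  shows "\<bar>action b - action a - ((\<phi> 1 a $ 2 + \<phi> 1 b $ 2) / 2 * (\<phi> 1 b $ 1 - \<phi> 1 a $ 1)
      - (a $ 2 + b $ 2) / 2 * (b $ 1 - a $ 1))\<bar> \<le> 2 * L * (exp L)\<^sup>2 * (norm (b - a))\<^sup>2"
proof -
  let ?A = "\<lambda>t. \<phi> t a" and ?B = "\<lambda>t. \<phi> t b"
  let ?XA = "\<lambda>t. X t (\<phi> t a)" and ?XB = "\<lambda>t. X t (\<phi> t b)"
  \<comment> \<open>The integral of x2 dx1 over the segment between the two moving points. Its
    values at times 0 and 1 depend only on the end points of the two trajectories.\<close>
  define m where "m t = (?A t $ 2 + ?B t $ 2) / 2 * (?B t $ 1 - ?A t $ 1)" for t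
  define m' where "m' t = (?A t $ 2 + ?B t $ 2) / 2 * (?XB t $ 1 - ?XA t $ 1) + (?XA t $ 2 + ?XB t $ 2) / 2 * (?B t $ 1 - ?A t $ 1)" for t
  have comp: "((\<lambda>s. \<phi> s x $ i) has_real_derivative X t (\<phi> t x) $ i) (at t within {0..1})"
    if "x \<in> disc" "t \<in> {0..1}" for x t i
    using bounded_linear.has_vector_derivative[OF bounded_linear_vec_nth flow_deriv[OF that]]
    by (simp add: has_real_derivative_iff_has_vector_derivative)
  have "(m has_vector_derivative m' t) (at t within {0..1})" if t: "t \<in> {0..1}" for t
    unfolding m_def m'_def has_real_derivative_iff_has_vector_derivative[symmetric]
    by (rule DERIV_cong) (rule derivative_eq_intros comp[OF a t] comp[OF b t] refl | simp add: field_simps)+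
  then have FTC: "(m' has_integral (m 1 - m 0)) {0..1}"
    by (intro fundamental_theorem_of_calculus) auto
  have hi: "((\<lambda>t. lagr t (\<phi> t x)) has_integral action x) {0..1}" if "x \<in> disc" for x
    unfolding action_def using set_borel_integral_eq_integral[OF continuous_on_compact_absolutely_integrable(3)[OF compact_Icc continuous_on_lagr_trajectory[OF that]]]
    by (simp add: has_integral_iff)
  have "((\<lambda>t. lagr t (?B t) - lagr t (?A t) - m' t) has_integral (action b - action a - (m 1 - m 0))) {0..1}"
    by (intro has_integral_diff hi a b FTC)
  then have "norm (action b - action a - (m 1 - m 0)) \<le> (2 * L * (exp L)\<^sup>2 * (norm (b - a))\<^sup>2) * measure lborel (cbox 0 (1::real))"
  proof (intro has_integral_bound[where f = "\<lambda>t. lagr t (?B t) - lagr t (?A t) - m' t"])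
    fix t :: real assume "t \<in> cbox 0 1"
    then have t: "t \<in> {0..1}" by simp
    \<comment> \<open>The difference of the products x2 X1, minus the first part of
      \<open>m'\<close>, is the average of X1 times the difference of x2. This completes the
      trapezoidal expression bounded by \<open>H_midpoint\<close>.\<close>
    have "lagr t (?B t) - lagr t (?A t) - m' t = - (H t (?B t) - H t (?A t)
        - ((?XA t $ 1 + ?XB t $ 1) / 2 * (?B t $ 2 - ?A t $ 2) - (?XA t $ 2 + ?XB t $ 2) / 2 * (?B t $ 1 - ?A t $ 1)))"
      unfolding lagr_def m'_def by (simp add: field_simps)
    then have "norm (lagr t (?B t) - lagr t (?A t) - m' t) \<le> 2 * L * (norm (?B t - ?A t))\<^sup>2"
      using H_midpoint[OF t flow_disc[OF a t] flow_disc[OF b t]] by simp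
    also have "\<dots> \<le> 2 * L * (exp L * norm (b - a))\<^sup>2"
      using flow_lipschitz_space[OF flow0 flow_disc flow_deriv b a t] L
      by (intro mult_left_mono power_mono) auto
    finally show "norm (lagr t (?B t) - lagr t (?A t) - m' t) \<le> 2 * L * (exp L)\<^sup>2 * (norm (b - a))\<^sup>2"
      by (simp add: power_mult_distrib)
  qed (use L in auto)
  then show ?thesis using flow0[OF a] flow0[OF b] by (simp add: m_def)
qed

end

end

section \<open>From smooth Hamiltonians to their fields, and uniqueness of the Calabi
  integral\<close>

lemma vector_2_eq: "vector [a, b] = a *\<^sub>R axis 1 1 + b *\<^sub>R (axis 2 1 :: real^2)"
  by (simp add: vec_eq_iff forall_2 axis_def)

lemma has_derivative_vector_2:
  assumes "(f has_derivative f') F" "(g has_derivative g') F"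
  shows "((\<lambda>x. vector [f x, g x] :: real^2) has_derivative (\<lambda>v. vector [f' v, g' v])) F"
  unfolding vector_2_eq by (intro has_derivative_add has_derivative_scaleR_left assms)

lemma norm_vector_2_le: "norm (vector [a, b] :: real^2) \<le> \<bar>a\<bar> + \<bar>b\<bar>"
  unfolding vector_2_eq using norm_triangle_ineq[of "a *\<^sub>R axis 1 (1::real) :: real^2" "b *\<^sub>R axis 2 1"] by simp

text \<open>The difference E of two derivatives is a derivative of 0, so moving along segments gives
  E (y - x) = 0 for every y in the disc. Taking y = v/|v| and y = 0 and subtracting reaches every
  direction v, also when x is a boundary point.\<close>

lemma has_derivative_unique_disc:
  fixes f :: "real^2 \<Rightarrow> real"
  assumes "(f has_derivative D) (at x within disc)" "(f has_derivative D') (at x within disc)" "x \<in> disc"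
  shows "D = D'"
proof -
  let ?E = "\<lambda>v. D v - D' v"
  have E: "((\<lambda>y. 0) has_derivative ?E) (at x within disc)"
    using has_derivative_diff[OF assms(1,2)] by simp
  interpret E: bounded_linear ?E using has_derivative_bounded_linear[OF E] .
  have zero: "?E (y - x) = 0" if y: "y \<in> disc" for y
  proof -
    define p where "p s = x + s *\<^sub>R (y - x)" for s :: real
    have pd: "p ` {0..1} \<subseteq> disc"
      using convexD_alt[OF disc_simps(2) assms(3) y] by (auto simp: p_def algebra_simps)
    have "(p has_vector_derivative (y - x)) (at 0 within {0..1})"
      unfolding p_def by (auto intro!: derivative_eq_intros)
    moreover have "((\<lambda>y. 0::real) has_derivative ?E) (at (p 0) within p ` {0..1})"
      using has_derivative_subset[OF E pd] by (simp add: p_def)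
    ultimately have "((\<lambda>s. 0) has_vector_derivative ?E (y - x)) (at 0 within {0..1::real})"
      using vector_derivative_diff_chain_within[of p "y - x" 0 "{0..1}" "\<lambda>y. 0" ?E] by (simp add: o_def)
    moreover have "((\<lambda>s. 0::real) has_vector_derivative 0) (at 0 within {0..1::real})" by simp
    ultimately show ?thesis
      using vector_derivative_unique_within_closed_interval[of 0 1 0 "\<lambda>s. 0" "?E (y - x)" 0] by simp
  qed
  have "?E v = 0" for v
  proof (cases "v = 0")
    case False
    have "inverse (norm v) *\<^sub>R v \<in> disc" "0 \<in> disc" using False by (auto simp: mem_disc)
    from zero[OF this(1)] zero[OF this(2)] have "?E (inverse (norm v) *\<^sub>R v) = 0" by (simp only: E.diff) simp
    then show ?thesis using False by (simp only: E.scaleR) simp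
  qed (simp only: E.zero)
  then show ?thesis by auto
qed

lemma frechet_derivative_disc:
  fixes f :: "real^2 \<Rightarrow> real"
  assumes "(f has_derivative D) (at x within disc)" "x \<in> disc"
  shows "frechet_derivative f (at x within disc) = D"
proof -
  have "f differentiable (at x within disc)" using assms(1) by (auto simp: differentiable_def)
  then show ?thesis using has_derivative_unique_disc[OF _ assms] by (simp add: frechet_derivative_works)
qed

text \<open>Compactness bounds the finitely many partial derivatives; convexity turns the bound into
  a Lipschitz constant.\<close>

lemma Ck_on_1_lipschitz:
  fixes g :: "'a::euclidean_space \<Rightarrow> real"
  assumes "Ck_on 1 U g" "compact K" "convex K" "K \<subseteq> U"
  obtains L where "0 \<le> L" "\<And>p v. p \<in> K \<Longrightarrow> \<bar>frechet_derivative g (at p) v\<bar> \<le> L * norm v"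
    "\<And>p q. p \<in> K \<Longrightarrow> q \<in> K \<Longrightarrow> \<bar>g p - g q\<bar> \<le> L * norm (p - q)"
proof -
  have C1: "Ck_on (Suc 0) U g" using assms(1) by simp
  have der: "(g has_derivative frechet_derivative g (at p)) (at p)" if "p \<in> K" for p
    using Ck_on_Suc_has_derivative[OF C1] that assms(4) by blast
  have "\<exists>B. \<forall>p\<in>K. \<bar>frechet_derivative g (at p) b\<bar> \<le> B" for b
  proof -
    have "continuous_on K (\<lambda>p. frechet_derivative g (at p) b)"
      using C1 assms(4) by (auto intro: continuous_on_subset)
    then show ?thesis
      using compact_imp_bounded[OF compact_continuous_image[OF _ assms(2)]] by (fastforce simp: bounded_iff)
  qed
  then obtain B where B: "\<And>b p. p \<in> K \<Longrightarrow> \<bar>frechet_derivative g (at p) b\<bar> \<le> B b" by metis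
  define L where "L = (\<Sum>b\<in>Basis. \<bar>B b\<bar>)"
  have bd: "\<bar>frechet_derivative g (at p) v\<bar> \<le> L * norm v" if p: "p \<in> K" for p v
  proof -
    interpret D: bounded_linear "frechet_derivative g (at p)" using has_derivative_bounded_linear[OF der[OF p]] .
    have "frechet_derivative g (at p) v = frechet_derivative g (at p) (\<Sum>b\<in>Basis. (v \<bullet> b) *\<^sub>R b)"
      by (simp add: euclidean_representation)
    also have "\<dots> = (\<Sum>b\<in>Basis. (v \<bullet> b) * frechet_derivative g (at p) b)" by (simp add: D.sum D.scaleR)
    also have "\<bar>\<dots>\<bar> \<le> (\<Sum>b\<in>Basis. \<bar>B b\<bar> * norm v)"
    proof (rule order_trans[OF sum_abs sum_mono])
      fix b :: 'a assume b: "b \<in> Basis"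
      show "\<bar>(v \<bullet> b) * frechet_derivative g (at p) b\<bar> \<le> \<bar>B b\<bar> * norm v"
        unfolding abs_mult mult.commute[of "\<bar>v \<bullet> b\<bar>"]
        using Basis_le_norm[OF b, of v] B[OF p, of b] by (intro mult_mono) auto
    qed
    finally show ?thesis by (simp add: L_def sum_distrib_right)
  qed
  show thesis
  proof (rule that[of L])
    show "0 \<le> L" by (simp add: L_def sum_nonneg)
    fix p q assume pq: "p \<in> K" "q \<in> K"
    have "norm (g p - g q) \<le> L * norm (p - q)"
    proof (rule differentiable_bound[OF assms(3)])
      fix z assume z: "z \<in> K"
      show "(g has_derivative frechet_derivative g (at z)) (at z within K)"
        using der[OF z] by (rule has_derivative_at_withinI)
      show "onorm (frechet_derivative g (at z)) \<le> L"
        using bd[OF z] by (intro onorm_le) simp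
    qed (use pq in auto)
    then show "\<bar>g p - g q\<bar> \<le> L * norm (p - q)" by simp
  qed (use bd in auto)
qed

text \<open>All bounds come from first and second derivatives of a smooth extension of H around the
  compact convex set [0,1] x disc. The divergence vanishes by the symmetry of mixed
  derivatives.\<close>

lemma hamiltonian_imp_field:
  assumes "hamiltonian H"
  obtains X' L r where "hamiltonian_field (\<lambda>t. ham_field (H t)) X' L r H"
proof -
  obtain U F where U: "open U" "{0..1} \<times> disc \<subseteq> U" and Ck: "\<And>k. Ck_on k U F"
    and F: "\<And>p. p \<in> {0..1} \<times> disc \<Longrightarrow> F p = (\<lambda>(t, x). H t x) p"
    using assms unfolding hamiltonian_def smooth_on_def by blast
  obtain r where r: "r < 1" and Hr: "\<And>t x. t \<in> {0..1} \<Longrightarrow> x \<in> disc \<Longrightarrow> r \<le> norm x \<Longrightarrow> H t x = 0"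
    using assms unfolding hamiltonian_def by blast
  define D where "D v p = frechet_derivative F (at p) v" for v p
  have CkD: "Ck_on k U (D v)" for k v using Ck[of "Suc k"] unfolding D_def[abs_def] by (simp only: Ck_on.simps)
  have K: "compact ({0..1::real} \<times> disc)" "convex ({0..1::real} \<times> disc)" by (auto intro: compact_Times convex_Times)
  have FD: "(F has_derivative (\<lambda>v. D v p)) (at p)" if "p \<in> U" for p
    using Ck_on_Suc_has_derivative[OF Ck that] by (simp add: D_def)
  let ?a = "(0::real, axis 1 1 :: real^2)" and ?b = "(0::real, axis 2 1 :: real^2)"
  have D_pair: "D (0, w) p = w $ 1 * D ?a p + w $ 2 * D ?b p" if "p \<in> U" for w p
  proof -
    interpret D: bounded_linear "\<lambda>v. D v p" using has_derivative_bounded_linear[OF FD[OF that]] .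
    have "(0, w) = w $ 1 *\<^sub>R ?a + w $ 2 *\<^sub>R ?b" by (simp add: vec_eq_iff forall_2 axis_def)
    then show ?thesis by (simp only: D.add D.scaleR) simp
  qed
  have inU: "(t, x) \<in> U" if "t \<in> {0..1}" "x \<in> disc" for t x using that U(2) by auto
  have dH: "(H t has_derivative (\<lambda>w. w $ 1 * D ?a (t, x) + w $ 2 * D ?b (t, x))) (at x within disc)"
    if "t \<in> {0..1}" "x \<in> disc" for t x
  proof -
    have "((\<lambda>y. F (t, y)) has_derivative (\<lambda>w. D (0, w) (t, x))) (at x within disc)"
      by (rule has_derivative_compose[where f = "\<lambda>y. (t, y)" and f' = "\<lambda>w. (0, w)" and g = F, OF _ FD[OF inU[OF that]]])
         (auto intro!: derivative_eq_intros)
    then have "((\<lambda>y. F (t, y)) has_derivative (\<lambda>w. w $ 1 * D ?a (t, x) + w $ 2 * D ?b (t, x))) (at x within disc)"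
      by (rule has_derivative_eq_rhs) (rule ext, rule D_pair[OF inU[OF that]])
    then show ?thesis by (rule has_derivative_transform[OF that(2), rotated]) (use F that in auto)
  qed
  define X where "X = (\<lambda>t. ham_field (H t))"
  have X: "X t x = vector [D ?b (t, x), - D ?a (t, x)]" if "t \<in> {0..1}" "x \<in> disc" for t x
    unfolding X_def ham_field_def frechet_derivative_disc[OF dH[OF that] that(2)] by (simp add: axis_def)
  obtain L1 where L1: "0 \<le> L1" "\<And>p v. p \<in> {0..1} \<times> disc \<Longrightarrow> \<bar>frechet_derivative (D ?a) (at p) v\<bar> \<le> L1 * norm v"
    "\<And>p q. p \<in> {0..1} \<times> disc \<Longrightarrow> q \<in> {0..1} \<times> disc \<Longrightarrow> \<bar>D ?a p - D ?a q\<bar> \<le> L1 * norm (p - q)"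
    using Ck_on_1_lipschitz[OF CkD K U(2)] by metis
  obtain L2 where L2: "0 \<le> L2" "\<And>p v. p \<in> {0..1} \<times> disc \<Longrightarrow> \<bar>frechet_derivative (D ?b) (at p) v\<bar> \<le> L2 * norm v"
    "\<And>p q. p \<in> {0..1} \<times> disc \<Longrightarrow> q \<in> {0..1} \<times> disc \<Longrightarrow> \<bar>D ?b p - D ?b q\<bar> \<le> L2 * norm (p - q)"
    using Ck_on_1_lipschitz[OF CkD K U(2)] by metis
  define X' :: "real \<Rightarrow> real^2 \<Rightarrow> real^2 \<Rightarrow> real^2" where "X' t x v = vector [frechet_derivative (D ?b) (at (t, x)) (0, v),
      - frechet_derivative (D ?a) (at (t, x)) (0, v)]" for t x v
  \<comment> \<open>That the field vanishes at a point is derived from H being 0 on a neighbourhood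
    within the disc, so the collar of radii from r to 1 is halved.\<close>
  have "hamiltonian_field X X' (L1 + L2) ((r + 1) / 2) H"
  proof
    show "(r + 1) / 2 < 1" "0 \<le> L1 + L2" using r L1 L2 by auto
    show "continuous_on ({0..1} \<times> disc) (\<lambda>(t, x). H t x)"
    proof -
      have "continuous_on ({0..1} \<times> disc) F"
        using Ck[of 0] U(2) by (auto intro: continuous_on_subset)
      then show ?thesis using F by (auto cong: continuous_on_cong)
    qed
  next
    fix t s :: real and x y assume h: "t \<in> {0..1}" "s \<in> {0..1}" "x \<in> disc" "y \<in> disc"
    have n: "norm ((t, x) - (s, y)) \<le> \<bar>t - s\<bar> + norm (x - y)" using norm_Pair_le[of "t - s" "x - y"] by simp
    have "X t x - X s y = vector [D ?b (t, x) - D ?b (s, y), - (D ?a (t, x) - D ?a (s, y))]"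
      unfolding X[OF h(1,3)] X[OF h(2,4)] by (simp add: vec_eq_iff forall_2)
    then have "norm (X t x - X s y) \<le> \<bar>D ?b (t, x) - D ?b (s, y)\<bar> + \<bar>D ?a (t, x) - D ?a (s, y)\<bar>"
      using norm_vector_2_le[of "D ?b (t, x) - D ?b (s, y)" "- (D ?a (t, x) - D ?a (s, y))"] by simp
    also have "\<dots> \<le> L2 * norm ((t, x) - (s, y)) + L1 * norm ((t, x) - (s, y))"
      using h by (intro add_mono L1 L2) auto
    also have "\<dots> = (L1 + L2) * norm ((t, x) - (s, y))" by (simp add: algebra_simps)
    also have "\<dots> \<le> (L1 + L2) * (\<bar>t - s\<bar> + norm (x - y))" using n L1 L2 by (intro mult_left_mono) auto
    finally show "norm (X t x - X s y) \<le> (L1 + L2) * (\<bar>t - s\<bar> + norm (x - y))" .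
  next
    fix t :: real and x assume h: "t \<in> {0..1}" "x \<in> disc" "(r + 1) / 2 \<le> norm x"
    have "((\<lambda>y. 0::real) has_derivative (\<lambda>w. 0)) (at x within disc)" by simp
    then have "(H t has_derivative (\<lambda>w. 0)) (at x within disc)"
    proof (rule has_derivative_transform_within[of _ _ _ _ "(1 - r) / 2"])
      fix y assume y: "y \<in> disc" "dist y x < (1 - r) / 2"
      have "norm x \<le> norm y + dist y x" by (metis dist_norm norm_triangle_sub norm_minus_commute)
      then have "r \<le> norm y" using y h(3) by (simp add: field_simps)
      then show "0 = H t y" using Hr[OF h(1) y(1)] by simp
    qed (use r h in auto)
    from frechet_derivative_disc[OF this h(2)] have "ham_field (H t) x = vector [0, - 0]"
      unfolding ham_field_def by simp
    then show "X t x = 0" by (simp add: X_def vec_eq_iff forall_2)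
  next
    fix t :: real and x :: "real^2" assume h: "t \<in> {0..1}" "norm x < 1"
    have x: "x \<in> disc" using h by (simp add: mem_disc)
    have dD: "((\<lambda>y. D v (t, y)) has_derivative (\<lambda>w. frechet_derivative (D v) (at (t, x)) (0, w))) (at x)" for v
      by (rule has_derivative_compose[where f = "\<lambda>y. (t, y)" and f' = "\<lambda>w. (0, w)" and g = "D v",
            OF _ Ck_on_Suc_has_derivative[OF CkD inU[OF h(1) x]]])
         (auto intro!: derivative_eq_intros)
    have "((\<lambda>y. vector [D ?b (t, y), - D ?a (t, y)]) has_derivative X' t x) (at x)"
      unfolding X'_def by (intro has_derivative_vector_2 has_derivative_minus dD)
    then show "(X t has_derivative X' t x) (at x)"
      by (rule has_derivative_transform_within_open[of _ _ _ _ "ball 0 1"]) (use h X in \<open>auto simp: mem_disc\<close>)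
    show "X' t x (axis 1 1) $ 1 + X' t x (axis 2 1) $ 2 = 0"
      using second_derivative_symmetric[OF U(1) inU[OF h(1) x] Ck, of ?a ?b]
      by (simp add: X'_def D_def[abs_def])
    fix v
    have "norm (X' t x v) \<le> \<bar>frechet_derivative (D ?b) (at (t, x)) (0, v)\<bar> + \<bar>frechet_derivative (D ?a) (at (t, x)) (0, v)\<bar>"
      unfolding X'_def by (rule order_trans[OF norm_vector_2_le]) simp
    also have "\<dots> \<le> L2 * norm (0::real, v) + L1 * norm (0::real, v)"
      using h x by (intro add_mono L1 L2) auto
    finally show "norm (X' t x v) \<le> (L1 + L2) * norm v" by (simp add: algebra_simps norm_Pair)
  next
    fix t x assume h: "t \<in> {0..1::real}" "x \<in> disc"
    show "(H t has_derivative (\<lambda>w. X t x $ 1 * w $ 2 - X t x $ 2 * w $ 1)) (at x within disc)"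
      using dH[OF h] by (simp add: X[OF h] mult.commute add.commute)
  next
    fix t and x :: "real^2" assume "t \<in> {0..1::real}" "norm x = 1"
    then show "H t x = 0" using Hr[of t x] r by (simp add: mem_disc)
  qed
  then show thesis using that unfolding X_def by blast
qed

text \<open>The main term in \<open>action_difference\<close> depends only on the time-one map,
  which both flows share, so the difference of the two actions varies at most quadratically and is
  constant. It is 0 on the circle, hence everywhere, and \<open>integral_action\<close> turns equal
  actions into equal integrals of the Hamiltonians.\<close>

lemma generates_integral_unique:
  assumes "generates H g" "generates K g"
  shows "(LBINT t:{0..1}. (LBINT x:disc. H t x)) = (LBINT t:{0..1}. (LBINT x:disc. K t x))"
proof -
  obtain \<phi> where \<phi>: "ham_flow H \<phi>" "\<And>x. x \<in> disc \<Longrightarrow> \<phi> 1 x = g x" and hH: "hamiltonian H"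
    using assms(1) unfolding generates_def by blast
  obtain \<psi> where \<psi>: "ham_flow K \<psi>" "\<And>x. x \<in> disc \<Longrightarrow> \<psi> 1 x = g x" and hK: "hamiltonian K"
    using assms(2) unfolding generates_def by blast
  obtain X' L r where "hamiltonian_field (\<lambda>t. ham_field (H t)) X' L r H" using hamiltonian_imp_field[OF hH] .
  then interpret A: hamiltonian_field "\<lambda>t. ham_field (H t)" X' L r H .
  obtain Y' M q where "hamiltonian_field (\<lambda>t. ham_field (K t)) Y' M q K" using hamiltonian_imp_field[OF hK] .
  then interpret B: hamiltonian_field "\<lambda>t. ham_field (K t)" Y' M q K .
  have fA: "\<And>x. x \<in> disc \<Longrightarrow> \<phi> 0 x = x" "\<And>t x. x \<in> disc \<Longrightarrow> t \<in> {0..1} \<Longrightarrow> \<phi> t x \<in> disc"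
    "\<And>t x. x \<in> disc \<Longrightarrow> t \<in> {0..1} \<Longrightarrow>
       ((\<lambda>s. \<phi> s x) has_vector_derivative ham_field (H t) (\<phi> t x)) (at t within {0..1})"
    using \<phi>(1) unfolding ham_flow_def by blast+
  have fB: "\<And>x. x \<in> disc \<Longrightarrow> \<psi> 0 x = x" "\<And>t x. x \<in> disc \<Longrightarrow> t \<in> {0..1} \<Longrightarrow> \<psi> t x \<in> disc"
    "\<And>t x. x \<in> disc \<Longrightarrow> t \<in> {0..1} \<Longrightarrow>
       ((\<lambda>s. \<psi> s x) has_vector_derivative ham_field (K t) (\<psi> t x)) (at t within {0..1})"
    using \<psi>(1) unfolding ham_flow_def by blast+
  define d where "d x = A.action \<phi> x - B.action \<psi> x" for x
  let ?C = "2 * L * (exp L)\<^sup>2 + 2 * M * (exp M)\<^sup>2"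
  have quad: "\<bar>d b - d a\<bar> \<le> ?C * (norm (b - a))\<^sup>2" if ab: "b \<in> disc" "a \<in> disc" for a b
    using A.action_difference[OF fA ab(2,1)] B.action_difference[OF fB ab(2,1)] ab
    unfolding d_def distrib_right by (simp add: \<phi>(2) \<psi>(2))
  have e: "(axis 1 1 :: real^2) \<in> disc" "norm (axis 1 1 :: real^2) = 1" by (auto simp: mem_disc)
  have "d x = 0" if "x \<in> disc" for x
    using constant_on_of_quadratic_bound[OF disc_simps(2) quad that e(1)]
      A.action_boundary[OF fA e(2)] B.action_boundary[OF fB e(2)] by (simp add: d_def)
  then have "(LBINT x:disc. A.action \<phi> x) = (LBINT x:disc. B.action \<psi> x)"
    by (intro set_lebesgue_integral_cong) (auto simp: d_def)
  then show ?thesis using A.integral_action[OF fA] B.integral_action[OF fB] by simp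
qed

lemma calabi_eq:
  assumes "generates H g"
  shows "calabi g = 2 * (LBINT t:{0..1}. (LBINT x:disc. H t x))"
  unfolding calabi_def
proof (rule the_equality)
  show "\<exists>K. generates K g \<and> 2 * (LBINT t:{0..1}. (LBINT x:disc. H t x)) = 2 * (LBINT t:{0..1}. (LBINT x:disc. K t x))"
    using assms by blast
  fix c assume "\<exists>K. generates K g \<and> c = 2 * (LBINT t:{0..1}. (LBINT x:disc. K t x))"
  then obtain K where "generates K g" "c = 2 * (LBINT t:{0..1}. (LBINT x:disc. K t x))" by blast
  then show "c = 2 * (LBINT t:{0..1}. (LBINT x:disc. H t x))"
    using generates_integral_unique[OF _ assms] by simp
qed

section \<open>The winding of pairs of points\<close>

lemma smooth_on_continuous_on: "smooth_on S f \<Longrightarrow> continuous_on S f"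
proof -
  assume "smooth_on S f"
  then obtain U F where "open U" "S \<subseteq> U" "\<And>k. Ck_on k U F" "\<And>x. x \<in> S \<Longrightarrow> F x = f x"
    unfolding smooth_on_def by blast
  then show ?thesis
    using continuous_on_subset[of U F S] Ck_on.simps(1)[of U F] continuous_on_cong[of S S F f] by metis
qed

text \<open>\<open>area_diff\<close> controls areas of images, while substitution needs preimages:
  \<open>g\<close> permutes the disc, so it maps the preimage of A onto A. Thus Lebesgue measure on
  the disc is its own push-forward.\<close>

lemma area_diff_nn_integral:
  assumes g: "g \<in> area_diff" and f: "f \<in> borel_measurable borel"
  shows "(\<integral>\<^sup>+x\<in>disc. f (g x) \<partial>lborel) = (\<integral>\<^sup>+x\<in>disc. f x \<partial>lborel)"
proof -
  let ?M = "restrict_space lborel disc"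
  have perm: "g permutes disc" and cont: "continuous_on disc g"
    and area: "\<And>A. A \<in> sets lebesgue \<Longrightarrow> A \<subseteq> disc \<Longrightarrow> emeasure lebesgue (g ` A) = emeasure lebesgue A"
    using g smooth_on_continuous_on unfolding area_diff_def by blast+
  have gd: "g x \<in> disc \<longleftrightarrow> x \<in> disc" for x using permutes_in_image[OF perm] .
  have "g \<in> borel_measurable (restrict_space borel disc)"
    by (rule borel_measurable_continuous_on_restrict[OF cont])
  then have mg: "g \<in> measurable ?M ?M"
    by (intro measurable_restrict_space2) (auto simp: gd space_restrict_space cong: measurable_cong_sets sets_restrict_space_cong)
  have "distr ?M ?M g = ?M"
  proof (rule measure_eqI)
    fix A assume "A \<in> sets (distr ?M ?M g)"
    then have A: "A \<in> sets ?M" by simp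
    then have A': "A \<subseteq> disc" "A \<in> sets borel" by (auto simp: sets_restrict_space)
    let ?B = "g -` A \<inter> disc"
    have B: "?B \<in> sets ?M" using measurable_sets[OF mg A] by (simp add: space_restrict_space)
    then have B': "?B \<in> sets borel" by (auto simp: sets_restrict_space)
    have gB: "g ` ?B = A"
    proof (intro equalityI subsetI)
      fix y assume y: "y \<in> A"
      have "g (inv g y) = y" using permutes_inverses(1)[OF perm] .
      then show "y \<in> g ` ?B" using y A' gd[of "inv g y"] by (intro image_eqI[of _ _ "inv g y"]) auto
    qed auto
    have "emeasure (distr ?M ?M g) A = emeasure ?M ?B"
      using emeasure_distr[OF mg A] by (simp add: space_restrict_space)
    also have "\<dots> = emeasure lborel ?B" by (rule emeasure_restrict_space) auto
    also have "\<dots> = emeasure lebesgue ?B" using B' by simp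
    also have "\<dots> = emeasure lebesgue A" using area[of ?B] B' gB by simp
    also have "\<dots> = emeasure ?M A" using A' by (simp add: emeasure_restrict_space)
    finally show "emeasure (distr ?M ?M g) A = emeasure ?M A" .
  qed simp
  then have "(\<integral>\<^sup>+x. f x \<partial>?M) = (\<integral>\<^sup>+x. f x \<partial>distr ?M ?M g)" by simp
  also have "\<dots> = (\<integral>\<^sup>+x. f (g x) \<partial>?M)"
    by (rule nn_integral_distr[OF mg]) (use f in \<open>auto intro: measurable_restrict_space1\<close>)
  finally show ?thesis by (simp add: nn_integral_restrict_space)
qed

lemma nn_integral_inverse_dist_le:
  fixes p :: "real^2"
  assumes "p \<in> disc"
  shows "(\<integral>\<^sup>+x\<in>disc. ennreal (1 / norm (x - p)) \<partial>lborel) \<le> ennreal (8 * pi)"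
proof -
  \<comment> \<open>dyadic decomposition of the disc around \<open>p\<close>\<close>
  have le: "ennreal (1 / norm (x - p)) * indicator disc x
    \<le> suminf (\<lambda>k. ennreal (2 ^ k) * indicator (cball p (2 * (1 / 2) ^ k)) x)" for x
  proof (cases "x \<in> disc \<and> x \<noteq> p")
    case True
    let ?P = "\<lambda>k. (1 / 2) ^ k \<le> norm (x - p)"
    have "\<exists>k. ?P k"
      using real_arch_pow_inv[of "norm (x - p)" "1 / 2"] True by (auto intro: less_imp_le)
    \<comment> \<open>For the least such k the distance lies between 2^(-k) and 2 * 2^(-k); for k =
      0 the upper bound is the diameter of the disc.\<close>
    define k where "k = (LEAST k. ?P k)"
    have k: "?P k" unfolding k_def using \<open>\<exists>k. ?P k\<close> by (rule LeastI_ex)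
    have "norm (x - p) \<le> 2 * (1 / 2) ^ k"
    proof (cases k)
      case 0
      have "norm (x - p) \<le> norm x + norm p" by (rule norm_triangle_ineq4)
      then show ?thesis using 0 True assms by (simp add: mem_disc)
    next
      case (Suc j)
      then have "\<not> ?P j" unfolding k_def using not_less_Least[of j ?P] by simp
      then show ?thesis using Suc by simp
    qed
    then have xk: "x \<in> cball p (2 * (1 / 2) ^ k)" by (simp add: dist_norm norm_minus_commute)
    have "1 / norm (x - p) \<le> 2 ^ k"
      using k True by (simp add: field_simps power_divide)
    then have "ennreal (1 / norm (x - p)) * indicator disc x \<le> ennreal (2 ^ k) * indicator (cball p (2 * (1 / 2) ^ k)) x"
      using True xk by (simp add: ennreal_leI del: mem_cball)
    also have "\<dots> = sum (\<lambda>k. ennreal (2 ^ k) * indicator (cball p (2 * (1 / 2) ^ k)) x) {k}"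
      by (simp del: sum_mult_indicator)
    also have "\<dots> \<le> suminf (\<lambda>k. ennreal (2 ^ k) * indicator (cball p (2 * (1 / 2) ^ k)) x)"
      by (rule sum_le_suminf) auto
    finally show ?thesis .
  qed auto
  \<comment> \<open>The k-th ball has area 4 pi 4^(-k); the weight 2^k leaves 4 pi 2^(-k), and these
    numbers sum to 8 pi.\<close>
  have vol: "ennreal (2 ^ k) * emeasure lborel (cball p (2 * (1 / 2) ^ k)) = ennreal (4 * pi * (1 / 2) ^ k)" for k
  proof -
    have "emeasure lborel (cball p (2 * (1 / 2) ^ k)) = ennreal (unit_ball_vol 2 * (2 * (1 / 2) ^ k)\<^sup>2)"
      by (simp add: emeasure_cball)
    then show ?thesis
      by (simp add: unit_ball_vol_2 ennreal_mult[symmetric] power2_eq_square power_divide field_simps)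
  qed
  have "(\<integral>\<^sup>+x\<in>disc. ennreal (1 / norm (x - p)) \<partial>lborel)
      \<le> (\<integral>\<^sup>+x. suminf (\<lambda>k. ennreal (2 ^ k) * indicator (cball p (2 * (1 / 2) ^ k)) x) \<partial>lborel)"
    by (rule nn_integral_mono) (use le in simp)
  also have "\<dots> = suminf (\<lambda>k. \<integral>\<^sup>+x. ennreal (2 ^ k) * indicator (cball p (2 * (1 / 2) ^ k)) x \<partial>lborel)"
    by (rule nn_integral_suminf) (auto intro!: borel_measurable_times_ennreal borel_measurable_indicator)
  also have "\<dots> = suminf (\<lambda>k. ennreal (4 * pi * (1 / 2) ^ k))"
    by (simp add: nn_integral_cmult_indicator vol)
  also have "\<dots> = ennreal (suminf (\<lambda>k. 4 * pi * (1 / 2) ^ k))"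
    by (rule suminf_ennreal2) (auto intro: summable_mult summable_geometric)
  also have "suminf (\<lambda>k. 4 * pi * (1 / 2) ^ k) = 8 * pi"
    using suminf_mult[OF summable_geometric[of "1 / 2 :: real"], of "4 * pi"] suminf_geometric[of "1 / 2 :: real"] by simp
  finally show ?thesis .
qed

text \<open>The integral is a logarithm of z 1 / z 0 followed along the path, with no choice of
  branch: z exp(-W) has derivative 0, where W is the integral up to time t.\<close>

lemma exp_integral_log_derivative:
  fixes z z' :: "real \<Rightarrow> complex"
  assumes der: "\<And>t. t \<in> {0..1} \<Longrightarrow> (z has_vector_derivative z' t) (at t within {0..1})"
    and nz: "\<And>t. t \<in> {0..1} \<Longrightarrow> z t \<noteq> 0" and cont: "continuous_on {0..1} z'"
  shows "z 1 = z 0 * exp (integral {0..1} (\<lambda>t. z' t / z t))"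
proof -
  define W where "W t = integral {0..t} (\<lambda>t. z' t / z t)" for t
  have cz: "continuous_on {0..1} z" by (auto simp: continuous_on_eq_continuous_within intro: has_vector_derivative_continuous[OF der])
  have cq: "continuous_on {0..1} (\<lambda>t. z' t / z t)" by (intro continuous_intros cont cz) (use nz in auto)
  have dW: "(W has_vector_derivative z' t / z t) (at t within {0..1})" if "t \<in> {0..1}" for t
    unfolding W_def by (rule integral_has_vector_derivative[OF cq that])
  have "((\<lambda>t. z t * exp (- W t)) has_vector_derivative 0) (at t within {0..1})" if t: "t \<in> {0..1}" for t
  proof -
    have "((\<lambda>t. exp (- W t)) has_vector_derivative (- (z' t / z t) * exp (- W t))) (at t within {0..1})"
      using field_vector_diff_chain_within[OF has_vector_derivative_minus[OF dW[OF t]]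
          has_field_derivative_at_within[OF DERIV_exp]] by (simp add: o_def)
    from has_vector_derivative_mult[OF der[OF t] this] nz[OF t]
    show ?thesis by (simp add: field_simps)
  qed
  then obtain c where c: "\<And>t. t \<in> {0..1} \<Longrightarrow> z t * exp (- W t) = c"
    using has_vector_derivative_zero_constant[of "{0..1}" "\<lambda>t. z t * exp (- W t)"] by auto
  have "z 1 * exp (- W 1) = z 0 * exp (- W 0)" using c[of 0] c[of 1] by simp
  then have "z 1 * exp (- W 1) * exp (W 1) = z 0 * exp (W 1)" by (simp add: W_def)
  then show ?thesis by (simp add: W_def mult.assoc flip: exp_add)
qed

text \<open>Identifies the plane with the complex numbers, so that arguments of differences of
  points become imaginary parts of logarithms.\<close>

definition cpx :: "real^2 \<Rightarrow> complex" where
  "cpx x = Complex (x $ 1) (x $ 2)"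

lemma bounded_linear_cpx: "bounded_linear cpx"
proof -
  have "cpx = (\<lambda>x. complex_of_real (x $ 1) + \<i> * complex_of_real (x $ 2))"
    by (auto simp: cpx_def complex_eq_iff)
  moreover have "bounded_linear (\<lambda>x::real^2. complex_of_real (x $ 1) + \<i> * complex_of_real (x $ 2))"
    by (intro bounded_linear_add bounded_linear_compose[OF bounded_linear_of_real bounded_linear_vec_nth]
          bounded_linear_const_mult)
  ultimately show ?thesis by simp
qed

lemma norm_cpx [simp]: "norm (cpx x) = norm x"
  by (simp add: cpx_def norm_vec_def L2_set_def sum_2 cmod_def)

lemma cpx_diff: "cpx (x - y) = cpx x - cpx y"
  and cpx_eq_iff: "cpx x = cpx y \<longleftrightarrow> x = y"
  and cpx_0 [simp]: "cpx 0 = 0"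
  by (auto simp: cpx_def complex_eq_iff vec_eq_iff forall_2)

lemmas continuous_on_cpx [continuous_intros] = bounded_linear.continuous_on[OF bounded_linear_cpx]

lemma Re_one_minus_pos:
  assumes "norm w \<le> 1" "w \<noteq> 1" shows "0 < Re (1 - w)"
proof (rule ccontr)
  assume "\<not> 0 < Re (1 - w)"
  then have "Re w \<ge> 1" by simp
  moreover have "Re w \<le> norm w" by (rule complex_Re_le_cmod)
  ultimately have re: "Re w = 1" and "norm w = 1" using assms by auto
  then have "Im w = 0" by (simp add: cmod_def)
  with re assms(2) show False by (simp add: complex_eq_iff)
qed

text \<open>The velocity is the time derivative of a smooth extension, hence jointly continuous up
  to the end times and up to the circle.\<close>

lemma smooth_isotopy_velocity:
  assumes "smooth_isotopy \<gamma> g0 g1"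
  obtains V where "continuous_on ({0..1} \<times> disc) (\<lambda>(t, x). V t x)"
    "\<And>t x. t \<in> {0..1} \<Longrightarrow> x \<in> disc \<Longrightarrow> ((\<lambda>s. \<gamma> s x) has_vector_derivative V t x) (at t within {0..1})"
proof -
  obtain U F where U: "open U" "{0..1} \<times> disc \<subseteq> U" and Ck: "\<And>k. Ck_on k U F"
    and F: "\<And>p. p \<in> {0..1} \<times> disc \<Longrightarrow> F p = (\<lambda>(t, x). \<gamma> t x) p"
    using assms unfolding smooth_isotopy_def smooth_on_def by blast
  define V where "V t x = frechet_derivative F (at (t, x)) (1, 0)" for t x
  have "Ck_on 0 U (\<lambda>p. frechet_derivative F (at p) (1, 0))" using Ck[of "Suc 0"] by (simp only: Ck_on.simps)
  then have c: "continuous_on ({0..1} \<times> disc) (\<lambda>(t, x). V t x)"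
    using U(2) by (auto simp: V_def case_prod_beta' intro: continuous_on_subset)
  have d: "((\<lambda>s. \<gamma> s x) has_vector_derivative V t x) (at t within {0..1})" if tx: "t \<in> {0..1}" "x \<in> disc" for t x
  proof -
    have p: "(t, x) \<in> U" using tx U(2) by auto
    have FD: "(F has_derivative frechet_derivative F (at (t, x))) (at (t, x))"
      using Ck_on_Suc_has_derivative[OF Ck p] .
    interpret D: bounded_linear "frechet_derivative F (at (t, x))" using has_derivative_bounded_linear[OF FD] .
    have "((\<lambda>s. F (s, x)) has_derivative (\<lambda>h. frechet_derivative F (at (t, x)) (h, 0))) (at t within {0..1})"
      by (rule has_derivative_compose[where f = "\<lambda>s. (s, x)" and f' = "\<lambda>h. (h, 0)" and g = F, OF _ FD])
         (auto intro!: derivative_eq_intros)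
    moreover have "frechet_derivative F (at (t, x)) (h, 0) = h *\<^sub>R V t x" for h
      using D.scaleR[of h "(1, 0)"] by (simp add: V_def)
    ultimately have "((\<lambda>s. F (s, x)) has_vector_derivative V t x) (at t within {0..1})"
      by (simp add: has_vector_derivative_def)
    then show ?thesis
      by (rule has_vector_derivative_transform[OF tx(1), rotated]) (use F tx in auto)
  qed
  show thesis
    by (rule that[OF c d])
qed

lemma area_diff_norm_1: "g \<in> area_diff \<Longrightarrow> norm x = 1 \<Longrightarrow> g x = x"
  unfolding area_diff_def by (auto simp: mem_disc)

definition ordered_pairs :: "((real^2) \<times> (real^2)) set" where
  "ordered_pairs = {(x, y). x \<in> disc \<and> y \<in> disc \<and> x \<noteq> y \<and> norm x \<le> norm y}"

text \<open>The principal argument of 1 - w/z where its real part is positive. The form with arctan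
  is measurable and bounded by pi/2 for all arguments, also where a denominator is 0.\<close>

definition arg_correction :: "complex \<Rightarrow> complex \<Rightarrow> real" where
  "arg_correction w z = arctan (Im (1 - w / z) / Re (1 - w / z))"

lemma arg_correction_eq: "0 < Re (1 - w / z) \<Longrightarrow> arg_correction w z = Im (Ln (1 - w / z))"
proof -
  assume re: "0 < Re (1 - w / z)"
  then have "1 - w / z \<noteq> 0" by auto
  show ?thesis
    unfolding arg_correction_def arg_conv_arctan[OF re, symmetric] by (rule Arg_eq_Im_Ln[OF \<open>1 - w / z \<noteq> 0\<close>])
qed

lemma abs_arg_correction_less: "\<bar>arg_correction w z\<bar> < pi / 2"
  unfolding arg_correction_def abs_less_iff by (simp only: arctan_ubound minus_less_iff arctan_lbound simp_thms)

text \<open>Here \<theta> is a function of the norm itself, whereas \<open>twist_map\<close> uses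
  the squared norm. Condition \<open>\<theta>1\<close> removes the rotation term at pairs of
  boundary points.\<close>

locale twist_isotopy =
  fixes \<gamma> :: "real \<Rightarrow> real^2 \<Rightarrow> real^2" and g :: "real^2 \<Rightarrow> real^2" and \<theta> :: "real \<Rightarrow> real"
    and V :: "real \<Rightarrow> real^2 \<Rightarrow> real^2"
  assumes isotopy: "smooth_isotopy \<gamma> id g"
    and V_cont: "continuous_on ({0..1::real} \<times> disc) (\<lambda>(t, x). V t x)"
    and V: "\<And>t x. t \<in> {0..1} \<Longrightarrow> x \<in> disc \<Longrightarrow> ((\<lambda>s. \<gamma> s x) has_vector_derivative V t x) (at t within {0..1})"
    and \<theta>_cont: "continuous_on {0..1} \<theta>" and \<theta>1: "\<theta> 1 = 0"
    and twist: "\<And>x. x \<in> disc \<Longrightarrow> cpx (g x) = cis (\<theta> (norm x)) * cpx x"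
begin

lemma \<gamma>_area_diff: "t \<in> {0..1} \<Longrightarrow> \<gamma> t \<in> area_diff"
  and \<gamma>_0: "\<gamma> 0 = id" and \<gamma>_1: "\<gamma> 1 = g"
  using isotopy by (auto simp: smooth_isotopy_def)

lemma g_area_diff: "g \<in> area_diff"
  using \<gamma>_area_diff[of 1] \<gamma>_1 by simp

lemma \<gamma>_cont: "continuous_on ({0..1::real} \<times> disc) (\<lambda>(t, x). \<gamma> t x)"
  using isotopy smooth_on_continuous_on unfolding smooth_isotopy_def by blast

lemma \<gamma>_permutes: "t \<in> {0..1} \<Longrightarrow> \<gamma> t permutes disc"
  using \<gamma>_area_diff by (auto simp: area_diff_def)

lemma \<gamma>_inj: "t \<in> {0..1} \<Longrightarrow> \<gamma> t x = \<gamma> t y \<longleftrightarrow> x = y"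
  using permutes_inj[OF \<gamma>_permutes] by (auto simp: inj_eq)

lemma \<gamma>_disc: "t \<in> {0..1} \<Longrightarrow> \<gamma> t x \<in> disc \<longleftrightarrow> x \<in> disc"
  using permutes_in_image[OF \<gamma>_permutes] .

text \<open>The change of a continuous logarithm of the difference of the two moving points; its
  imaginary part is the angle through which the difference turns.\<close>

definition winding :: "real^2 \<Rightarrow> real^2 \<Rightarrow> complex" where
  "winding x y = integral (cbox 0 (1::real)) (\<lambda>t. cpx (V t x - V t y) / cpx (\<gamma> t x - \<gamma> t y))"

text \<open>A logarithm of (g x - g y)/(x - y), split according to x - y = - y (1 - x/y) and the
  same identity for the images. The quotient of g y and y contributes the twist angle, the other
  factors principal logarithms.\<close>

definition formula :: "real^2 \<Rightarrow> real^2 \<Rightarrow> complex" where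
  "formula x y = \<i> * \<theta> (norm y) + Ln (1 - cpx (g x) / cpx (g y)) - Ln (1 - cpx x / cpx y)"

lemma norm_g: "x \<in> disc \<Longrightarrow> norm (g x) = norm x"
  using arg_cong[OF twist, of x norm] by (simp add: norm_mult)

lemma g_pairs: "(x, y) \<in> ordered_pairs \<Longrightarrow> (g x, g y) \<in> ordered_pairs"
  using \<gamma>_inj[of 1 x y] \<gamma>_disc[of 1] norm_g by (auto simp: ordered_pairs_def \<gamma>_1)

lemma pairs_quotient:
  assumes "(x, y) \<in> ordered_pairs"
  shows "cpx y \<noteq> 0" "0 < Re (1 - cpx x / cpx y)" "1 - cpx x / cpx y \<noteq> 0"
proof -
  have xy: "x \<noteq> y" "norm x \<le> norm y" using assms by (auto simp: ordered_pairs_def)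
  then have y: "norm y > 0" by (metis norm_le_zero_iff not_le order_trans norm_ge_zero zero_less_norm_iff)
  then show c: "cpx y \<noteq> 0" by (metis norm_cpx norm_zero less_irrefl)
  have "norm (cpx x / cpx y) \<le> 1" using xy y by (simp add: norm_divide)
  moreover have "cpx x / cpx y \<noteq> 1" using xy c by (simp add: cpx_eq_iff)
  ultimately show "0 < Re (1 - cpx x / cpx y)" by (rule Re_one_minus_pos)
  then show "1 - cpx x / cpx y \<noteq> 0" by auto
qed

lemma integrand_cont:
  "continuous_on (ordered_pairs \<times> cbox 0 (1::real)) (\<lambda>(q, t). cpx (V t (fst q) - V t (snd q)) / cpx (\<gamma> t (fst q) - \<gamma> t (snd q)))"
proof -
  have c: "continuous_on (ordered_pairs \<times> cbox 0 (1::real)) (\<lambda>p. F (snd p) (f (fst p)))"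
    if "continuous_on ({0..1::real} \<times> disc) (\<lambda>(t, x). F t x)" "f = fst \<or> f = snd" for F :: "real \<Rightarrow> real^2 \<Rightarrow> real^2" and f
  proof -
    have "continuous_on (ordered_pairs \<times> cbox 0 (1::real)) (\<lambda>p. (snd p, f (fst p)))"
      using that(2) by (auto intro!: continuous_intros)
    moreover have "(\<lambda>p. (snd p, f (fst p))) ` (ordered_pairs \<times> cbox 0 (1::real)) \<subseteq> {0..1::real} \<times> disc"
      using that(2) by (auto simp: ordered_pairs_def box_real)
    ultimately show ?thesis using continuous_on_compose2[OF that(1)] by fastforce
  qed
  have "cpx (\<gamma> (snd p) (fst (fst p)) - \<gamma> (snd p) (snd (fst p))) \<noteq> 0" if "p \<in> ordered_pairs \<times> cbox 0 (1::real)" for p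
    using that \<gamma>_inj[of "snd p"] by (auto simp: ordered_pairs_def cpx_diff cpx_eq_iff)
  then show ?thesis
    unfolding case_prod_beta' by (intro continuous_intros c V_cont \<gamma>_cont) auto
qed

lemma winding_cont: "continuous_on ordered_pairs (\<lambda>q. winding (fst q) (snd q))"
  unfolding winding_def by (rule integral_continuous_on_param[OF integrand_cont])

lemma formula_cont: "continuous_on ordered_pairs (\<lambda>q. formula (fst q) (snd q))"
proof -
  have gc: "continuous_on disc g"
    using g_area_diff smooth_on_continuous_on by (auto simp: area_diff_def)
  have gc1: "continuous_on ordered_pairs (\<lambda>q. g (fst q))" "continuous_on ordered_pairs (\<lambda>q. g (snd q))"
    by (rule continuous_on_compose2[OF gc]; auto simp: ordered_pairs_def intro!: continuous_intros)+
  have tc: "continuous_on ordered_pairs (\<lambda>q. \<theta> (norm (snd q)))"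
    by (rule continuous_on_compose2[OF \<theta>_cont]) (auto simp: ordered_pairs_def mem_disc intro!: continuous_intros)
  have q: "cpx (snd q) \<noteq> 0" "1 - cpx (fst q) / cpx (snd q) \<notin> \<real>\<^sub>\<le>\<^sub>0"
    "cpx (g (snd q)) \<noteq> 0" "1 - cpx (g (fst q)) / cpx (g (snd q)) \<notin> \<real>\<^sub>\<le>\<^sub>0" if "q \<in> ordered_pairs" for q
    using pairs_quotient[of "fst q" "snd q"] pairs_quotient[OF g_pairs[of "fst q" "snd q"]] that
    by (auto simp: complex_nonpos_Reals_iff)
  show ?thesis
    unfolding formula_def by (intro continuous_intros gc1 tc) (use q in auto)
qed

lemma exp_winding:
  assumes "(x, y) \<in> ordered_pairs"
  shows "exp (winding x y) = exp (formula x y)"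
proof -
  have xy: "x \<in> disc" "y \<in> disc" "x \<noteq> y" using assms by (auto simp: ordered_pairs_def)
  note q = pairs_quotient[OF assms] pairs_quotient[OF g_pairs[OF assms]]
  let ?z = "\<lambda>t. cpx (\<gamma> t x - \<gamma> t y)"
  have "continuous_on {0..1} (\<lambda>t. cpx (V t x - V t y))"
  proof -
    have "continuous_on {0..1} (\<lambda>t. V t u)" if "u \<in> disc" for u
      using continuous_on_slices(2)[OF V_cont that] .
    then show ?thesis using xy by (intro continuous_intros)
  qed
  then have "?z 1 = ?z 0 * exp (integral {0..1} (\<lambda>t. cpx (V t x - V t y) / ?z t))"
    using xy \<gamma>_inj
    by (intro exp_integral_log_derivative bounded_linear.has_vector_derivative[OF bounded_linear_cpx]
        has_vector_derivative_diff V) (auto simp: cpx_diff cpx_eq_iff)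
  then have e1: "cpx (g x) - cpx (g y) = (cpx x - cpx y) * exp (winding x y)"
    by (simp add: winding_def \<gamma>_0 \<gamma>_1 cpx_diff)
  have "exp (formula x y) = cis (\<theta> (norm y)) * (1 - cpx (g x) / cpx (g y)) / (1 - cpx x / cpx y)"
    using q unfolding formula_def by (simp add: exp_diff exp_add cis_conv_exp)
  also have "\<dots> = cis (\<theta> (norm y)) * cpx y * (1 - cpx (g x) / cpx (g y)) / (cpx y * (1 - cpx x / cpx y))"
    using q by simp
  also have "\<dots> = cpx (g y) * (1 - cpx (g x) / cpx (g y)) / (cpx y * (1 - cpx x / cpx y))"
    by (simp add: twist[OF xy(2)])
  also have "\<dots> = (cpx (g y) - cpx (g x)) / (cpx y - cpx x)"
    using q by (simp add: right_diff_distrib)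
  also have "\<dots> = (cpx (g x) - cpx (g y)) / (cpx x - cpx y)"
    by (metis minus_diff_eq minus_divide_divide)
  finally show ?thesis using e1 xy by (simp add: cpx_eq_iff)
qed

text \<open>Equal exponentials put the difference into the integer multiples of 2 pi i, and a
  continuous function with values in a discrete set is constant on an interval.\<close>

lemma winding_formula_along_path:
  fixes P :: "real \<Rightarrow> (real^2) \<times> (real^2)"
  assumes "continuous_on {0..1} P" "P ` {0..1} \<subseteq> ordered_pairs"
  shows "winding (fst (P 0)) (snd (P 0)) - formula (fst (P 0)) (snd (P 0))
       = winding (fst (P 1)) (snd (P 1)) - formula (fst (P 1)) (snd (P 1))"
proof -
  define d where "d s = winding (fst (P s)) (snd (P s)) - formula (fst (P s)) (snd (P s))" for s :: real
  have "continuous_on {0..1} (\<lambda>s. winding (fst (P s)) (snd (P s)))" "continuous_on {0..1} (\<lambda>s. formula (fst (P s)) (snd (P s)))"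
    using continuous_on_compose2[OF winding_cont assms] continuous_on_compose2[OF formula_cont assms] by auto
  then have dc: "continuous_on {0..1} d" unfolding d_def by (intro continuous_intros)
  have dn: "\<exists>n::int. d s = of_int n * (2 * pi * \<i>)" if "s \<in> {0..1}" for s
  proof -
    have "(fst (P s), snd (P s)) \<in> ordered_pairs" using assms(2) that by auto
    from exp_winding[OF this] obtain n :: int
      where "winding (fst (P s)) (snd (P s)) = formula (fst (P s)) (snd (P s)) + of_int (2 * n) * pi * \<i>"
      unfolding exp_eq by blast
    then show ?thesis by (intro exI[of _ n]) (simp add: d_def)
  qed
  have "\<exists>e>0. \<forall>s'. s' \<in> {0..1} \<and> d s' \<noteq> d s \<longrightarrow> e \<le> norm (d s' - d s)" if s: "s \<in> {0..1}" for s
  proof (intro exI[of _ "2 * pi"] conjI allI impI)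
    fix s' assume s': "s' \<in> {0..1} \<and> d s' \<noteq> d s"
    obtain n m :: int where nm: "d s = of_int n * (2 * pi * \<i>)" "d s' = of_int m * (2 * pi * \<i>)" using dn s s' by meson
    then have "m \<noteq> n" using s' by auto
    then have "1 \<le> \<bar>real_of_int (m - n)\<bar>" by linarith
    moreover have "d s' - d s = of_real (of_int (m - n) * (2 * pi)) * \<i>" by (simp add: nm algebra_simps)
    then have "norm (d s' - d s) = \<bar>real_of_int (m - n)\<bar> * (2 * pi)" by (simp only: norm_mult norm_of_real abs_mult) simp
    ultimately show "2 * pi \<le> norm (d s' - d s)" using mult_right_mono[of 1 _ "2 * pi"] by simp
  qed simp
  then have "d constant_on {0..1}" using continuous_discrete_range_constant[of "{0..1}" d, OF _ dc] by auto
  then have "d 0 = d 1" unfolding constant_on_def by force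
  then show ?thesis by (simp add: d_def)
qed

lemma winding_boundary:
  assumes "norm x = 1" "norm y = 1" shows "winding x y = 0"
proof -
  have "V t u = 0" if "t \<in> {0..1}" "norm u = 1" for t u
  proof -
    have u: "u \<in> disc" using that by (simp add: mem_disc)
    have "((\<lambda>s. u) has_vector_derivative V t u) (at t within {0..1})"
      by (rule has_vector_derivative_transform[OF that(1) _ V[OF that(1) u]])
         (use area_diff_norm_1[OF \<gamma>_area_diff] that in auto)
    moreover have "((\<lambda>s. u) has_vector_derivative 0) (at t within {0..1})" by simp
    ultimately show ?thesis
      using vector_derivative_unique_within_closed_interval[of 0 1 t "\<lambda>s. u"] that by simp
  qed
  then have "cpx (V t x - V t y) / cpx (\<gamma> t x - \<gamma> t y) = 0" if "t \<in> cbox 0 1" for t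
    using that assms by simp
  then have "winding x y = integral (cbox 0 (1::real)) (\<lambda>t. 0)"
    unfolding winding_def by (rule Henstock_Kurzweil_Integration.integral_cong)
  then show ?thesis by simp
qed

text \<open>Both sides are logarithms of the same number, so their difference is constant along paths of
  pairs; such a path leads to a pair of boundary points, where both sides vanish.\<close>

lemma winding_eq_formula:
  assumes "(x, y) \<in> ordered_pairs"
  shows "winding x y = formula x y"
proof -
  have xy: "x \<in> disc" "y \<in> disc" "x \<noteq> y" "norm x \<le> norm y" "y \<noteq> 0"
    using assms pairs_quotient(1)[OF assms] by (auto simp: ordered_pairs_def)
  \<comment> \<open>The path has three pieces: x shrinks to 0, then y moves out radially to u, then
    0 moves to -u. The two points never meet and never reverse their order by norm.\<close>
  define u where "u = y /\<^sub>R norm y"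
  have u: "norm u = 1" "u \<in> disc" "u \<noteq> 0" using xy by (auto simp: u_def mem_disc)
  let ?d = "\<lambda>x y. winding x y - formula x y"
  have "?d x y = ?d 0 y"
  proof -
    let ?P = "\<lambda>s::real. ((1 - s) *\<^sub>R x, y)"
    have "((1 - s) *\<^sub>R x, y) \<in> ordered_pairs" if s: "s \<in> {0..1}" for s
    proof -
      have n: "norm ((1 - s) *\<^sub>R x) \<le> norm x" using s by (simp add: mult_left_le_one_le)
      have "(1 - s) *\<^sub>R x \<noteq> y"
      proof
        assume e: "(1 - s) *\<^sub>R x = y"
        show False
        proof (cases "s = 0")
          case False
          then have "(1 - s) * norm x < norm x \<or> norm x = 0" using s by (auto simp: mult_less_cancel_right1)
          moreover have "norm y = (1 - s) * norm x" using e s by auto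
          ultimately show False using xy by auto
        qed (use e xy in auto)
      qed
      then show ?thesis using n xy by (auto simp: ordered_pairs_def mem_disc)
    qed
    then have "?P ` {0..1} \<subseteq> ordered_pairs" by auto
    moreover have "continuous_on {0..1} ?P" by (intro continuous_intros)
    ultimately show ?thesis using winding_formula_along_path[of ?P] by simp
  qed
  also have "\<dots> = ?d 0 u"
  proof -
    let ?P = "\<lambda>s::real. (0, ((1 - s) + s / norm y) *\<^sub>R y)"
    have "?P s \<in> ordered_pairs" if s: "s \<in> {0..1}" for s
    proof -
      have y1: "0 < norm y" "norm y \<le> 1" using xy by (auto simp: mem_disc)
      have pos: "0 < (1 - s) + s / norm y"
      proof (cases "s = 0")
        case False
        then have "0 < s / norm y" using s y1 by auto
        then show ?thesis using s by auto
      qed simp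
      have "norm (((1 - s) + s / norm y) *\<^sub>R y) = ((1 - s) + s / norm y) * norm y" using pos by simp
      also have "\<dots> = (1 - s) * norm y + s" using y1 by (simp add: field_simps)
      also have "\<dots> \<le> (1 - s) * 1 + s" using s y1 by (intro add_right_mono mult_left_mono) auto
      finally show ?thesis using pos xy by (auto simp: ordered_pairs_def mem_disc)
    qed
    then have "?P ` {0..1} \<subseteq> ordered_pairs" by auto
    moreover have "continuous_on {0..1} ?P" using xy by (intro continuous_intros) auto
    ultimately show ?thesis using winding_formula_along_path[of ?P] by (simp add: u_def divide_inverse)
  qed
  also have "\<dots> = ?d (- u) u"
  proof -
    let ?P = "\<lambda>s::real. ((- s) *\<^sub>R u, u)"
    have "?P s \<in> ordered_pairs" if s: "s \<in> {0..1}" for s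
    proof -
      have "(- s) *\<^sub>R u \<noteq> u"
      proof
        assume "(- s) *\<^sub>R u = u"
        then have "u + s *\<^sub>R u = 0" by (metis add.left_inverse add.commute add.inverse_inverse scaleR_minus_left)
        then have "(1 + s) *\<^sub>R u = 0" by (simp add: scaleR_left_distrib)
        then show False using u s by auto
      qed
      then show ?thesis using s u by (auto simp: ordered_pairs_def mem_disc)
    qed
    then have "?P ` {0..1} \<subseteq> ordered_pairs" by auto
    moreover have "continuous_on {0..1} ?P" by (intro continuous_intros)
    ultimately show ?thesis using winding_formula_along_path[of ?P] by simp
  qed
  also have "\<dots> = 0"
    using winding_boundary[of "- u" u] u area_diff_norm_1[OF g_area_diff]
    by (simp add: formula_def \<theta>1)
  finally show ?thesis by simp
qed

text \<open>The left-hand number is the imaginary part of the winding, at most the integral of the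
  absolute value of its integrand. In \<open>ennreal\<close> a negative left-hand side counts as 0,
  and the right-hand side is in the form needed for Tonelli.\<close>

lemma angle_bound:
  assumes "(x, y) \<in> ordered_pairs"
  shows "ennreal (\<theta> (norm y) + arg_correction (cpx (g x)) (cpx (g y)) - arg_correction (cpx x) (cpx y))
    \<le> (\<integral>\<^sup>+t\<in>{0..1}. ennreal ((norm (V t x) + norm (V t y)) / norm (\<gamma> t x - \<gamma> t y)) \<partial>lborel)"
proof -
  let ?f = "\<lambda>t. cpx (V t x - V t y) / cpx (\<gamma> t x - \<gamma> t y)"
  have cf: "continuous_on {0..1} ?f"
  proof -
    have "continuous_on {0..1} (\<lambda>t. ((x, y), t))" "(\<lambda>t. ((x, y), t)) ` {0..1::real} \<subseteq> ordered_pairs \<times> cbox 0 (1::real)"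
      using assms by (auto intro!: continuous_intros simp: box_real)
    from continuous_on_compose2[OF integrand_cont this] show ?thesis by simp
  qed
  note ci = continuous_on_compact_absolutely_integrable[OF compact_Icc cf]
  have "\<theta> (norm y) + arg_correction (cpx (g x)) (cpx (g y)) - arg_correction (cpx x) (cpx y) = Im (formula x y)"
    unfolding arg_correction_eq[OF pairs_quotient(2)[OF assms]]
      arg_correction_eq[OF pairs_quotient(2)[OF g_pairs[OF assms]]]
    by (simp add: formula_def)
  also have "\<dots> \<le> norm (winding x y)" unfolding winding_eq_formula[OF assms] using abs_Im_le_cmod abs_ge_self order_trans by metis
  also have "winding x y = (LBINT t:{0..1}. ?f t)"
    unfolding winding_def using set_borel_integral_eq_integral(2)[OF ci(3)] by simp
  finally have "ennreal (\<theta> (norm y) + arg_correction (cpx (g x)) (cpx (g y)) - arg_correction (cpx x) (cpx y))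
    \<le> ennreal (norm (LBINT t:{0..1}. ?f t))" by (rule ennreal_leI)
  also have "\<dots> \<le> (\<integral>\<^sup>+t. ennreal (norm (indicator {0..1} t *\<^sub>R ?f t)) \<partial>lborel)"
    unfolding set_lebesgue_integral_def
    by (rule integral_norm_bound_ennreal) (use ci(3) in \<open>simp add: set_integrable_def\<close>)
  also have "\<dots> \<le> (\<integral>\<^sup>+t\<in>{0..1}. ennreal ((norm (V t x) + norm (V t y)) / norm (\<gamma> t x - \<gamma> t y)) \<partial>lborel)"
  proof (rule nn_integral_mono)
    fix t
    have "norm (?f t) \<le> (norm (V t x) + norm (V t y)) / norm (\<gamma> t x - \<gamma> t y)"
      by (simp add: norm_divide divide_right_mono norm_triangle_ineq4)
    then show "ennreal (norm (indicator {0..1} t *\<^sub>R ?f t))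
      \<le> ennreal ((norm (V t x) + norm (V t y)) / norm (\<gamma> t x - \<gamma> t y)) * indicator {0..1} t"
      by (auto simp: indicator_def intro: ennreal_leI)
  qed
  finally show ?thesis .
qed

end

section \<open>Integration of the angle bound over all pairs of points\<close>

lemma set_integral_const_disc:
  "set_integrable lborel disc (\<lambda>x. c :: real)" "(LBINT x:disc. c) = c * pi"
proof -
  show "set_integrable lborel disc (\<lambda>x. c :: real)"
    by (intro continuous_on_compact_absolutely_integrable) auto
  show "(LBINT x:disc. c) = c * pi"
    using content_cball[of 1 "0::real^2"]
    by (simp add: set_lebesgue_integral_def disc_def unit_ball_vol_2 mult.commute)
qed

lemma disc_measurable [measurable]: "disc \<in> sets borel"
  by simp

context twist_isotopy begin

lemma g_measurable: "g \<in> borel_measurable borel"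
proof -
  have gc: "continuous_on disc g"
    using g_area_diff smooth_on_continuous_on by (auto simp: area_diff_def)
  have gp: "g permutes disc" using \<gamma>_permutes[of 1] \<gamma>_1 by simp
  have "(\<lambda>x. indicator disc x *\<^sub>R g x + indicator (- disc) x *\<^sub>R x) \<in> borel_measurable borel"
    by (intro borel_measurable_add borel_measurable_continuous_on_indicator gc borel_measurable_scaleR
        borel_measurable_indicator) auto
  moreover have "(\<lambda>x. indicator disc x *\<^sub>R g x + indicator (- disc) x *\<^sub>R x) = g"
    using permutes_not_in[OF gp] by (auto simp: indicator_def fun_eq_iff)
  ultimately show ?thesis by simp
qed

text \<open>The region |x| < |y| is invariant when \<open>g\<close> acts on both points, so
  integrals over it do not distinguish a pair from its image.\<close>

definition correction :: "real^2 \<Rightarrow> real^2 \<Rightarrow> ennreal" where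
  "correction x y = ennreal (pi + arg_correction (cpx x) (cpx y)) * indicator {(x, y). norm x < norm y} (x, y)"

lemma cpx_measurable [measurable]: "cpx \<in> borel_measurable borel"
  by (intro borel_measurable_continuous_onI continuous_intros)

lemma correction_measurable: "(\<lambda>(x, y). correction x y) \<in> borel_measurable (borel \<Otimes>\<^sub>M borel)"
  unfolding correction_def arg_correction_def by measurable

lemma correction_le: "correction x y \<le> ennreal (2 * pi)"
proof -
  have "pi + arg_correction (cpx x) (cpx y) \<le> 2 * pi"
    using abs_arg_correction_less[of "cpx x" "cpx y"] pi_gt_zero by linarith
  then show ?thesis by (auto simp: correction_def indicator_def intro: ennreal_leI)
qed

definition correction_mass :: "real^2 \<Rightarrow> ennreal" where
  "correction_mass y = (\<integral>\<^sup>+x\<in>disc. correction x y \<partial>lborel)"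

lemma correction_mass_measurable: "correction_mass \<in> borel_measurable borel"
proof -
  have [measurable]: "(\<lambda>p. correction (snd p) (fst p)) \<in> borel_measurable (borel \<Otimes>\<^sub>M borel)"
    using measurable_compose[OF measurable_pair_swap' correction_measurable] by (simp add: case_prod_beta')
  have "(\<lambda>p. correction (snd p) (fst p) * indicator disc (snd p)) \<in> borel_measurable (borel \<Otimes>\<^sub>M borel)"
    by measurable
  then have "(\<lambda>(y, x). correction x y * indicator disc x) \<in> borel_measurable (borel \<Otimes>\<^sub>M lborel)"
    by (simp add: case_prod_beta')
  then show ?thesis unfolding correction_mass_def
    by (rule lborel.borel_measurable_nn_integral)
qed

definition displacement :: "real \<Rightarrow> ennreal" where
  "displacement t = (\<integral>\<^sup>+x\<in>disc. ennreal (norm (V t x)) \<partial>lborel)"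

text \<open>The indicators extend the integrand by 0 in the time and both points, which makes it
  jointly measurable on the full product, so that Tonelli applies with \<open>lborel\<close> in
  every variable.\<close>

definition pair_cost :: "real \<Rightarrow> real^2 \<Rightarrow> real^2 \<Rightarrow> ennreal" where
  "pair_cost t x y = ennreal ((norm (V t x) + norm (V t y)) / norm (\<gamma> t x - \<gamma> t y))
     * indicator ({0..1} \<times> disc) (t, x) * indicator ({0..1} \<times> disc) (t, y)"

lemma pair_cost_measurable:
  "(\<lambda>(t, x, y). pair_cost t x y) \<in> borel_measurable (borel \<Otimes>\<^sub>M borel \<Otimes>\<^sub>M borel)"
proof -
  let ?D = "{0..1::real} \<times> disc"
  have D: "?D \<in> sets borel" by (intro borel_closed closed_Times) auto
  have ext: "(\<lambda>p. indicator ?D p *\<^sub>R F (fst p) (snd p)) \<in> borel_measurable (borel \<Otimes>\<^sub>M borel)"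
    if "continuous_on ?D (\<lambda>(t, x). F t x)" for F :: "real \<Rightarrow> real^2 \<Rightarrow> real^2"
    using borel_measurable_continuous_on_indicator[OF D that] by (simp add: borel_prod case_prod_beta')
  define v where "v p = indicator ?D p *\<^sub>R V (fst p) (snd p)" for p
  define c where "c p = indicator ?D p *\<^sub>R \<gamma> (fst p) (snd p)" for p
  have [measurable]: "v \<in> borel_measurable (borel \<Otimes>\<^sub>M borel)" "c \<in> borel_measurable (borel \<Otimes>\<^sub>M borel)"
    unfolding v_def[abs_def] c_def[abs_def] using ext[OF V_cont] ext[OF \<gamma>_cont] by auto
  have [measurable]: "?D \<in> sets (borel \<Otimes>\<^sub>M borel)" using D by (simp add: borel_prod)
  have "(\<lambda>(t, x, y). ennreal ((norm (v (t, x)) + norm (v (t, y))) / norm (c (t, x) - c (t, y)))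
     * indicator ?D (t, x) * indicator ?D (t, y)) \<in> borel_measurable (borel \<Otimes>\<^sub>M borel \<Otimes>\<^sub>M borel)"
    by measurable
  also have "(\<lambda>(t, x, y). ennreal ((norm (v (t, x)) + norm (v (t, y))) / norm (c (t, x) - c (t, y)))
     * indicator ?D (t, x) * indicator ?D (t, y)) = (\<lambda>(t, x, y). pair_cost t x y)"
    by (auto simp: fun_eq_iff pair_cost_def v_def c_def indicator_def)
  finally show ?thesis .
qed

lemma V_measurable: assumes "t \<in> {0..1}"
  shows "(\<lambda>x. ennreal (norm (V t x)) * indicator disc x) \<in> borel_measurable borel"
proof -
  from borel_measurable_continuous_on_indicator[OF _ continuous_on_slices(1)[OF V_cont assms]]
  have "(\<lambda>x. ennreal (norm (indicator disc x *\<^sub>R V t x))) \<in> borel_measurable borel" by measurable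
  also have "(\<lambda>x. ennreal (norm (indicator disc x *\<^sub>R V t x))) = (\<lambda>x. ennreal (norm (V t x)) * indicator disc x)"
    by (auto simp: indicator_def fun_eq_iff)
  finally show ?thesis .
qed

text \<open>Since \<open>\<gamma> t\<close> preserves area, its image of y can serve as the variable
  of integration. What remains is the singular integral around one point, bounded independently of
  the isotopy.\<close>

lemma nn_integral_inverse_dist_flow:
  assumes t: "t \<in> {0..1}" and x: "x \<in> disc"
  shows "(\<integral>\<^sup>+y\<in>disc. ennreal (1 / norm (\<gamma> t x - \<gamma> t y)) \<partial>lborel) \<le> ennreal (8 * pi)"
proof -
  have "(\<integral>\<^sup>+y\<in>disc. ennreal (1 / norm (\<gamma> t x - \<gamma> t y)) \<partial>lborel)
      = (\<integral>\<^sup>+y\<in>disc. ennreal (1 / norm (\<gamma> t y - \<gamma> t x)) \<partial>lborel)"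
    by (simp add: norm_minus_commute)
  also have "\<dots> = (\<integral>\<^sup>+y\<in>disc. ennreal (1 / norm (y - \<gamma> t x)) \<partial>lborel)"
    by (rule area_diff_nn_integral[OF \<gamma>_area_diff[OF t], of "\<lambda>y. ennreal (1 / norm (y - \<gamma> t x))"]) measurable
  also have "\<dots> \<le> ennreal (8 * pi)"
    by (rule nn_integral_inverse_dist_le) (use \<gamma>_disc[OF t] x in simp)
  finally show ?thesis .
qed

text \<open>The kernel 1/|\<gamma> t x - \<gamma> t y| is symmetric, so the two speeds contribute
  equally. For each, integrating the kernel over the other point gives at most 8 pi.\<close>

lemma pair_cost_integral:
  assumes t: "t \<in> {0..1}"
  shows "(\<integral>\<^sup>+x. \<integral>\<^sup>+y. pair_cost t x y \<partial>lborel \<partial>lborel) \<le> ennreal (16 * pi) * displacement t"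
proof -
  let ?v = "\<lambda>x. ennreal (norm (V t x)) * indicator disc x"
  let ?d = "\<lambda>x y. ennreal (1 / norm (\<gamma> t x - \<gamma> t y)) * indicator disc x * indicator disc y"
  have vm: "?v \<in> borel_measurable borel" using V_measurable[OF t] .
  have gcont: "continuous_on disc (\<gamma> t)"
    using \<gamma>_area_diff[OF t] smooth_on_continuous_on by (auto simp: area_diff_def)
  define c where "c x = indicator disc x *\<^sub>R \<gamma> t x" for x
  have cm [measurable]: "c \<in> borel_measurable borel"
    unfolding c_def[abs_def] by (intro borel_measurable_continuous_on_indicator gcont) auto
  have "(\<lambda>(x, y). ennreal (1 / norm (c x - c y)) * indicator disc x * indicator disc y) \<in> borel_measurable (borel \<Otimes>\<^sub>M borel)"
    by measurable
  also have "(\<lambda>(x, y). ennreal (1 / norm (c x - c y)) * indicator disc x * indicator disc y) = (\<lambda>(x, y). ?d x y)"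
    by (auto simp: c_def indicator_def fun_eq_iff)
  finally have dm: "(\<lambda>(x, y). ?d x y) \<in> borel_measurable (borel \<Otimes>\<^sub>M borel)" .
  have split: "pair_cost t x y = ?v x * ?d x y + ?v y * ?d x y" for x y
    using t by (auto simp: pair_cost_def indicator_def add_divide_distrib ennreal_plus[symmetric]
        ennreal_mult[symmetric] simp del: ennreal_plus)
  have vm1: "(\<lambda>(x, y). ?v x * ?d x y) \<in> borel_measurable (borel \<Otimes>\<^sub>M borel)"
    "(\<lambda>(x, y). ?v y * ?d x y) \<in> borel_measurable (borel \<Otimes>\<^sub>M borel)"
    using borel_measurable_times_ennreal[OF measurable_compose[OF measurable_fst vm] dm[unfolded case_prod_beta']]
      borel_measurable_times_ennreal[OF measurable_compose[OF measurable_snd vm] dm[unfolded case_prod_beta']]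
    unfolding case_prod_beta' by auto
  have dy: "(\<integral>\<^sup>+y. ?d x y \<partial>lborel) \<le> ennreal (8 * pi)" for x
  proof (cases "x \<in> disc")
    case True
    then show ?thesis using nn_integral_inverse_dist_flow[OF t True] by simp
  qed auto
  have dsym: "?d x y = ?d y x" for x y by (simp add: norm_minus_commute mult_ac)
  have one: "(\<integral>\<^sup>+x. \<integral>\<^sup>+y. ?v x * ?d x y \<partial>lborel \<partial>lborel) \<le> ennreal (8 * pi) * displacement t"
  proof -
    have m: "?d x \<in> borel_measurable lborel" for x
      using measurable_compose[OF measurable_Pair1' dm, of x] by simp
    have "(\<integral>\<^sup>+x. \<integral>\<^sup>+y. ?v x * ?d x y \<partial>lborel \<partial>lborel) = (\<integral>\<^sup>+x. ?v x * (\<integral>\<^sup>+y. ?d x y \<partial>lborel) \<partial>lborel)"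
      by (intro nn_integral_cong nn_integral_cmult m)
    also have "\<dots> \<le> (\<integral>\<^sup>+x. ?v x * ennreal (8 * pi) \<partial>lborel)"
      by (intro nn_integral_mono mult_left_mono dy) auto
    also have "\<dots> = ennreal (8 * pi) * displacement t"
      unfolding displacement_def by (subst nn_integral_multc) (use vm in \<open>auto simp: mult.commute\<close>)
    finally show ?thesis .
  qed
  have two: "(\<integral>\<^sup>+x. \<integral>\<^sup>+y. ?v y * ?d x y \<partial>lborel \<partial>lborel) = (\<integral>\<^sup>+x. \<integral>\<^sup>+y. ?v x * ?d x y \<partial>lborel \<partial>lborel)"
  proof -
    have "(\<integral>\<^sup>+x. \<integral>\<^sup>+y. ?v y * ?d x y \<partial>lborel \<partial>lborel) = (\<integral>\<^sup>+y. \<integral>\<^sup>+x. ?v y * ?d x y \<partial>lborel \<partial>lborel)"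
      by (rule lborel_pair.Fubini'[symmetric]) (use vm1(2) in simp)
    also have "\<dots> = (\<integral>\<^sup>+y. \<integral>\<^sup>+x. ?v y * ?d y x \<partial>lborel \<partial>lborel)" by (subst dsym) simp
    finally show ?thesis .
  qed
  have "(\<integral>\<^sup>+x. \<integral>\<^sup>+y. pair_cost t x y \<partial>lborel \<partial>lborel)
     = (\<integral>\<^sup>+x. (\<integral>\<^sup>+y. ?v x * ?d x y \<partial>lborel) + (\<integral>\<^sup>+y. ?v y * ?d x y \<partial>lborel) \<partial>lborel)"
    unfolding split
    by (intro nn_integral_cong nn_integral_add)
       (use measurable_compose[OF measurable_Pair1' vm1(1)] measurable_compose[OF measurable_Pair1' vm1(2)] in simp_all)
  also have "\<dots> = (\<integral>\<^sup>+x. \<integral>\<^sup>+y. ?v x * ?d x y \<partial>lborel \<partial>lborel) + (\<integral>\<^sup>+x. \<integral>\<^sup>+y. ?v y * ?d x y \<partial>lborel \<partial>lborel)"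
    by (intro nn_integral_add lborel.borel_measurable_nn_integral) (use vm1 in simp_all)
  also have "\<dots> \<le> ennreal (8 * pi) * displacement t + ennreal (8 * pi) * displacement t"
    unfolding two by (intro add_mono one)
  also have "\<dots> = ennreal (16 * pi) * displacement t"
    by (simp flip: distrib_right ennreal_plus)
  finally show ?thesis .
qed

lemma pair_cost_integral_total:
  "(\<integral>\<^sup>+y. \<integral>\<^sup>+x. \<integral>\<^sup>+t. pair_cost t x y \<partial>lborel \<partial>lborel \<partial>lborel)
    \<le> ennreal (16 * pi) * (\<integral>\<^sup>+t\<in>{0..1}. displacement t \<partial>lborel)"
proof -
  have m: "(\<lambda>(x, t). pair_cost t x y) \<in> borel_measurable (lborel \<Otimes>\<^sub>M lborel)" for y
  proof -
    have "(\<lambda>(x, t). (t, x, y)) \<in> measurable (borel \<Otimes>\<^sub>M borel) (borel \<Otimes>\<^sub>M borel \<Otimes>\<^sub>M borel)" by measurable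
    from measurable_compose[OF this pair_cost_measurable] show ?thesis by (simp add: case_prod_beta')
  qed
  have m2: "(\<lambda>((y, t), x). pair_cost t x y) \<in> borel_measurable ((lborel \<Otimes>\<^sub>M lborel) \<Otimes>\<^sub>M lborel)"
  proof -
    have "(\<lambda>p. (snd (fst p), snd p, fst (fst p))) \<in> measurable ((borel \<Otimes>\<^sub>M borel) \<Otimes>\<^sub>M borel) (borel \<Otimes>\<^sub>M borel \<Otimes>\<^sub>M borel)" by measurable
    from measurable_compose[OF this pair_cost_measurable] show ?thesis by (simp add: case_prod_beta')
  qed
  have m3: "(\<lambda>(y, x). pair_cost t x y) \<in> borel_measurable (lborel \<Otimes>\<^sub>M lborel)" for t
  proof -
    have "(\<lambda>(y, x). (t, x, y)) \<in> measurable (borel \<Otimes>\<^sub>M borel) (borel \<Otimes>\<^sub>M borel \<Otimes>\<^sub>M borel)" by measurable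
    from measurable_compose[OF this pair_cost_measurable] show ?thesis by (simp add: case_prod_beta')
  qed
  have "(\<integral>\<^sup>+y. \<integral>\<^sup>+x. \<integral>\<^sup>+t. pair_cost t x y \<partial>lborel \<partial>lborel \<partial>lborel)
     = (\<integral>\<^sup>+y. \<integral>\<^sup>+t. \<integral>\<^sup>+x. pair_cost t x y \<partial>lborel \<partial>lborel \<partial>lborel)"
    by (intro nn_integral_cong lborel_pair.Fubini'[symmetric] m)
  also have "\<dots> = (\<integral>\<^sup>+t. \<integral>\<^sup>+y. \<integral>\<^sup>+x. pair_cost t x y \<partial>lborel \<partial>lborel \<partial>lborel)"
  proof (rule lborel_pair.Fubini'[symmetric])
    have "(\<lambda>p. \<integral>\<^sup>+x. pair_cost (snd p) x (fst p) \<partial>lborel) \<in> borel_measurable (lborel \<Otimes>\<^sub>M lborel)"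
      by (rule lborel.borel_measurable_nn_integral) (use m2 in \<open>simp add: case_prod_beta'\<close>)
    then show "(\<lambda>(y, t). \<integral>\<^sup>+x. pair_cost t x y \<partial>lborel) \<in> borel_measurable (lborel \<Otimes>\<^sub>M lborel)"
      by (simp add: case_prod_beta')
  qed
  also have "\<dots> = (\<integral>\<^sup>+t. \<integral>\<^sup>+x. \<integral>\<^sup>+y. pair_cost t x y \<partial>lborel \<partial>lborel \<partial>lborel)"
    by (intro nn_integral_cong lborel_pair.Fubini'[symmetric] m3)
  also have "\<dots> \<le> (\<integral>\<^sup>+t. ennreal (16 * pi) * (displacement t * indicator {0..1} t) \<partial>lborel)"
  proof (rule nn_integral_mono)
    fix t :: real
    show "(\<integral>\<^sup>+x. \<integral>\<^sup>+y. pair_cost t x y \<partial>lborel \<partial>lborel) \<le> ennreal (16 * pi) * (displacement t * indicator {0..1} t)"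
      using pair_cost_integral[of t] by (cases "t \<in> {0..1}") (auto simp: pair_cost_def indicator_times)
  qed
  also have "\<dots> = ennreal (16 * pi) * (\<integral>\<^sup>+t\<in>{0..1}. displacement t \<partial>lborel)"
  proof (rule nn_integral_cmult)
    have D: "{0..1::real} \<times> disc \<in> sets borel" by (intro borel_closed closed_Times) auto
    have [measurable]: "(\<lambda>p. indicator ({0..1::real} \<times> disc) p *\<^sub>R V (fst p) (snd p)) \<in> borel_measurable (borel \<Otimes>\<^sub>M borel)"
      using borel_measurable_continuous_on_indicator[OF D V_cont]
      by (simp add: borel_prod case_prod_beta')
    have "(\<lambda>p. ennreal (norm (indicator ({0..1::real} \<times> disc) p *\<^sub>R V (fst p) (snd p)))) \<in> borel_measurable (borel \<Otimes>\<^sub>M borel)"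
      by measurable
    then have "(\<lambda>t. \<integral>\<^sup>+x. ennreal (norm (indicator ({0..1::real} \<times> disc) (t, x) *\<^sub>R V t x)) \<partial>lborel) \<in> borel_measurable lborel"
      by (intro lborel.borel_measurable_nn_integral) (simp add: case_prod_beta')
    also have "(\<lambda>t. \<integral>\<^sup>+x. ennreal (norm (indicator ({0..1::real} \<times> disc) (t, x) *\<^sub>R V t x)) \<partial>lborel)
       = (\<lambda>t. displacement t * indicator {0..1} t)"
      by (auto simp: displacement_def fun_eq_iff indicator_times indicator_def intro!: nn_integral_cong)
    finally show "(\<lambda>t. displacement t * indicator {0..1} t) \<in> borel_measurable lborel" .
  qed
  finally show ?thesis .
qed

text \<open>The two argument corrections in \<open>angle_bound\<close> have the same integral, since \<open>g\<close> preserves area and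
  norms.  They are shifted by $\pi$ to make them nonnegative.\<close>

lemma twist_lower_bound:
  assumes ab: "0 < a" "b \<le> 1" and \<theta>_nonneg: "\<And>s. a \<le> s \<Longrightarrow> s \<le> b \<Longrightarrow> 0 \<le> \<theta> s"
  shows "(\<integral>\<^sup>+y\<in>{y :: real^2. a \<le> norm y \<and> norm y \<le> b}. ennreal (\<theta> (norm y)) * emeasure lborel (ball (0::real^2) (norm y)) \<partial>lborel)
    \<le> ennreal (16 * pi) * (\<integral>\<^sup>+t\<in>{0..1}. displacement t \<partial>lborel)"
proof -
  let ?S = "{y :: real^2. a \<le> norm y \<and> norm y \<le> b}"
  have S: "?S \<in> sets borel" by measurable
  have SD: "y \<in> disc" if "y \<in> ?S" for y using that ab by (auto simp: mem_disc)
  let ?I = "\<lambda>f. \<integral>\<^sup>+y\<in>?S. f y \<partial>lborel"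
  let ?e = "\<lambda>y. ennreal (\<theta> (norm y)) * emeasure lborel (ball (0::real^2) (norm y))"
  let ?q = "\<lambda>x y. \<integral>\<^sup>+t. pair_cost t x y \<partial>lborel"
  have kg: "(\<integral>\<^sup>+x\<in>disc. correction (g x) (g y) \<partial>lborel) = correction_mass (g y)" for y
    unfolding correction_mass_def
    by (rule area_diff_nn_integral[OF g_area_diff, of "\<lambda>x. correction x (g y)"])
       (use measurable_compose[OF measurable_Pair2' correction_measurable, of "g y"] in simp)
  \<comment> \<open>With \<open>kg\<close>, area preservation has now been applied to x and to y.
    The annulus is invariant because \<open>g\<close> preserves norms.\<close>
  have kI: "?I (\<lambda>y. correction_mass (g y)) = ?I correction_mass"
  proof -
    have "?I (\<lambda>y. correction_mass (g y)) = (\<integral>\<^sup>+y\<in>disc. (correction_mass (g y) * indicator ?S (g y)) \<partial>lborel)"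
      by (intro nn_integral_cong) (use SD norm_g in \<open>auto simp: indicator_def\<close>)
    also have "\<dots> = (\<integral>\<^sup>+y\<in>disc. (correction_mass y * indicator ?S y) \<partial>lborel)"
      by (rule area_diff_nn_integral[OF g_area_diff, of "\<lambda>y. correction_mass y * indicator ?S y"])
         (intro borel_measurable_times_ennreal correction_mass_measurable borel_measurable_indicator S)
    also have "\<dots> = ?I correction_mass"
      by (intro nn_integral_cong) (use SD in \<open>auto simp: indicator_def\<close>)
    finally show ?thesis .
  qed
  \<comment> \<open>Finiteness permits cancelling this term from both sides of an inequality in
    \<open>ennreal\<close> at the end.\<close>
  have kfin: "?I correction_mass < \<infinity>"
  proof -
    have "correction_mass y \<le> ennreal (2 * pi) * emeasure lborel disc" for y
    proof -
      have "correction_mass y \<le> (\<integral>\<^sup>+x\<in>disc. ennreal (2 * pi) \<partial>lborel)"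
        unfolding correction_mass_def by (intro nn_integral_mono mult_right_mono correction_le) auto
      then show ?thesis by (simp add: nn_integral_cmult_indicator)
    qed
    then have "?I correction_mass \<le> (\<integral>\<^sup>+y. (ennreal (2 * pi) * emeasure lborel disc) * indicator disc y \<partial>lborel)"
      by (intro nn_integral_mono) (use SD in \<open>auto simp: indicator_def\<close>)
    also have "\<dots> = ennreal (2 * pi) * emeasure lborel disc * emeasure lborel disc"
      by (simp add: nn_integral_cmult_indicator)
    also have "\<dots> < \<infinity>"
      using emeasure_compact_finite[OF disc_simps(1)] by (auto simp: ennreal_mult_less_top)
    finally show ?thesis .
  qed
  \<comment> \<open>The correction of the image pair stands on the left and that of the pair itself
    on the right, so no subtraction occurs before integration.\<close>
  have pt: "ennreal (\<theta> (norm y)) * indicator (ball (0::real^2) (norm y)) x + correction (g x) (g y) * indicator disc x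
     \<le> ?q x y + correction x y * indicator disc x" if y: "y \<in> ?S" for x y
  proof (cases "norm x < norm y")
    case True
    then have x: "x \<in> disc" and xy: "(x, y) \<in> ordered_pairs" using SD[OF y] by (auto simp: mem_disc ordered_pairs_def)
    have yd: "y \<in> disc" using SD[OF y] .
    let ?c = "arg_correction (cpx x) (cpx y)" and ?cg = "arg_correction (cpx (g x)) (cpx (g y))"
    have th: "0 \<le> \<theta> (norm y)" using y \<theta>_nonneg by auto
    have c: "0 \<le> pi + ?c" "0 \<le> pi + ?cg"
      using abs_arg_correction_less[of "cpx x" "cpx y"] abs_arg_correction_less[of "cpx (g x)" "cpx (g y)"] pi_gt_zero by linarith+
    have "ennreal (\<theta> (norm y)) + ennreal (pi + ?cg) = ennreal ((\<theta> (norm y) + ?cg - ?c) + (pi + ?c))"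
      using th c by (simp add: ennreal_plus[symmetric] del: ennreal_plus)
    \<comment> \<open>The first summand may be negative; \<open>ennreal\<close> then replaces it by
      0, which can only enlarge the right-hand side.\<close>
    also have "\<dots> \<le> ennreal (\<theta> (norm y) + ?cg - ?c) + ennreal (pi + ?c)"
    proof (cases "0 \<le> \<theta> (norm y) + ?cg - ?c")
      case False
      then have "ennreal ((\<theta> (norm y) + ?cg - ?c) + (pi + ?c)) \<le> ennreal (pi + ?c)" by (intro ennreal_leI) simp
      then show ?thesis by (rule order_trans) simp
    qed (use c in \<open>simp add: ennreal_plus[symmetric] del: ennreal_plus\<close>)
    also have "ennreal (\<theta> (norm y) + ?cg - ?c)
       \<le> (\<integral>\<^sup>+t\<in>{0..1}. ennreal ((norm (V t x) + norm (V t y)) / norm (\<gamma> t x - \<gamma> t y)) \<partial>lborel)"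
      by (rule angle_bound[OF xy])
    also have "\<dots> = ?q x y"
      using x yd by (intro nn_integral_cong) (auto simp: pair_cost_def indicator_def)
    finally have "ennreal (\<theta> (norm y)) + ennreal (pi + ?cg) \<le> ?q x y + ennreal (pi + ?c)"
      by (simp add: add_right_mono)
    then show ?thesis using True x yd norm_g by (simp add: correction_def indicator_def)
  next
    case False
    then show ?thesis using norm_g SD[OF y] by (auto simp: correction_def indicator_def)
  qed
  have cm: "(\<lambda>x. correction (g x) (g y) * indicator disc x) \<in> borel_measurable lborel"
    "(\<lambda>x. correction x y * indicator disc x) \<in> borel_measurable lborel" for y
  proof -
    have c1: "(\<lambda>x. correction x z) \<in> borel_measurable borel" for z
      using measurable_compose[OF measurable_Pair2' correction_measurable, of z] by simp
    show "(\<lambda>x. correction (g x) (g y) * indicator disc x) \<in> borel_measurable lborel"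
      using measurable_compose[OF g_measurable c1, of "g y"] by (auto intro!: borel_measurable_times_ennreal)
    show "(\<lambda>x. correction x y * indicator disc x) \<in> borel_measurable lborel"
      using c1 by (auto intro!: borel_measurable_times_ennreal)
  qed
  have qm: "(\<lambda>(y, x). ?q x y) \<in> borel_measurable (borel \<Otimes>\<^sub>M borel)"
  proof -
    have "(\<lambda>p. (snd p, snd (fst p), fst (fst p))) \<in> measurable ((borel \<Otimes>\<^sub>M borel) \<Otimes>\<^sub>M lborel) (borel \<Otimes>\<^sub>M borel \<Otimes>\<^sub>M borel)" by measurable
    from measurable_compose[OF this pair_cost_measurable]
    have "(\<lambda>p. ?q (snd p) (fst p)) \<in> borel_measurable (borel \<Otimes>\<^sub>M borel)"
      by (intro lborel.borel_measurable_nn_integral) (simp add: case_prod_beta')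
    then show ?thesis by (simp add: case_prod_beta')
  qed
  have qm1: "(\<lambda>x. ?q x y) \<in> borel_measurable lborel" for y
    using measurable_compose[OF measurable_Pair1' qm, of y] by simp
  have qm2: "(\<lambda>y. \<integral>\<^sup>+x. ?q x y \<partial>lborel) \<in> borel_measurable borel"
    by (rule lborel.borel_measurable_nn_integral) (use qm in simp)
  have em: "(\<lambda>y. ?e y * indicator ?S y) \<in> borel_measurable borel"
  proof -
    have [measurable]: "(\<lambda>s. indicator {0..1} s *\<^sub>R \<theta> s) \<in> borel_measurable borel"
      by (rule borel_measurable_continuous_on_indicator[OF _ \<theta>_cont]) simp
    have "(\<lambda>y. ennreal (indicator {0..1} (norm y) *\<^sub>R \<theta> (norm y)) * ennreal (pi * (norm y)\<^sup>2) * indicator ?S y)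
       \<in> borel_measurable borel"
      using S by measurable
    also have "(\<lambda>y. ennreal (indicator {0..1} (norm y) *\<^sub>R \<theta> (norm y)) * ennreal (pi * (norm y)\<^sup>2) * indicator ?S y)
       = (\<lambda>y. ?e y * indicator ?S y)"
      using SD by (auto simp: fun_eq_iff indicator_def emeasure_ball unit_ball_vol_2 mem_disc)
    finally show ?thesis .
  qed
  have row: "?e y + correction_mass (g y) \<le> (\<integral>\<^sup>+x. ?q x y \<partial>lborel) + correction_mass y" if y: "y \<in> ?S" for y
  proof -
    have "?e y + correction_mass (g y) = (\<integral>\<^sup>+x. ennreal (\<theta> (norm y)) * indicator (ball (0::real^2) (norm y)) x \<partial>lborel)
        + (\<integral>\<^sup>+x. correction (g x) (g y) * indicator disc x \<partial>lborel)"
      by (simp add: nn_integral_cmult_indicator kg)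
    also have "\<dots> = (\<integral>\<^sup>+x. ennreal (\<theta> (norm y)) * indicator (ball (0::real^2) (norm y)) x + correction (g x) (g y) * indicator disc x \<partial>lborel)"
      by (rule nn_integral_add[symmetric, OF _ cm(1)]) (intro borel_measurable_times_ennreal borel_measurable_indicator; simp)
    also have "\<dots> \<le> (\<integral>\<^sup>+x. ?q x y + correction x y * indicator disc x \<partial>lborel)"
      by (intro nn_integral_mono pt y)
    also have "\<dots> = (\<integral>\<^sup>+x. ?q x y \<partial>lborel) + correction_mass y"
      unfolding correction_mass_def by (rule nn_integral_add[OF qm1 cm(2)])
    finally show ?thesis .
  qed
  have "?I ?e + ?I correction_mass = ?I ?e + ?I (\<lambda>y. correction_mass (g y))" by (simp only: kI)
  also have "\<dots> = ?I (\<lambda>y. ?e y + correction_mass (g y))"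
    using measurable_compose[OF g_measurable correction_mass_measurable] S em
    by (subst nn_integral_add[symmetric]) (auto simp: distrib_right intro!: borel_measurable_times_ennreal)
  also have "\<dots> \<le> ?I (\<lambda>y. (\<integral>\<^sup>+x. ?q x y \<partial>lborel) + correction_mass y)"
    by (rule nn_integral_mono) (use row in \<open>auto simp: indicator_def\<close>)
  also have "\<dots> = ?I (\<lambda>y. \<integral>\<^sup>+x. ?q x y \<partial>lborel) + ?I correction_mass"
    using qm2 correction_mass_measurable S
    by (subst nn_integral_add[symmetric]) (auto simp: distrib_right intro!: borel_measurable_times_ennreal)
  finally have "?I ?e \<le> ?I (\<lambda>y. \<integral>\<^sup>+x. ?q x y \<partial>lborel)"
    using kfin by (auto simp: ennreal_add_left_cancel_le add.commute)
  also have "\<dots> \<le> (\<integral>\<^sup>+y. \<integral>\<^sup>+x. ?q x y \<partial>lborel \<partial>lborel)"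
    by (rule nn_integral_mono) (auto simp: indicator_def)
  also have "\<dots> \<le> ennreal (16 * pi) * (\<integral>\<^sup>+t\<in>{0..1}. displacement t \<partial>lborel)"
    by (rule pair_cost_integral_total)
  finally show ?thesis .
qed

section \<open>From the L^1-displacement to the L^p-length\<close>

lemma set_integrable_Lp_norm:
  assumes p: "1 \<le> p"
  shows "set_integrable lborel {0..1} (\<lambda>t. (LBINT x:disc. norm (V t x) powr p) powr (1 / p))"
proof -
  have "continuous_on ({0..1} \<times> disc) (\<lambda>q. norm (case q of (t, x) \<Rightarrow> V t x) powr p)"
    by (intro continuous_on_powr' continuous_intros V_cont) (use p in auto)
  then have "continuous_on ({0..1} \<times> disc) (\<lambda>(t, x). norm (V t x) powr p)" by (simp add: case_prod_beta')
  from set_integral_swap_disc(2)[OF this]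
  have i: "set_integrable lborel {0..1} (\<lambda>t. LBINT x:disc. norm (V t x) powr p)" .
  have one: "set_integrable lborel {0..1::real} (\<lambda>t. 1 :: real)"
    by (intro continuous_on_compact_absolutely_integrable) auto
  define J where "J t = (LBINT x:disc. norm (V t x) powr p)" for t
  have J0: "0 \<le> J t" for t
    unfolding J_def by (rule set_integral_nonneg_everywhere) simp
  \<comment> \<open>This majorant gives integrability in time. It matters because the integral in
    \<open>Lp_length\<close> would be 0 by default for a non-integrable function.\<close>
  have le: "J t powr (1 / p) \<le> 1 + J t" for t
  proof (cases "J t \<le> 1")
    case True
    then have "J t powr (1 / p) \<le> 1 powr (1 / p)" using J0 p by (intro powr_mono2) auto
    then show ?thesis using J0[of t] by simp
  next
    case False
    then have "J t powr (1 / p) \<le> J t powr 1" using p by (intro powr_mono) auto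
    then show ?thesis using J0[of t] by simp
  qed
  have "set_integrable lborel {0..1} (\<lambda>t. 1 + J t)" using i one unfolding J_def by (rule set_integral_add(1)[rotated])
  then have "set_integrable lborel {0..1} (\<lambda>t. J t powr (1 / p))"
  proof (rule set_integrable_bound)
    have [measurable]: "(\<lambda>t. indicator {0..1} t *\<^sub>R J t) \<in> borel_measurable borel"
      using i borel_measurable_integrable unfolding set_integrable_def J_def by fastforce
    have "(\<lambda>t. indicator {0..1} t *\<^sub>R ((indicator {0..1} t *\<^sub>R J t) powr (1 / p))) \<in> borel_measurable borel" by measurable
    also have "(\<lambda>t. indicator {0..1} t *\<^sub>R ((indicator {0..1} t *\<^sub>R J t) powr (1 / p))) = (\<lambda>t. indicator {0..1} t *\<^sub>R (J t powr (1 / p)))"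
      by (auto simp: fun_eq_iff indicator_def)
    finally show "set_borel_measurable lborel {0..1} (\<lambda>t. J t powr (1 / p))"
      by (simp add: set_borel_measurable_def)
    show "AE x in lborel. x \<in> {0..1} \<longrightarrow> norm (J x powr (1 / p)) \<le> norm (1 + J x)"
      using le J0 by auto
  qed
  then show ?thesis by (simp add: J_def)
qed

text \<open>A weak form of the Hoelder inequality. In both cases z <= M and z > M one has z <= M +
  M^(1-p) z^p; for M above the L^p-norm, integration over the disc of area pi gives (pi + 1) M.
  Taking M strictly larger keeps it positive when the field vanishes, and \<open>dense_ge\<close>
  then passes to the norm itself.\<close>

lemma displacement_le_Lp:
  assumes t: "t \<in> {0..1}" and p: "1 \<le> p"
  shows "displacement t \<le> ennreal ((pi + 1) * (LBINT x:disc. norm (V t x) powr p) powr (1 / p))"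
proof -
  have Vc: "continuous_on disc (V t)" by (rule continuous_on_slices(1)[OF V_cont t])
  note ci = continuous_on_compact_absolutely_integrable(3)[OF disc_simps(1)]
  have i1: "set_integrable lborel disc (\<lambda>x. norm (V t x))" by (intro ci continuous_intros Vc)
  have ip: "set_integrable lborel disc (\<lambda>x. norm (V t x) powr p)"
    by (intro ci continuous_on_powr' continuous_intros Vc) (use p in auto)
  define J where "J = (LBINT x:disc. norm (V t x) powr p)"
  have J0: "0 \<le> J" unfolding J_def by (rule set_integral_nonneg_everywhere) simp
  have bound: "(LBINT x:disc. norm (V t x)) \<le> (pi + 1) * M" if M: "J powr (1 / p) < M" for M
  proof -
    have M0: "0 < M" using M J0 by (meson le_less_trans powr_ge_zero)
    have "J = (J powr (1 / p)) powr p" using J0 p by (simp add: powr_powr)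
    also have "\<dots> \<le> M powr p" using M p by (intro powr_mono2) auto
    finally have JM: "J \<le> M powr p" .
    have pt: "norm (V t x) \<le> M + M powr (1 - p) * norm (V t x) powr p" for x
    proof (cases "norm (V t x) \<le> M")
      case True
      then show ?thesis by (simp add: add_increasing2)
    next
      case False
      then have n: "0 < norm (V t x)" "1 \<le> norm (V t x) / M" using M0 by auto
      have "norm (V t x) / M = (norm (V t x) / M) powr 1" using n M0 by simp
      also have "\<dots> \<le> (norm (V t x) / M) powr p" using n(2) p by (intro powr_mono) auto
      finally have "norm (V t x) \<le> M * (norm (V t x) / M) powr p" using M0 by (simp add: field_simps)
      also have "\<dots> = M powr (1 - p) * norm (V t x) powr p"
      proof -
        have M1: "M powr 1 = M" using M0 by simp
        show ?thesis unfolding powr_divide powr_diff M1 by simp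
      qed
      finally show ?thesis using M0 by simp
    qed
    have "(LBINT x:disc. norm (V t x)) \<le> (LBINT x:disc. M + M powr (1 - p) * norm (V t x) powr p)"
      by (intro set_integral_mono i1 set_integral_add(1) set_integrable_mult_right set_integral_const_disc ip) (rule pt)
    also have "\<dots> = M * pi + M powr (1 - p) * J"
      by (subst set_integral_add(2)[OF set_integral_const_disc(1) set_integrable_mult_right])
         (simp_all add: ip J_def set_integral_const_disc(2))
    also have "\<dots> \<le> M * pi + M powr (1 - p) * M powr p" using JM by (intro add_left_mono mult_left_mono) auto
    also have "\<dots> = (pi + 1) * M" using M0 by (simp add: powr_add[symmetric] algebra_simps)
    finally show ?thesis .
  qed
  have pi1: "0 < pi + 1" using pi_gt_zero by linarith
  have "(LBINT x:disc. norm (V t x)) / (pi + 1) \<le> J powr (1 / p)"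
  proof (rule dense_ge)
    fix M assume "J powr (1 / p) < M"
    from bound[OF this] show "(LBINT x:disc. norm (V t x)) / (pi + 1) \<le> M"
      by (simp only: pos_divide_le_eq[OF pi1] mult.commute)
  qed
  then have le: "(LBINT x:disc. norm (V t x)) \<le> (pi + 1) * J powr (1 / p)"
    by (simp only: pos_divide_le_eq[OF pi1] mult.commute)
  have "displacement t = (\<integral>\<^sup>+x. ennreal (indicator disc x *\<^sub>R norm (V t x)) \<partial>lborel)"
    unfolding displacement_def by (intro nn_integral_cong) (auto simp: indicator_def)
  also have "\<dots> = ennreal (LBINT x:disc. norm (V t x))"
    unfolding set_lebesgue_integral_def by (rule nn_integral_eq_integral) (use i1 in \<open>auto simp: set_integrable_def\<close>)
  finally show ?thesis using le by (simp add: J_def ennreal_leI)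
qed

lemma nn_integral_displacement_le_Lp_length:
  assumes p: "1 \<le> p"
  shows "(\<integral>\<^sup>+t\<in>{0..1}. displacement t \<partial>lborel) \<le> ennreal ((pi + 1) * Lp_length p \<gamma>)"
proof -
  define N where "N t = (LBINT x:disc. norm (V t x) powr p) powr (1 / p)" for t
  have "(LBINT x:disc. norm (vector_derivative (\<lambda>s. \<gamma> s x) (at t within {0..1})) powr p) powr (1 / p) = N t"
    if "t \<in> {0..1}" for t
    unfolding N_def
    using vector_derivative_within_closed_interval[OF zero_less_one that V[OF that]]
    by (intro arg_cong[where f = "\<lambda>z. z powr (1 / p)"] set_lebesgue_integral_cong) auto
  then have len: "Lp_length p \<gamma> = (LBINT t:{0..1}. N t)"
    unfolding Lp_length_def by (intro set_lebesgue_integral_cong) auto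
  have Ni: "set_integrable lborel {0..1} (\<lambda>t. (pi + 1) * N t)"
    unfolding N_def by (intro set_integrable_mult_right impI set_integrable_Lp_norm p)
  have "(\<integral>\<^sup>+t\<in>{0..1}. displacement t \<partial>lborel) \<le> (\<integral>\<^sup>+t. ennreal (indicator {0..1} t *\<^sub>R ((pi + 1) * N t)) \<partial>lborel)"
    by (intro nn_integral_mono) (use displacement_le_Lp[OF _ p] in \<open>auto simp: indicator_def N_def\<close>)
  also have "\<dots> = ennreal (LBINT t:{0..1}. (pi + 1) * N t)"
    unfolding set_lebesgue_integral_def
    by (rule nn_integral_eq_integral)
       (use Ni in \<open>auto simp: set_integrable_def N_def intro!: mult_nonneg_nonneg add_nonneg_nonneg\<close>)
  finally show ?thesis by (simp add: len)
qed

end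

section \<open>Twist maps\<close>

definition rot :: "real \<Rightarrow> real^2 \<Rightarrow> real^2" where
  "rot a x = vector [cos a * x $ 1 - sin a * x $ 2, sin a * x $ 1 + cos a * x $ 2]"

text \<open>The angle depends on the squared norm, a polynomial in the coordinates, so a smooth
  \<theta> gives a map that is smooth at the origin as well.\<close>

definition twist_map :: "(real \<Rightarrow> real) \<Rightarrow> real^2 \<Rightarrow> real^2" where
  "twist_map \<theta> x = rot (\<theta> ((norm x)\<^sup>2)) x"

lemma cpx_rot: "cpx (rot a x) = cis a * cpx x"
  by (simp add: cpx_def rot_def complex_eq_iff)

lemma norm_rot [simp]: "norm (rot a x) = norm x"
  by (metis cpx_rot norm_cpx norm_cis norm_mult mult_1)

lemma rot_rot: "rot a (rot b x) = rot (a + b) x"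
  by (metis cpx_rot cpx_eq_iff cis_mult mult.assoc)

lemma rot_0 [simp]: "rot 0 x = x"
  by (metis cpx_rot cpx_eq_iff cis_zero mult_1)

lemma norm_twist_map [simp]: "norm (twist_map \<theta> x) = norm x"
  by (simp add: twist_map_def)

lemma twist_map_add: "twist_map (\<lambda>s. \<theta> s + \<eta> s) = twist_map \<theta> \<circ> twist_map \<eta>"
  by (simp add: fun_eq_iff twist_map_def rot_rot)

lemma twist_map_0 [simp]: "twist_map (\<lambda>s. 0) = id"
  by (simp add: fun_eq_iff twist_map_def)

lemma norm_power2_Ck_on: "open S \<Longrightarrow> Ck_on n S (\<lambda>x::real^2. (norm x)\<^sup>2)"
  unfolding power2_norm_eq_inner by (intro Ck_on_inner Ck_on_bounded_linear bounded_linear_ident)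

lemma rot_Ck_on:
  assumes S: "open S" and "Ck_on n S a" "Ck_on n S y"
  shows "Ck_on n S (\<lambda>z. rot (a z) (y z))"
proof -
  have c: "Ck_on n S (\<lambda>z. y z $ i)" for i
    using Ck_on_inner[OF S assms(3) Ck_on_const[OF S, of n "axis i 1"]] by (simp add: inner_axis)
  have m: "Ck_on n S (\<lambda>z. - (sin (a z) * y z $ 2))"
    using Ck_on_mult[OF S Ck_on_const[OF S, of n "- 1 :: real"] Ck_on_mult[OF S Ck_on_sin_cos(1)[OF S assms(2)] c[of 2]]]
    by simp
  have "Ck_on n S (\<lambda>z. (cos (a z) * y z $ 1 + - (sin (a z) * y z $ 2)) *\<^sub>R axis 1 1
     + (sin (a z) * y z $ 1 + cos (a z) * y z $ 2) *\<^sub>R (axis 2 1 :: real^2))"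
    by (intro Ck_on_add Ck_on_scaleR Ck_on_mult Ck_on_const Ck_on_sin_cos S c m assms)
  then show ?thesis by (simp add: rot_def vector_2_eq)
qed

lemma Lp_length_nonneg: "0 \<le> Lp_length p \<gamma>"
  unfolding Lp_length_def by (intro set_integral_nonneg_everywhere) simp

text \<open>\<open>f 0\<close> is a Hamiltonian as a function of s = |x|^2 and \<open>f k\<close> is
  its k-th derivative, in the form that \<open>Ck_on_compose_real\<close> expects.\<close>

locale smooth_profile =
  fixes f :: "nat \<Rightarrow> real \<Rightarrow> real" and q :: real
  assumes f_deriv: "\<And>k s. (f k has_real_derivative f (Suc k) s) (at s)"
    and f_supp: "\<And>k s. q \<le> s \<Longrightarrow> f k s = 0" and q: "0 < q" "q < 1"
begin

text \<open>The angular speed under the Hamiltonian f 0 (|x|^2): its field is -2 f 1 (|x|^2) times x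
  turned by pi/2.\<close>

definition \<theta> :: "real \<Rightarrow> real" where "\<theta> s = - 2 * f 1 s"

lemma radial_Ck_on: "open S \<Longrightarrow> Ck_on n S (\<lambda>x::real^2. f k ((norm x)\<^sup>2))"
  by (rule Ck_on_compose_real[where h = f and k = k, OF _ f_deriv norm_power2_Ck_on])

lemma angle_Ck_on: "Ck_on n UNIV (\<lambda>x::real^2. \<theta> ((norm x)\<^sup>2))"
  unfolding \<theta>_def by (intro Ck_on_mult Ck_on_const radial_Ck_on) auto

lemma \<theta>_supp: "q \<le> s \<Longrightarrow> \<theta> s = 0"
  by (simp add: \<theta>_def f_supp)

lemma sqrt_q: "sqrt q < 1" "sqrt q \<le> norm (x::real^2) \<Longrightarrow> q \<le> (norm x)\<^sup>2"
  using q real_sqrt_le_iff[of q "(norm x)\<^sup>2"] by auto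

lemma twist_supp: "sqrt q \<le> norm x \<Longrightarrow> twist_map (\<lambda>s. c * \<theta> s) x = x"
  using sqrt_q(2) by (simp add: twist_map_def \<theta>_supp)

lemma twist_permutes: "twist_map (\<lambda>s. c * \<theta> s) permutes disc"
  and twist_inv: "inv (twist_map (\<lambda>s. c * \<theta> s)) = twist_map (\<lambda>s. - c * \<theta> s)"
proof -
  have comp: "twist_map (\<lambda>s. c * \<theta> s) \<circ> twist_map (\<lambda>s. - c * \<theta> s) = id"
    "twist_map (\<lambda>s. - c * \<theta> s) \<circ> twist_map (\<lambda>s. c * \<theta> s) = id"
    by (simp_all flip: twist_map_add)
  show "inv (twist_map (\<lambda>s. c * \<theta> s)) = twist_map (\<lambda>s. - c * \<theta> s)"
    by (rule inv_unique_comp[OF comp])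
  have "twist_map (\<lambda>s. c * \<theta> s) x = x" if "x \<notin> disc" for x
  proof (rule twist_supp)
    show "sqrt q \<le> norm x" using that sqrt_q(1) unfolding mem_disc by linarith
  qed
  then show "twist_map (\<lambda>s. c * \<theta> s) permutes disc"
    using o_bij[OF comp(2,1)] unfolding permutes_def bij_iff by blast
qed

lemma twist_smooth_joint:
  "smooth_on ({0..1} \<times> disc) (\<lambda>(t, x). twist_map (\<lambda>s. t * \<theta> s) x)"
proof -
  have "Ck_on k UNIV (\<lambda>z::real \<times> (real^2). twist_map (\<lambda>s. fst z * \<theta> s) (snd z))" for k
    unfolding twist_map_def
  proof (intro rot_Ck_on Ck_on_mult)
    have s: "Ck_on k UNIV (\<lambda>z::real \<times> (real^2). (norm (snd z))\<^sup>2)"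
      unfolding power2_norm_eq_inner by (intro Ck_on_inner Ck_on_bounded_linear bounded_linear_snd) auto
    show "Ck_on k UNIV (\<lambda>z::real \<times> (real^2). \<theta> ((norm (snd z))\<^sup>2))"
      unfolding \<theta>_def by (intro Ck_on_mult Ck_on_const Ck_on_compose_real[where h = f and k = 1, OF _ f_deriv s]) auto
  qed (auto intro: Ck_on_bounded_linear bounded_linear_fst bounded_linear_snd)
  then show ?thesis unfolding smooth_on_def
    by (intro exI[of _ UNIV] exI[of _ "\<lambda>z. twist_map (\<lambda>s. fst z * \<theta> s) (snd z)"]) auto
qed

lemma twist_smooth: "smooth_on disc (twist_map (\<lambda>s. c * \<theta> s))"
proof -
  have "Ck_on k UNIV (twist_map (\<lambda>s. c * \<theta> s))" for k
    unfolding twist_map_def[abs_def]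
    by (intro rot_Ck_on Ck_on_mult Ck_on_const angle_Ck_on Ck_on_bounded_linear bounded_linear_ident) auto
  then show ?thesis unfolding smooth_on_def by blast
qed

lemma norm_power2_has_derivative:
  "((\<lambda>x::real^2. (norm x)\<^sup>2) has_derivative (\<lambda>v. 2 * (x $ 1 * v $ 1 + x $ 2 * v $ 2))) (at x within S)"
proof -
  have "((\<lambda>x::real^2. x \<bullet> x) has_derivative (\<lambda>v. x \<bullet> v + v \<bullet> x)) (at x within S)"
    by (intro has_derivative_inner has_derivative_ident)
  then show ?thesis
    by (simp add: power2_norm_eq_inner inner_vec_def sum_2 algebra_simps)
qed

lemma radial_has_derivative:
  "((\<lambda>x::real^2. f k ((norm x)\<^sup>2)) has_derivative
     (\<lambda>v. 2 * (x $ 1 * v $ 1 + x $ 2 * v $ 2) * f (Suc k) ((norm x)\<^sup>2))) (at x within S)"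
  by (rule DERIV_compose_FDERIV[OF f_deriv norm_power2_has_derivative])

text \<open>The angle varies only radially and a change of angle moves points tangentially, so the
  derivative is a rotation times a shear. In the determinant all terms containing the derivative of
  the angle cancel.\<close>

lemma twist_area:
  assumes A: "A \<in> sets lebesgue" "A \<subseteq> disc"
  shows "emeasure lebesgue (twist_map (\<lambda>s. c * \<theta> s) ` A) = emeasure lebesgue A"
proof -
  let ?g = "twist_map (\<lambda>s. c * \<theta> s)"
  define a where "a x = c * \<theta> ((norm x)\<^sup>2)" for x :: "real^2"
  define a' where "a' x v = - 4 * c * f (Suc 1) ((norm x)\<^sup>2) * (x $ 1 * v $ 1 + x $ 2 * v $ 2)" for x v :: "real^2"
  define g' :: "real^2 \<Rightarrow> real^2 \<Rightarrow> real^2" where "g' x v = vector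
     [cos (a x) * v $ 1 - sin (a x) * v $ 2 - a' x v * (sin (a x) * x $ 1 + cos (a x) * x $ 2),
      sin (a x) * v $ 1 + cos (a x) * v $ 2 + a' x v * (cos (a x) * x $ 1 - sin (a x) * x $ 2)]" for x v
  have da: "(a has_derivative a' x) (at x within A)" for x
    unfolding a_def a'_def \<theta>_def
    using has_derivative_mult_right[OF radial_has_derivative[of 1 x A], of "- 2 * c"]
    by (simp add: algebra_simps)
  have dg: "(?g has_derivative g' x) (at x within A)" for x
  proof -
    have dc: "((\<lambda>x. x $ i) has_derivative (\<lambda>v. v $ i)) (at x within A)" for i :: 2
      by (rule bounded_linear_imp_has_derivative[OF bounded_linear_vec_nth])
    have ds: "((\<lambda>x. sin (a x)) has_derivative (\<lambda>v. a' x v * cos (a x))) (at x within A)"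
      "((\<lambda>x. cos (a x)) has_derivative (\<lambda>v. a' x v * - sin (a x))) (at x within A)"
      by (rule DERIV_compose_FDERIV[OF DERIV_sin da] DERIV_compose_FDERIV[OF DERIV_cos da])+
    have "((\<lambda>x. vector [cos (a x) * x $ 1 - sin (a x) * x $ 2, sin (a x) * x $ 1 + cos (a x) * x $ 2])
      has_derivative g' x) (at x within A)"
      by (rule has_derivative_eq_rhs[OF has_derivative_vector_2[OF
            has_derivative_diff[OF has_derivative_mult[OF ds(2) dc[of 1]] has_derivative_mult[OF ds(1) dc[of 2]]]
            has_derivative_add[OF has_derivative_mult[OF ds(1) dc[of 1]] has_derivative_mult[OF ds(2) dc[of 2]]]]])
         (simp add: fun_eq_iff g'_def vec_eq_iff forall_2 algebra_simps)
    then show ?thesis by (simp add: twist_map_def[abs_def] rot_def a_def)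
  qed
  have det: "\<bar>det (matrix (g' x))\<bar> = 1" for x
  proof -
    define C S k where "C = cos (a x)" and "S = sin (a x)" and "k = - 4 * c * f (Suc 1) ((norm x)\<^sup>2)"
    have CS: "S * S + C * C = 1" using sin_cos_squared_add[of "a x"] by (simp add: C_def S_def power2_eq_square)
    have "det (matrix (g' x)) =
       (C - k * x $ 1 * (S * x $ 1 + C * x $ 2)) * (C + k * x $ 2 * (C * x $ 1 - S * x $ 2))
       - (- S - k * x $ 2 * (S * x $ 1 + C * x $ 2)) * (S + k * x $ 1 * (C * x $ 1 - S * x $ 2))"
      by (simp add: det_2 matrix_2_entries g'_def a'_def C_def S_def k_def axis_def)
    also have "\<dots> = S * S + C * C" by (simp add: algebra_simps)
    finally show ?thesis using CS by simp
  qed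
  have inj: "inj_on ?g A" using permutes_inj[OF twist_permutes] by (rule inj_on_subset) auto
  have Am: "A \<in> lmeasurable"
    using bounded_set_imp_lmeasurable[OF bounded_subset[OF disc_simps(7) A(2)] A(1)] .
  have "((\<lambda>x. \<bar>det (matrix (g' x))\<bar>) has_integral measure lebesgue A) A"
    unfolding det using lmeasurable_iff_integrable_on[of A] lmeasure_integral[OF Am] Am by (simp add: has_integral_iff)
  then have m: "?g ` A \<in> lmeasurable" "measure lebesgue (?g ` A) = measure lebesgue A"
    using has_measure_differentiable_image[OF A(1) dg inj] by auto
  then show ?thesis
    using emeasure_eq_ennreal_measure[OF fmeasurableD2[OF m(1)]] emeasure_eq_ennreal_measure[OF fmeasurableD2[OF Am]] by simp
qed

lemma twist_area_diff: "twist_map (\<lambda>s. c * \<theta> s) \<in> area_diff"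
  unfolding area_diff_def
proof (intro CollectI conjI ballI impI)
  show "smooth_on disc (inv (twist_map (\<lambda>s. c * \<theta> s)))" unfolding twist_inv by (rule twist_smooth)
  show "\<exists>r<1. \<forall>x\<in>disc. r \<le> norm x \<longrightarrow> twist_map (\<lambda>s. c * \<theta> s) x = x"
    using twist_supp sqrt_q(1) by blast
qed (rule twist_permutes twist_smooth twist_area; assumption?)+

lemma twist_isotopic: "smooth_isotopy (\<lambda>t. twist_map (\<lambda>s. t * \<theta> s)) id (twist_map \<theta>)"
  unfolding smooth_isotopy_def using twist_area_diff twist_smooth_joint by simp

section \<open>Length of the twisting isotopy, bounds for the norm, and the Calabi invariant of a
  twist\<close>

lemma rot_path_has_vector_derivative:
  "((\<lambda>t. rot (t * a) x) has_vector_derivative a *\<^sub>R rot (t * a + pi / 2) x) (at t within S)"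
proof -
  have "((\<lambda>t. vector [cos (t * a) * x $ 1 - sin (t * a) * x $ 2, sin (t * a) * x $ 1 + cos (t * a) * x $ 2] :: real^2)
     has_derivative (\<lambda>h. vector [h * (a * (- sin (t * a) * x $ 1 - cos (t * a) * x $ 2)),
        h * (a * (cos (t * a) * x $ 1 - sin (t * a) * x $ 2))])) (at t within S)"
    by (intro has_derivative_vector_2) (auto intro!: derivative_eq_intros simp: algebra_simps)
  moreover have "vector [h * (a * (- sin (t * a) * x $ 1 - cos (t * a) * x $ 2)),
        h * (a * (cos (t * a) * x $ 1 - sin (t * a) * x $ 2))] = h *\<^sub>R (a *\<^sub>R rot (t * a + pi / 2) x)" for h
    by (simp add: vec_eq_iff forall_2 rot_def sin_add cos_add)
  ultimately show ?thesis unfolding has_vector_derivative_def rot_def[symmetric] by simp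
qed

text \<open>Each point turns at constant speed at most M, so the length is at most M pi^(1/p); as pi
  is at least 1, this is at most M pi for every p.\<close>

lemma Lp_length_twist:
  assumes p: "1 \<le> p" and M: "\<And>s. 0 \<le> s \<Longrightarrow> s \<le> 1 \<Longrightarrow> \<bar>\<theta> s\<bar> \<le> M"
  shows "Lp_length p (\<lambda>t. twist_map (\<lambda>s. t * \<theta> s)) \<le> M * pi"
proof -
  define J where "J = (LBINT x:disc. (\<bar>\<theta> ((norm x)\<^sup>2)\<bar> * norm (x::real^2)) powr p)"
  have M0: "0 \<le> M" using M[of 0] by simp
  have speed: "norm (vector_derivative (\<lambda>s. twist_map (\<lambda>s'. s * \<theta> s') x) (at t within {0..1})) = \<bar>\<theta> ((norm x)\<^sup>2)\<bar> * norm x"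
    if t: "t \<in> {0..1}" for t x
  proof -
    have "vector_derivative (\<lambda>s. twist_map (\<lambda>s'. s * \<theta> s') x) (at t within {0..1})
       = \<theta> ((norm x)\<^sup>2) *\<^sub>R rot (t * \<theta> ((norm x)\<^sup>2) + pi / 2) x"
      unfolding twist_map_def
      by (rule vector_derivative_within_closed_interval[OF zero_less_one t rot_path_has_vector_derivative])
    then show ?thesis by simp
  qed
  have "(LBINT x:disc. norm (vector_derivative (\<lambda>s. twist_map (\<lambda>s'. s * \<theta> s') x) (at t within {0..1})) powr p) powr (1 / p)
     = J powr (1 / p)" if "t \<in> {0..1}" for t
    by (simp only: speed[OF that] J_def)
  then have "Lp_length p (\<lambda>t. twist_map (\<lambda>s. t * \<theta> s)) = (LBINT t:{0..1::real}. J powr (1 / p))"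
    unfolding Lp_length_def by (auto intro!: set_lebesgue_integral_cong)
  also have "\<dots> = J powr (1 / p)" by (simp add: set_lebesgue_integral_def)
  also have "\<dots> \<le> (M powr p * pi) powr (1 / p)"
  proof (intro powr_mono2)
    show "0 \<le> J" unfolding J_def by (rule set_integral_nonneg_everywhere) simp
    have "J \<le> (LBINT x:disc. M powr p)"
      unfolding J_def
    proof (rule set_integral_mono)
      have "continuous_on disc (\<lambda>x::real^2. \<theta> ((norm x)\<^sup>2))"
        using angle_Ck_on[of 0] by (auto intro: continuous_on_subset)
      then show "set_integrable lborel disc (\<lambda>x::real^2. (\<bar>\<theta> ((norm x)\<^sup>2)\<bar> * norm x) powr p)"
        using p by (intro continuous_on_compact_absolutely_integrable continuous_on_powr' continuous_intros) auto
      show "set_integrable lborel disc (\<lambda>x. M powr p)"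
        by (rule set_integral_const_disc(1))
      fix x :: "real^2" assume "x \<in> disc"
      then have n: "0 \<le> norm x" "norm x \<le> 1" by (auto simp: mem_disc)
      then have "\<bar>\<theta> ((norm x)\<^sup>2)\<bar> * norm x \<le> M * 1"
        using M0 by (intro mult_mono M) (auto simp: power_le_one)
      then show "(\<bar>\<theta> ((norm x)\<^sup>2)\<bar> * norm x) powr p \<le> M powr p" using p by (intro powr_mono2) auto
    qed
    also have "\<dots> = M powr p * pi"
      by (rule set_integral_const_disc(2))
    finally show "J \<le> M powr p * pi" .
  qed (use p in simp)
  also have "\<dots> = M * pi powr (1 / p)"
    using M0 p by (simp add: powr_mult powr_powr)
  also have "\<dots> \<le> M * pi powr 1"
    using p pi_ge_two M0 by (intro mult_left_mono powr_mono) auto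
  finally show ?thesis by simp
qed

lemma Lp_norm_twist_le:
  assumes p: "1 \<le> p" and M: "\<And>s. 0 \<le> s \<Longrightarrow> s \<le> 1 \<Longrightarrow> \<bar>\<theta> s\<bar> \<le> M"
  shows "Lp_norm p (twist_map \<theta>) \<le> M * pi"
proof -
  have "bdd_below {Lp_length p \<gamma> |\<gamma>. smooth_isotopy \<gamma> id (twist_map \<theta>)}"
    using Lp_length_nonneg by (intro bdd_belowI[of _ 0]) auto
  then have "Lp_norm p (twist_map \<theta>) \<le> Lp_length p (\<lambda>t. twist_map (\<lambda>s. t * \<theta> s))"
    unfolding Lp_norm_def Lp_dist_def by (intro cInf_lower) (use twist_isotopic in auto)
  also have "\<dots> \<le> M * pi" by (rule Lp_length_twist[OF p M])
  finally show ?thesis .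
qed

text \<open>For y in the annulus the ball of radius |y| has area at least pi a^2 and the angle is at
  least \<open>m\<close>. The resulting bound holds for the length of every isotopy, hence for the
  infimum.\<close>

lemma Lp_norm_twist_ge:
  assumes p: "1 \<le> p" and ab: "0 < a" "b \<le> 1" and m: "0 \<le> m" "\<And>s. a\<^sup>2 \<le> s \<Longrightarrow> s \<le> b\<^sup>2 \<Longrightarrow> m \<le> \<theta> s"
  shows "m * (pi * a\<^sup>2) * measure lborel {y :: real^2. a \<le> norm y \<and> norm y \<le> b}
     \<le> 16 * pi * (pi + 1) * Lp_norm p (twist_map \<theta>)"
proof -
  let ?S = "{y :: real^2. a \<le> norm y \<and> norm y \<le> b}"
  let ?c = "m * (pi * a\<^sup>2) * measure lborel ?S"
  have Sf: "emeasure lborel ?S < \<infinity>"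
  proof -
    have "emeasure lborel ?S \<le> emeasure lborel disc"
      using ab by (intro emeasure_mono) (auto simp: mem_disc)
    also have "\<dots> < \<infinity>" by (rule emeasure_compact_finite) simp
    finally show ?thesis .
  qed
  have Sm: "?S \<in> sets borel" by measurable
  have le: "?c \<le> 16 * pi * (pi + 1) * Lp_length p \<gamma>" if iso: "smooth_isotopy \<gamma> id (twist_map \<theta>)" for \<gamma>
  proof -
    obtain V where V: "continuous_on ({0..1} \<times> disc) (\<lambda>(t, x). V t x)"
      "\<And>t x. t \<in> {0..1} \<Longrightarrow> x \<in> disc \<Longrightarrow> ((\<lambda>s. \<gamma> s x) has_vector_derivative V t x) (at t within {0..1})"
      using smooth_isotopy_velocity[OF iso] by metis
    \<comment> \<open>Squaring the argument converts the profile from the squared norm of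
      \<open>twist_map\<close> to the norm used by the locale.\<close>
    interpret twist_isotopy \<gamma> "twist_map \<theta>" "\<lambda>s. \<theta> (s\<^sup>2)" V
    proof
      have "continuous_on UNIV (f 1)" by (intro continuous_at_imp_continuous_on ballI DERIV_isCont[OF f_deriv])
      then have "continuous_on {0..1} (\<lambda>s::real. f 1 (s\<^sup>2))"
        by (rule continuous_on_compose2) (auto intro!: continuous_intros)
      then show "continuous_on {0..1} (\<lambda>s. \<theta> (s\<^sup>2))"
        unfolding \<theta>_def by (intro continuous_on_mult continuous_on_const)
      show "\<theta> (1\<^sup>2) = 0" using \<theta>_supp q by simp
      fix x :: "real^2"
      show "cpx (twist_map \<theta> x) = cis (\<theta> ((norm x)\<^sup>2)) * cpx x" by (simp add: twist_map_def cpx_rot)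
    qed (use iso V in auto)
    have "ennreal ?c = (\<integral>\<^sup>+y\<in>?S. ennreal (m * (pi * a\<^sup>2)) \<partial>lborel)"
      using Sm Sf m by (simp add: nn_integral_cmult_indicator ennreal_mult emeasure_eq_ennreal_measure)
    also have "\<dots> \<le> (\<integral>\<^sup>+y\<in>?S. ennreal (\<theta> ((norm y)\<^sup>2)) * emeasure lborel (ball (0::real^2) (norm y)) \<partial>lborel)"
    proof (intro nn_integral_mono)
      fix y :: "real^2"
      show "ennreal (m * (pi * a\<^sup>2)) * indicator ?S y \<le> ennreal (\<theta> ((norm y)\<^sup>2)) * emeasure lborel (ball (0::real^2) (norm y)) * indicator ?S y"
      proof (cases "y \<in> ?S")
        case True
        then have s: "a\<^sup>2 \<le> (norm y)\<^sup>2" "(norm y)\<^sup>2 \<le> b\<^sup>2" using ab by (auto intro!: power_mono)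
        have "m * (pi * a\<^sup>2) \<le> \<theta> ((norm y)\<^sup>2) * (pi * (norm y)\<^sup>2)"
          using m s by (intro mult_mono order_trans[OF m(1) m(2)[OF s]]) auto
        then have "ennreal (m * (pi * a\<^sup>2)) \<le> ennreal (\<theta> ((norm y)\<^sup>2)) * ennreal (pi * (norm y)\<^sup>2)"
          using m s order_trans[OF m(1) m(2)[OF s]] by (simp add: ennreal_mult[symmetric] ennreal_leI)
        then show ?thesis using True by (simp add: emeasure_ball unit_ball_vol_2)
      qed simp
    qed
    also have "\<dots> \<le> ennreal (16 * pi) * (\<integral>\<^sup>+t\<in>{0..1}. displacement t \<partial>lborel)"
    proof (rule twist_lower_bound[OF ab])
      fix s assume "a \<le> s" "s \<le> b"
      then show "0 \<le> \<theta> (s\<^sup>2)" using m ab order_trans[OF m(1) m(2)] by (simp add: power_mono)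
    qed
    also have "\<dots> \<le> ennreal (16 * pi) * ennreal ((pi + 1) * Lp_length p \<gamma>)"
      by (intro mult_left_mono nn_integral_displacement_le_Lp_length p) auto
    also have "\<dots> = ennreal (16 * pi * ((pi + 1) * Lp_length p \<gamma>))"
      by (rule ennreal_mult'[symmetric]) simp
    finally have "ennreal ?c \<le> ennreal (16 * pi * ((pi + 1) * Lp_length p \<gamma>))" .
    then show ?thesis using Lp_length_nonneg[of p \<gamma>] by (simp add: mult.assoc)
  qed
  have b: "0 < 16 * pi * (pi + 1)" by (intro mult_pos_pos add_pos_pos) auto
  have "?c / (16 * pi * (pi + 1)) \<le> Lp_norm p (twist_map \<theta>)"
    unfolding Lp_norm_def Lp_dist_def
  proof (rule cInf_greatest)
    show "{Lp_length p \<gamma> |\<gamma>. smooth_isotopy \<gamma> id (twist_map \<theta>)} \<noteq> {}" using twist_isotopic by blast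
    fix l assume "l \<in> {Lp_length p \<gamma> |\<gamma>. smooth_isotopy \<gamma> id (twist_map \<theta>)}"
    then obtain \<gamma> where l: "l = Lp_length p \<gamma>" "smooth_isotopy \<gamma> id (twist_map \<theta>)" by blast
    show "?c / (16 * pi * (pi + 1)) \<le> l"
      using le[OF l(2)] unfolding l(1) pos_divide_le_eq[OF b] by (simp only: mult.commute[of "Lp_length p \<gamma>"])
  qed
  then show ?thesis unfolding pos_divide_le_eq[OF b] by (simp only: mult.commute[of "Lp_norm p (twist_map \<theta>)"])
qed

text \<open>The autonomous Hamiltonian f 0 (|x|^2) generates the twist: its field is tangent to
  circles around 0, and each circle turns uniformly. By \<open>calabi_eq\<close> this one generator
  determines the invariant.\<close>

lemma calabi_twist: "calabi (twist_map \<theta>) = 2 * (LBINT x:disc. f 0 ((norm x)\<^sup>2))"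
proof -
  let ?H = "\<lambda>(t::real) (x::real^2). f 0 ((norm x)\<^sup>2)"
  have "hamiltonian ?H"
    unfolding hamiltonian_def
  proof
    have "Ck_on k UNIV (\<lambda>z::real \<times> (real^2). f 0 ((norm (snd z))\<^sup>2))" for k
    proof -
      have s: "Ck_on k UNIV (\<lambda>z::real \<times> (real^2). (norm (snd z))\<^sup>2)"
        unfolding power2_norm_eq_inner by (intro Ck_on_inner Ck_on_bounded_linear bounded_linear_snd) auto
      show ?thesis by (rule Ck_on_compose_real[where h = f and k = 0, OF _ f_deriv s]) simp
    qed
    then show "smooth_on ({0..1} \<times> disc) (\<lambda>(t, x). ?H t x)"
      unfolding smooth_on_def
      by (intro exI[of _ UNIV] exI[of _ "\<lambda>z. f 0 ((norm (snd z))\<^sup>2)"]) auto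
    show "\<exists>r<1. \<forall>t\<in>{0..1}. \<forall>x\<in>disc. r \<le> norm x \<longrightarrow> ?H t x = 0"
      using sqrt_q f_supp by blast
  qed
  moreover have "ham_flow ?H (\<lambda>t. twist_map (\<lambda>s. t * \<theta> s))"
    unfolding ham_flow_def
  proof (intro ballI conjI)
    fix x :: "real^2" and t :: real assume x: "x \<in> disc" and t: "t \<in> {0..1}"
    define y where "y = twist_map (\<lambda>s. t * \<theta> s) x"
    show yd: "twist_map (\<lambda>s. t * \<theta> s) x \<in> disc" using x by (simp add: mem_disc)
    have "frechet_derivative (?H t) (at y within disc) = (\<lambda>v. 2 * (y $ 1 * v $ 1 + y $ 2 * v $ 2) * f 1 ((norm y)\<^sup>2))"
      using frechet_derivative_disc[OF radial_has_derivative[of 0 y disc]] yd by (simp add: y_def)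
    then have "ham_field (?H t) y = \<theta> ((norm x)\<^sup>2) *\<^sub>R rot (pi / 2) y"
      by (simp add: ham_field_def \<theta>_def y_def axis_def vec_eq_iff forall_2 rot_def)
    then have "ham_field (?H t) y = \<theta> ((norm x)\<^sup>2) *\<^sub>R rot (t * \<theta> ((norm x)\<^sup>2) + pi / 2) x"
      by (simp add: y_def twist_map_def rot_rot add.commute)
    then show "((\<lambda>s. twist_map (\<lambda>s'. s * \<theta> s') x) has_vector_derivative ham_field (?H t) (twist_map (\<lambda>s. t * \<theta> s) x)) (at t within {0..1})"
      using rot_path_has_vector_derivative[of "\<theta> ((norm x)\<^sup>2)" x t "{0..1}"] unfolding y_def by (simp add: twist_map_def)
  qed (simp add: twist_map_def)
  ultimately have "generates ?H (twist_map \<theta>)" unfolding generates_def by auto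
  from calabi_eq[OF this] show ?thesis by (simp add: set_lebesgue_integral_def)
qed

end

section \<open>The embedding\<close>

lemma flat_0: "flat 0 x = (if x > 0 then exp (- (1 / x)) else 0)"
  by (simp add: flat_def flat_poly_def)

lemma flat_1: "flat (Suc 0) x = (if x > 0 then (1 / x)\<^sup>2 * exp (- (1 / x)) else 0)"
  by (simp add: flat_def flat_poly_def power2_eq_square)

lemma flat_nonpos: "x \<le> 0 \<Longrightarrow> flat k x = 0"
  by (simp add: flat_def)

lemma flat_0_bounds: "0 \<le> flat 0 x" "flat 0 x \<le> 1"
  by (auto simp: flat_0)

lemma flat_1_nonneg: "0 \<le> flat (Suc 0) x"
  by (simp add: flat_1)

lemma flat_1_pos: "0 < x \<Longrightarrow> 0 < flat (Suc 0) x"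
  by (simp add: flat_1)

lemma flat_1_le: "flat (Suc 0) x \<le> 2"
proof (cases "x > 0")
  case True
  have "(1 / x)\<^sup>2 / 2 \<le> exp (1 / x)"
    using exp_lower_Taylor_quadratic[of "1 / x"] True by (smt (verit) zero_le_divide_1_iff)
  then have "(1 / x)\<^sup>2 * exp (- (1 / x)) \<le> 2 * exp (1 / x) * exp (- (1 / x))"
    by (intro mult_right_mono) auto
  then show ?thesis using True by (simp add: flat_1 mult.assoc flip: exp_add)
qed (simp add: flat_1)

text \<open>The lower limit 1/8 is the source of the constant e^(-8) below; the factor 1/x^2 in the
  derivative is at least 1 for x up to 1.\<close>

lemma flat_lower:
  assumes "1 / 8 \<le> x" "x \<le> 1"
  shows "exp (- 8) \<le> flat 0 x" "exp (- 8) \<le> flat (Suc 0) x"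
proof -
  have y: "1 \<le> 1 / x" "1 / x \<le> 8" using assms by (auto simp: field_simps)
  then have e: "exp (- 8) \<le> exp (- (1 / x))" by simp
  then show "exp (- 8) \<le> flat 0 x" using assms by (simp add: flat_0)
  have "1 * exp (- 8) \<le> (1 / x)\<^sup>2 * exp (- (1 / x))"
    using e y by (intro mult_mono one_le_power) auto
  then show "exp (- 8) \<le> flat (Suc 0) x" using assms by (simp add: flat_1)
qed

definition radial_integral :: "(real \<Rightarrow> real) \<Rightarrow> real" where
  "radial_integral u = (LBINT x:disc. u ((norm x)\<^sup>2))"

text \<open>Strictly decreasing from 5/6 to the limit 1/2. Distinct end points give injectivity;
  staying above 1/2 leaves a margin of more than 1/8 beyond s = 9/25, so all outer bumps are bounded
  below on one annulus.\<close>

definition \<rho> :: "nat \<Rightarrow> real" where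
  "\<rho> i = 1 / 2 + 1 / (real i + 3)"

text \<open>The inner bump is scaled such that the Calabi invariant of every \<open>bump i\<close> vanishes.  It does not
  reach the annulus $1/2 \le |y|$, where only the outer bump with end point \<open>\<rho> i\<close> acts.\<close>

definition coeff_inner :: "nat \<Rightarrow> real" where
  "coeff_inner i = radial_integral (\<lambda>s. flat 0 (\<rho> i - s)) / radial_integral (\<lambda>s. flat 0 (1 / 4 - s))"

text \<open>The sign arises because \<open>flat\<close> is evaluated at an end point minus s, so
  that each derivative in s contributes a factor -1.\<close>

definition bump :: "nat \<Rightarrow> nat \<Rightarrow> real \<Rightarrow> real" where
  "bump i k s = (- 1) ^ k * (flat k (\<rho> i - s) - coeff_inner i * flat k (1 / 4 - s))"

definition profile :: "(nat \<Rightarrow>\<^sub>0 real) \<Rightarrow> nat \<Rightarrow> real \<Rightarrow> real" where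
  "profile v k s = (\<Sum>i\<in>Poly_Mapping.keys v. Poly_Mapping.lookup v i * bump i k s)"

lemma \<rho>_bounds: "1 / 2 < \<rho> i" "\<rho> i \<le> 5 / 6"
  by (auto simp: \<rho>_def field_simps)

lemma \<rho>_strict_antimono: "i < j \<Longrightarrow> \<rho> j < \<rho> i"
  by (simp add: \<rho>_def frac_less2)

lemma flat_shift_deriv: "((\<lambda>s. flat k (c - s)) has_real_derivative - flat (Suc k) (c - s)) (at s)"
proof -
  have "((\<lambda>s. c - s) has_real_derivative - 1) (at s)" by (auto intro!: derivative_eq_intros)
  from DERIV_chain2[OF flat_has_derivative this] show ?thesis by simp
qed

lemma profile_deriv: "(profile v k has_real_derivative profile v (Suc k) s) (at s)"
proof -
  have "(bump i k has_real_derivative bump i (Suc k) s) (at s)" for i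
    unfolding bump_def[abs_def]
    by (rule derivative_eq_intros flat_shift_deriv refl | simp add: algebra_simps)+
  then show ?thesis
    unfolding profile_def[abs_def] by (intro DERIV_sum DERIV_cmult)
qed

lemma profile_supp: "5 / 6 \<le> s \<Longrightarrow> profile v k s = 0"
proof -
  assume "5 / 6 \<le> s"
  then have "bump i k s = 0" for i using \<rho>_bounds(2)[of i] by (simp add: bump_def flat_nonpos)
  then show ?thesis by (simp add: profile_def)
qed

interpretation profile: smooth_profile "profile v" "5 / 6" for v
  by unfold_locales (auto intro: profile_deriv profile_supp)

definition twist_embedding :: "(nat \<Rightarrow>\<^sub>0 real) \<Rightarrow> real^2 \<Rightarrow> real^2" where
  "twist_embedding v = twist_map (profile.\<theta> v)"

lemma profile_superset:
  assumes "finite A" "Poly_Mapping.keys v \<subseteq> A"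
  shows "profile v k s = (\<Sum>i\<in>A. Poly_Mapping.lookup v i * bump i k s)"
  unfolding profile_def
  by (rule sum.mono_neutral_left) (use assms in \<open>auto simp: in_keys_iff\<close>)

lemma profile_add: "profile (v + w) k s = profile v k s + profile w k s"
proof -
  let ?A = "Poly_Mapping.keys v \<union> Poly_Mapping.keys w"
  have A: "finite ?A" "Poly_Mapping.keys (v + w) \<subseteq> ?A" by (auto simp: Poly_Mapping.keys_add)
  then have "profile (v + w) k s = (\<Sum>i\<in>?A. Poly_Mapping.lookup (v + w) i * bump i k s)" by (rule profile_superset)
  also have "\<dots> = (\<Sum>i\<in>?A. Poly_Mapping.lookup v i * bump i k s) + (\<Sum>i\<in>?A. Poly_Mapping.lookup w i * bump i k s)"
    by (simp add: lookup_add distrib_right sum.distrib)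
  finally show ?thesis using A(1) profile_superset[of ?A v] profile_superset[of ?A w] by simp
qed

lemma twist_embedding_add: "twist_embedding (v + w) = twist_embedding v \<circ> twist_embedding w"
proof -
  have "profile.\<theta> (v + w) = (\<lambda>s. profile.\<theta> v s + profile.\<theta> w s)"
    by (simp add: fun_eq_iff profile.\<theta>_def profile_add)
  then show ?thesis by (simp add: twist_embedding_def twist_map_add)
qed

lemma radial_integrable:
  "set_integrable lborel disc (\<lambda>x. flat 0 (c - (norm x)\<^sup>2))"
proof -
  have "continuous_on UNIV (flat 0)"
    by (intro continuous_at_imp_continuous_on ballI DERIV_isCont[OF flat_has_derivative])
  then have "continuous_on disc (\<lambda>x::real^2. flat 0 (c - (norm x)\<^sup>2))"
    by (rule continuous_on_compose2) (auto intro!: continuous_intros)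
  then show ?thesis by (intro continuous_on_compact_absolutely_integrable) auto
qed

lemma area_cball: "0 \<le> r \<Longrightarrow> measure lborel (cball (0::real^2) r) = pi * r\<^sup>2"
  by (simp add: content_cball unit_ball_vol_2)

text \<open>On the ball of radius 1/4 the argument 1/4 - |x|^2 is at least 3/16, hence above 1/8,
  and \<open>flat_lower\<close> applies. This keeps the denominator of \<open>coeff_inner\<close>
  away from 0.\<close>

lemma radial_integral_inner_pos: "0 < radial_integral (\<lambda>s. flat 0 (1 / 4 - s))"
proof -
  have "exp (- 8) * (pi * (1 / 4)\<^sup>2) = (LBINT x:(cball 0 (1 / 4) :: (real^2) set). exp (- 8))"
    using area_cball[of "1 / 4"] by (simp add: set_lebesgue_integral_def mult.commute)
  also have "\<dots> \<le> (LBINT x:(cball 0 (1 / 4) :: (real^2) set). flat 0 (1 / 4 - (norm x)\<^sup>2))"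
  proof (rule set_integral_mono)
    show "set_integrable lborel (cball 0 (1 / 4) :: (real^2) set) (\<lambda>x. exp (- 8) :: real)"
      by (intro continuous_on_compact_absolutely_integrable) auto
    show "set_integrable lborel (cball 0 (1 / 4) :: (real^2) set) (\<lambda>x. flat 0 (1 / 4 - (norm x)\<^sup>2))"
      by (rule set_integrable_subset[OF radial_integrable]) (auto simp: mem_disc)
    fix x :: "real^2" assume "x \<in> cball 0 (1 / 4)"
    then have "(norm x)\<^sup>2 \<le> (1 / 4)\<^sup>2" by (intro power_mono) auto
    then have "(norm x)\<^sup>2 \<le> 1 / 16" by (simp add: power_divide)
    then show "exp (- 8) \<le> flat 0 (1 / 4 - (norm x)\<^sup>2)"
      by (intro flat_lower) (use zero_le_power2[of "norm x"] in linarith)+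
  qed
  also have "\<dots> \<le> (LBINT x:disc. flat 0 (1 / 4 - (norm x)\<^sup>2))"
  proof -
    have sub: "cball 0 (1 / 4) \<subseteq> disc" by (auto simp: mem_disc)
    show ?thesis
      using set_integrable_subset[OF radial_integrable[of "1 / 4"] _ sub] radial_integrable[of "1 / 4"]
      unfolding set_lebesgue_integral_def set_integrable_def
      by (intro integral_mono) (use sub in \<open>auto simp: flat_0_bounds indicator_def\<close>)
  qed
  finally have "exp (- 8) * (pi * (1 / 4)\<^sup>2) \<le> radial_integral (\<lambda>s. flat 0 (1 / 4 - s))"
    by (simp add: radial_integral_def)
  then show ?thesis by (rule less_le_trans[rotated]) simp
qed

text \<open>A bound for all \<open>coeff_inner i\<close> at once, with numerator pi because
  \<open>flat 0\<close> is at most 1 on a disc of area pi. Uniformity in i is what yields one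
  Lipschitz constant.\<close>

definition coeff_max :: real where "coeff_max = pi / radial_integral (\<lambda>s. flat 0 (1 / 4 - s))"

lemma coeff_inner_bounds: "0 \<le> coeff_inner i" "coeff_inner i \<le> coeff_max"
proof -
  have "0 \<le> radial_integral (\<lambda>s. flat 0 (\<rho> i - s))"
    unfolding radial_integral_def by (rule set_integral_nonneg_everywhere) (rule flat_0_bounds)
  moreover have "radial_integral (\<lambda>s. flat 0 (\<rho> i - s)) \<le> (LBINT x:disc. 1)"
    unfolding radial_integral_def
    by (rule set_integral_mono[OF radial_integrable set_integral_const_disc(1)])
       (auto simp: flat_0_bounds)
  then have "radial_integral (\<lambda>s. flat 0 (\<rho> i - s)) \<le> pi"
    by (simp add: set_integral_const_disc)
  ultimately show "0 \<le> coeff_inner i" "coeff_inner i \<le> coeff_max"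
    using radial_integral_inner_pos by (auto simp: coeff_inner_def coeff_max_def divide_right_mono)
qed

lemma bump_integral: "(LBINT x:disc. bump i 0 ((norm x)\<^sup>2)) = 0"
    and bump_integrable: "set_integrable lborel disc (\<lambda>x. bump i 0 ((norm x)\<^sup>2))"
proof -
  have i: "set_integrable lborel disc (\<lambda>x. flat 0 (\<rho> i - (norm x)\<^sup>2))"
    "set_integrable lborel disc (\<lambda>x. coeff_inner i * flat 0 (1 / 4 - (norm x)\<^sup>2))"
    by (intro radial_integrable set_integrable_mult_right impI)+
  show "(LBINT x:disc. bump i 0 ((norm x)\<^sup>2)) = 0"
    using set_integral_diff(2)[OF i] radial_integral_inner_pos
    by (simp add: bump_def coeff_inner_def radial_integral_def)
  show "set_integrable lborel disc (\<lambda>x. bump i 0 ((norm x)\<^sup>2))"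
    using set_integral_diff(1)[OF i] by (simp add: bump_def)
qed

lemma calabi_twist_embedding: "calabi (twist_embedding v) = 0"
proof -
  have "(LBINT x:disc. profile v 0 ((norm x)\<^sup>2))
    = (\<Sum>i\<in>Poly_Mapping.keys v. (LBINT x:disc. Poly_Mapping.lookup v i * bump i 0 ((norm x)\<^sup>2)))"
    unfolding profile_def set_lebesgue_integral_def scaleR_sum_right
    by (rule Bochner_Integration.integral_sum)
       (use set_integrable_mult_right[OF bump_integrable] in \<open>auto simp: set_integrable_def\<close>)
  also have "\<dots> = 0" by (simp add: bump_integral)
  finally show ?thesis by (simp add: twist_embedding_def profile.calabi_twist)
qed

lemma twist_embedding_ker_calabi: "twist_embedding v \<in> ker_calabi"
  using profile.twist_area_diff[of 1 v] calabi_twist_embedding[of v] by (simp add: ker_calabi_def twist_embedding_def)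

lemma \<theta>_eq: "profile.\<theta> v s
  = (\<Sum>i\<in>Poly_Mapping.keys v. Poly_Mapping.lookup v i * (2 * (flat (Suc 0) (\<rho> i - s) - coeff_inner i * flat (Suc 0) (1 / 4 - s))))"
  by (simp add: profile.\<theta>_def profile_def bump_def sum_distrib_left mult_ac)

section \<open>Bounds for the angle and the norm in terms of the l1-norm\<close>

lemma l1_norm_Rinf_plus: "v \<in> Rinf_plus \<Longrightarrow> l1_norm v = (\<Sum>i\<in>Poly_Mapping.keys v. Poly_Mapping.lookup v i)"
  by (simp add: l1_norm_def Rinf_plus_def)

text \<open>Each bump contributes 2 (a - b) with a between 0 and 2 and b between 0 and 2
  \<open>coeff_max\<close>, since the first derivative of the flat function is at most 2.\<close>

lemma \<theta>_upper:
  assumes "v \<in> Rinf_plus"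
  shows "\<bar>profile.\<theta> v s\<bar> \<le> (4 + 4 * coeff_max) * l1_norm v"
proof -
  have "\<bar>profile.\<theta> v s\<bar> \<le> (\<Sum>i\<in>Poly_Mapping.keys v. Poly_Mapping.lookup v i * (4 + 4 * coeff_max))"
    unfolding \<theta>_eq
  proof (rule order_trans[OF sum_abs sum_mono])
    fix i
    have "coeff_inner i * flat (Suc 0) (1 / 4 - s) \<le> coeff_max * 2"
      using coeff_inner_bounds[of i] flat_1_le flat_1_nonneg by (intro mult_mono) auto
    moreover have "0 \<le> coeff_inner i * flat (Suc 0) (1 / 4 - s)"
      using coeff_inner_bounds[of i] flat_1_nonneg by simp
    moreover have "\<bar>2 * (a - b)\<bar> \<le> 4 + 4 * coeff_max" if "0 \<le> a" "a \<le> 2" "0 \<le> b" "b \<le> coeff_max * 2" for a b :: real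
      using that coeff_inner_bounds[of i] by (auto simp: abs_le_iff)
    ultimately have "\<bar>2 * (flat (Suc 0) (\<rho> i - s) - coeff_inner i * flat (Suc 0) (1 / 4 - s))\<bar> \<le> 4 + 4 * coeff_max"
      using flat_1_le flat_1_nonneg by blast
    then show "\<bar>Poly_Mapping.lookup v i * (2 * (flat (Suc 0) (\<rho> i - s) - coeff_inner i * flat (Suc 0) (1 / 4 - s)))\<bar>
      \<le> Poly_Mapping.lookup v i * (4 + 4 * coeff_max)"
      using assms by (simp only: abs_mult[of "Poly_Mapping.lookup v i"]) (auto simp: Rinf_plus_def intro!: mult_left_mono)
  qed
  then show ?thesis using assms by (simp add: l1_norm_Rinf_plus sum_distrib_right mult.commute)
qed

text \<open>For s at least 1/4 the inner bump is 0, and for s at most 9/25 every end point is more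
  than 1/8 away. Nonnegative coordinates let the contributions add up to the l1-norm.\<close>

lemma \<theta>_lower:
  assumes "v \<in> Rinf_plus" and s: "(1 / 2)\<^sup>2 \<le> s" "s \<le> (3 / 5)\<^sup>2"
  shows "2 * exp (- 8) * l1_norm v \<le> profile.\<theta> v s"
proof -
  have "(\<Sum>i\<in>Poly_Mapping.keys v. Poly_Mapping.lookup v i * (2 * exp (- 8))) \<le> profile.\<theta> v s"
    unfolding \<theta>_eq
  proof (intro sum_mono mult_left_mono)
    fix i
    have "flat (Suc 0) (1 / 4 - s) = 0" using s by (intro flat_nonpos) (simp add: power2_eq_square)
    moreover have "exp (- 8) \<le> flat (Suc 0) (\<rho> i - s)"
      using s \<rho>_bounds[of i] by (intro flat_lower) (auto simp: power2_eq_square)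
    ultimately show "exp (- 8) \<le> flat (Suc 0) (\<rho> i - s) - coeff_inner i * flat (Suc 0) (1 / 4 - s)" by simp
  qed (use assms in \<open>auto simp: Rinf_plus_def\<close>)
  then show ?thesis using assms by (simp add: l1_norm_Rinf_plus sum_distrib_right mult.commute)
qed

lemma annulus_pos: "0 < measure lborel {y :: real^2. 1 / 2 \<le> norm y \<and> norm y \<le> 3 / 5}"
proof -
  \<comment> \<open>11/20 lies halfway between the radii 1/2 and 3/5, and the radius 1/20 used for
    the ball is half their difference.\<close>
  let ?c = "axis 1 (11 / 20) :: real^2"
  have nc: "norm ?c = 11 / 20" using norm_scaleR[of "11 / 20" "axis 1 1 :: real^2"] by (simp add: axis_def norm_vec_def L2_set_def sum_2)
  have sub: "cball ?c (1 / 20) \<subseteq> {y. 1 / 2 \<le> norm y \<and> norm y \<le> 3 / 5}"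
  proof
    fix y assume "y \<in> cball ?c (1 / 20)"
    then have "norm (?c - y) \<le> 1 / 20" by (simp add: dist_norm)
    then show "y \<in> {y. 1 / 2 \<le> norm y \<and> norm y \<le> 3 / 5}"
      using norm_triangle_ineq2[of ?c y] norm_triangle_ineq2[of y ?c] nc by (simp add: norm_minus_commute)
  qed
  have S: "{y :: real^2. 1 / 2 \<le> norm y \<and> norm y \<le> 3 / 5} \<in> sets borel" by measurable
  have "emeasure lborel {y :: real^2. 1 / 2 \<le> norm y \<and> norm y \<le> 3 / 5} \<le> emeasure lborel disc"
    by (intro emeasure_mono) (auto simp: mem_disc)
  then have fin: "{y :: real^2. 1 / 2 \<le> norm y \<and> norm y \<le> 3 / 5} \<in> fmeasurable lborel"
    using S emeasure_compact_finite[of "disc :: (real^2) set"] by (intro fmeasurableI) (auto intro: le_less_trans)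
  have "0 < measure lborel (cball ?c (1 / 20))" by simp
  also have "\<dots> \<le> measure lborel {y :: real^2. 1 / 2 \<le> norm y \<and> norm y \<le> 3 / 5}"
    by (rule measure_mono_fmeasurable[OF sub _ fin]) simp
  finally show ?thesis .
qed

lemma l1_norm_nonneg: "0 \<le> l1_norm v"
  by (simp add: l1_norm_def sum_nonneg)

lemma twist_embedding_lower:
  obtains c where "0 < c" "\<And>p v. 1 \<le> p \<Longrightarrow> v \<in> Rinf_plus \<Longrightarrow> c * l1_norm v \<le> Lp_norm p (twist_embedding v)"
proof -
  let ?m = "measure lborel {y :: real^2. 1 / 2 \<le> norm y \<and> norm y \<le> 3 / 5}"
  let ?a = "2 * exp (- 8) * (pi * (1 / 2)\<^sup>2) * ?m" and ?b = "16 * pi * (pi + 1)"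
  have b: "0 < ?b" by (intro mult_pos_pos add_pos_pos) auto
  have "?a / ?b * l1_norm v \<le> Lp_norm p (twist_embedding v)" if "1 \<le> p" "v \<in> Rinf_plus" for p v
  proof -
    have "2 * exp (- 8) * l1_norm v * (pi * (1 / 2)\<^sup>2) * ?m \<le> ?b * Lp_norm p (twist_embedding v)"
      unfolding twist_embedding_def
      by (rule profile.Lp_norm_twist_ge) (use that \<theta>_lower l1_norm_nonneg in auto)
    then have "?a * l1_norm v \<le> ?b * Lp_norm p (twist_embedding v)" by (simp add: mult_ac)
    then show ?thesis
      unfolding times_divide_eq_left pos_divide_le_eq[OF b] by (simp only: mult.commute[of "Lp_norm p (twist_embedding v)"])
  qed
  moreover have "0 < ?a / ?b" using annulus_pos by (intro divide_pos_pos[OF _ b] mult_pos_pos) auto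
  ultimately show thesis using that by blast
qed

lemma twist_embedding_upper:
  assumes "1 \<le> p" "v \<in> Rinf_plus"
  shows "Lp_norm p (twist_embedding v) \<le> (4 + 4 * coeff_max) * pi * l1_norm v"
  using profile.Lp_norm_twist_le[of p v "(4 + 4 * coeff_max) * l1_norm v"] \<theta>_upper[OF assms(2)] assms(1)
  by (simp add: twist_embedding_def mult_ac)

text \<open>Equal maps determine the angle only modulo 2 pi, but the difference of the angles is
  continuous in s and 0 at s = 1. Hence it is 0 for all s from 1/4 to 1, where only outer bumps act,
  and their distinct end points separate the coordinates.\<close>

lemma twist_embedding_inj: "inj twist_embedding"
proof (rule injI, rule ccontr)
  fix v w assume eq: "twist_embedding v = twist_embedding w" and ne: "v \<noteq> w"
  define D where "D s = profile.\<theta> v s - profile.\<theta> w s" for s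
  have Dint: "\<exists>n::int. D s = 2 * pi * n" if s: "s \<in> {1/4..1}" for s
  proof -
    define x where "x = sqrt s *\<^sub>R (axis 1 1 :: real^2)"
    have x: "(norm x)\<^sup>2 = s" "x \<noteq> 0" using s by (auto simp: x_def)
    have "cis (profile.\<theta> v s) * cpx x = cis (profile.\<theta> w s) * cpx x"
      using arg_cong[OF fun_cong[OF eq, of x], of cpx] by (simp add: twist_embedding_def twist_map_def cpx_rot x)
    then have "cis (profile.\<theta> v s) = cis (profile.\<theta> w s)" using x cpx_eq_iff[of x 0] by simp
    then have "cis (D s) = 1" by (simp add: D_def flip: cis_divide)
    then have "cos (D s) = 1" by (metis cis.sel(1) one_complex.sel(1))
    then show ?thesis unfolding cos_one_2pi_int by (auto simp: mult_ac)
  qed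
  have Dc: "continuous_on {1/4..1} D"
  proof -
    have "isCont (profile u k) s" for u k s by (rule DERIV_isCont[OF profile_deriv])
    then show ?thesis unfolding D_def profile.\<theta>_def by (intro continuous_at_imp_continuous_on ballI continuous_intros)
  qed
  have "D constant_on {1/4..1}"
  proof (rule continuous_discrete_range_constant[OF _ Dc])
    fix s :: real assume s: "s \<in> {1/4..1}"
    show "\<exists>e>0. \<forall>y. y \<in> {1/4..1} \<and> D y \<noteq> D s \<longrightarrow> e \<le> norm (D y - D s)"
    proof (intro exI[of _ "2 * pi"] conjI allI impI)
      fix y assume y: "y \<in> {1/4..1} \<and> D y \<noteq> D s"
      obtain n m :: int where nm: "D s = 2 * pi * n" "D y = 2 * pi * m" using Dint s y by meson
      then have "1 \<le> \<bar>real_of_int (m - n)\<bar>" using y by auto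
      moreover have "norm (D y - D s) = 2 * pi * \<bar>real_of_int (m - n)\<bar>"
        unfolding nm by (simp add: abs_mult flip: right_diff_distrib)
      ultimately show "2 * pi \<le> norm (D y - D s)" using mult_left_mono[of 1 "\<bar>real_of_int (m - n)\<bar>" "2 * pi"] by simp
    qed simp
  qed simp
  moreover have "D 1 = 0" by (simp add: D_def profile.\<theta>_supp)
  ultimately have D0: "D s = 0" if "s \<in> {1/4..1}" for s using that unfolding constant_on_def by force
  define i where "i = (LEAST i. Poly_Mapping.lookup v i \<noteq> Poly_Mapping.lookup w i)"
  have "\<exists>i. Poly_Mapping.lookup v i \<noteq> Poly_Mapping.lookup w i" using ne by (auto intro: poly_mapping_eqI)
  then have i: "Poly_Mapping.lookup v i \<noteq> Poly_Mapping.lookup w i" unfolding i_def by (rule LeastI_ex)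
  have below: "Poly_Mapping.lookup v j = Poly_Mapping.lookup w j" if "j < i" for j
    using not_less_Least[of j] that unfolding i_def by blast
  \<comment> \<open>At s = \<open>\<rho> (Suc i)\<close> all bumps of index above i vanish, the
    coordinates of index below i agree, and the bump of index i is still positive. So the first
    coordinate in which v and w differ is isolated.\<close>
  let ?A = "insert i (Poly_Mapping.keys v \<union> Poly_Mapping.keys w)" and ?s = "\<rho> (Suc i)"
  let ?l = "\<lambda>u i. Poly_Mapping.lookup u i"
  have th: "profile.\<theta> u ?s = (\<Sum>j\<in>?A. ?l u j * (2 * flat (Suc 0) (\<rho> j - ?s)))" if "Poly_Mapping.keys u \<subseteq> ?A" for u
  proof -
    have "flat (Suc 0) (1 / 4 - ?s) = 0" using \<rho>_bounds(1)[of "Suc i"] by (intro flat_nonpos) simp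
    then have "- 2 * (?l u j * bump j 1 ?s) = ?l u j * (2 * flat (Suc 0) (\<rho> j - ?s))" for j
      by (simp add: bump_def)
    then show ?thesis
      unfolding profile.\<theta>_def using profile_superset[OF _ that, of 1 ?s] by (simp only: sum_distrib_left finite_keys finite_insert finite_Un simp_thms)
  qed
  have "D ?s = (\<Sum>j\<in>?A. (?l v j - ?l w j) * (2 * flat (Suc 0) (\<rho> j - ?s)))"
    unfolding D_def left_diff_distrib sum_subtractf by (subst (1 2) th) auto
  also have "\<dots> = (\<Sum>j\<in>{i}. (?l v j - ?l w j) * (2 * flat (Suc 0) (\<rho> j - ?s)))"
  proof (rule sum.mono_neutral_right)
    show "\<forall>j\<in>?A - {i}. (?l v j - ?l w j) * (2 * flat (Suc 0) (\<rho> j - ?s)) = 0"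
    proof
      fix j assume "j \<in> ?A - {i}"
      then have "j \<noteq> i" by simp
      then consider "j < i" | "j = Suc i" | "Suc i < j" by linarith
      then show "(?l v j - ?l w j) * (2 * flat (Suc 0) (\<rho> j - ?s)) = 0"
        by cases (use below \<rho>_strict_antimono[of "Suc i" j] in \<open>auto simp: flat_nonpos\<close>)
    qed
  qed auto
  also have "\<dots> \<noteq> 0" using i flat_1_pos[of "\<rho> i - ?s"] \<rho>_strict_antimono[of i "Suc i"] by simp
  finally show False using D0[of ?s] \<rho>_bounds[of "Suc i"] by simp
qed

lemma twist_embedding_bilipschitz:
  assumes "1 \<le> p"
  shows "bilipschitz_embedding p ker_calabi twist_embedding"
proof -
  obtain c where c: "0 < c" "\<And>v. v \<in> Rinf_plus \<Longrightarrow> c * l1_norm v \<le> Lp_norm p (twist_embedding v)"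
    using twist_embedding_lower assms by metis
  define A where "A = max 1 (max (inverse c) ((4 + 4 * coeff_max) * pi))"
  have A: "1 \<le> A" "inverse c \<le> A" "(4 + 4 * coeff_max) * pi \<le> A" by (auto simp: A_def)
  have "inverse A \<le> c" using A(2) c(1) le_imp_inverse_le[OF A(2)] by simp
  then have "inverse A * l1_norm v \<le> Lp_norm p (twist_embedding v) \<and> Lp_norm p (twist_embedding v) \<le> A * l1_norm v"
    if "v \<in> Rinf_plus" for v
    using c(2)[OF that] twist_embedding_upper[OF assms that] mult_right_mono[OF _ l1_norm_nonneg, of "inverse A" c v]
      mult_right_mono[OF A(3) l1_norm_nonneg, of v] by linarith
  then show ?thesis
    unfolding bilipschitz_embedding_def
    using A(1) twist_embedding_ker_calabi twist_embedding_add inj_on_subset[OF twist_embedding_inj subset_UNIV] by blast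
qed

theorem theorem5:
  fixes p :: real
  assumes "1 \<le> p"
  shows "(\<exists>\<Psi>. bilipschitz_embedding p area_diff \<Psi>) \<and>
         (\<exists>\<Psi>. bilipschitz_embedding p ker_calabi \<Psi>)"
proof -
  have "bilipschitz_embedding p ker_calabi twist_embedding" by (rule twist_embedding_bilipschitz[OF assms])
  moreover from this have "bilipschitz_embedding p area_diff twist_embedding"
    unfolding bilipschitz_embedding_def ker_calabi_def by blast
  ultimately show ?thesis by blast
qed

end
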